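(* For every integer $q\ge 4$, the pretzel knot $P(3,-3,q)$ has thin Khovanov homology over $\mathbb{Z}$.
   Context: **Thinness.** The Khovanov homology of a knot $K$ over $\mathbb{Z}$ is thin if it is supported (torsion included) on two adjacent diagonals, i.e. there is an integer $s$ such that the part of $Kh^i(K)$ in quantum grading $j$ is zero unless $j-2i\in\{s-1,s+1\}$. **Smoothings.** The $0$-smoothing of a crossing joins the two regions swept out when the overstrand is rotated counterclockwise until it meets the understrand; the $1$-smoothing is the other one. (For a positive crossing of an oriented link the $0$-smoothing is the oriented one.) **Pretzel links.** For integers $a_1,a_2,a_3$, $P(a_1,a_2,a_3)$ is the link with the standard pretzel diagram: three vertical two-strand columns placed side by side, the $i$-th consisting of $|a_i|$ crossings (half twists) stacked vertically, with the top right end of each column joined to the top left end of the next (cyclically) and likewise at the bottom. The sign of $a_i$ determines the handedness of the twists: in a column with $a_i>0$ the $0$-smoothing of each crossing is the horizontal one (a cup above a cap, cutting the column into an upper and a lower part) and the $1$-smoothing is the vertical one; in a column with $a_i<0$ the roles are exchanged. With this convention the $q$ crossings of the third column of $P(3,-3,q)$ ($q>0$) are positive crossings. **Khovanov homology.** Let $R$ be a commutative ring (here $R=\mathbb{Z}$) and let $A$ be the free graded $R$-module on $\mathbf{1}$ (quantum grading $1$) and $\mathbf{X}$ (quantum grading $-1$); quantum gradings add under tensor product, and $\{k\}$ shifts quantum grading up by $k$. Define $m:A\otimes A\to A$ by $m(\mathbf 1\otimes\mathbf 1)=\mathbf 1$, $m(\mathbf 1\otimes\mathbf X)=m(\mathbf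 X\otimes\mathbf 1)=\mathbf X$, $m(\mathbf X\otimes\mathbf X)=0$, and $\Delta:A\to A\otimes A$ by $\Delta(\mathbf 1)=\mathbf 1\otimes\mathbf X+\mathbf X\otimes\mathbf 1$, $\Delta(\mathbf X)=\mathbf X\otimes\mathbf X$. For an oriented link diagram $D$ with $n$ ordered crossings, each $v\in\{0,1\}^n$ gives a complete smoothing $D_v$, a collection of $k_v$ disjoint circles; let $w(v)$ be the number of $1$'s in $v$ and assign to $v$ the module $A^{\otimes k_v}\{w(v)\}$. Each edge of the cube (changing one $0$ to a $1$) is assigned $m$ or $\Delta$ on the factors of the circles that merge or split (identity on the others), with signs inserted so that all squares anticommute. Let $\overline{CKh}^i(D)=\bigoplus_{w(v)=i}A^{\otimes k_v}\{w(v)\}$ with differential the sum of the edge maps. Let $n_+,n_-$ be the numbers of positive and negative crossings of $D$. The Khovanov homology is $Kh^i(D)=H^{i+n_-}(\overline{CKh}(D))\{n_+-2n_-\}$, a quantum-graded module for each homological degree $i$; up to isomorphism it is a link invariant. *)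

theory Defs
  imports "HOL-Algebra.Free_Abelian_Groups" "HOL-Algebra.Elementary_Groups"
begin

section \<open>Link diagrams\<close>

text \<open>
  A link diagram is cut at finitely many points, at least one on every component and one between
  any two consecutive crossings.  A crossing \<^term>\<open>(a, b, c, d)\<close> lists the four neighbouring
  points counterclockwise, starting at an end of the understrand; so the understrand runs between
  \<^term>\<open>a\<close> and \<^term>\<open>c\<close>, and the overstrand between \<^term>\<open>b\<close> and \<^term>\<open>d\<close>.  A join is a
  crossingless arc between two points.  In a genuine diagram each point is an end of exactly two
  of the strands below; \<^term>\<open>is_orientation\<close> forces this.
\<close>

record 'p diagram =
  crossings :: "('p \<times> 'p \<times> 'p \<times> 'p) list"
  joins :: "('p \<times> 'p) list"

datatype strand = Under nat | Over nat | Join nat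

definition strands :: "'p diagram \<Rightarrow> strand set" where
  "strands D = Under ` {..<length (crossings D)} \<union> Over ` {..<length (crossings D)}
     \<union> Join ` {..<length (joins D)}"

fun ends :: "'p diagram \<Rightarrow> strand \<Rightarrow> 'p \<times> 'p" where
  "ends D (Under k) = (case crossings D ! k of (a, b, c, d) \<Rightarrow> (a, c))"
| "ends D (Over k) = (case crossings D ! k of (a, b, c, d) \<Rightarrow> (b, d))"
| "ends D (Join k) = joins D ! k"

definition points :: "'p diagram \<Rightarrow> 'p set" where
  "points D = fst ` ends D ` strands D \<union> snd ` ends D ` strands D"


subsection \<open>Orientations and crossing signs\<close>

text \<open>An orientation says whether each strand runs from its first to its second end.\<close>

definition tail :: "'p diagram \<Rightarrow> (strand \<Rightarrow> bool) \<Rightarrow> strand \<Rightarrow> 'p" where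
  "tail D ori s = (if ori s then fst (ends D s) else snd (ends D s))"

definition head :: "'p diagram \<Rightarrow> (strand \<Rightarrow> bool) \<Rightarrow> strand \<Rightarrow> 'p" where
  "head D ori s = (if ori s then snd (ends D s) else fst (ends D s))"

definition is_orientation :: "'p diagram \<Rightarrow> (strand \<Rightarrow> bool) \<Rightarrow> bool" where
  "is_orientation D ori \<longleftrightarrow>
     bij_betw (tail D ori) (strands D) (points D) \<and> bij_betw (head D ori) (strands D) (points D)"

text \<open>
  If the understrand of \<^term>\<open>(a, b, c, d)\<close> runs from \<^term>\<open>a\<close> to \<^term>\<open>c\<close>, the crossing is
  positive iff the overstrand crosses it from left to right, that is, from \<^term>\<open>d\<close> to \<^term>\<open>b\<close>.
\<close>

definition positive :: "(strand \<Rightarrow> bool) \<Rightarrow> nat \<Rightarrow> bool" where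
  "positive ori k \<longleftrightarrow> ori (Under k) \<noteq> ori (Over k)"

definition n_pos :: "'p diagram \<Rightarrow> (strand \<Rightarrow> bool) \<Rightarrow> nat" where
  "n_pos D ori = card {k. k < length (crossings D) \<and> positive ori k}"

definition n_neg :: "'p diagram \<Rightarrow> (strand \<Rightarrow> bool) \<Rightarrow> nat" where
  "n_neg D ori = card {k. k < length (crossings D) \<and> \<not> positive ori k}"


subsection \<open>Smoothings\<close>

text \<open>
  Rotating the overstrand of \<^term>\<open>(a, b, c, d)\<close> counterclockwise moves its end \<^term>\<open>b\<close> to
  \<^term>\<open>c\<close> and \<^term>\<open>d\<close> to \<^term>\<open>a\<close>.  The 0-smoothing joins the regions between \<^term>\<open>b\<close>,
  \<^term>\<open>c\<close> and between \<^term>\<open>d\<close>, \<^term>\<open>a\<close>; its two arcs therefore connect \<^term>\<open>a\<close> with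
  \<^term>\<open>b\<close> and \<^term>\<open>c\<close> with \<^term>\<open>d\<close>.
\<close>

fun smoothing_arcs :: "bool \<Rightarrow> 'p \<times> 'p \<times> 'p \<times> 'p \<Rightarrow> ('p \<times> 'p) set" where
  "smoothing_arcs False (a, b, c, d) = {(a, b), (c, d)}"
| "smoothing_arcs True (a, b, c, d) = {(a, d), (b, c)}"

text \<open>In a cube vertex, \<^term>\<open>False\<close> stands for 0 and \<^term>\<open>True\<close> for 1.\<close>

definition smoothing :: "'p diagram \<Rightarrow> bool list \<Rightarrow> ('p \<times> 'p) set" where
  "smoothing D v = set (joins D) \<union>
     (\<Union>k<length (crossings D). smoothing_arcs (v ! k) (crossings D ! k))"

text \<open>A circle of a complete smoothing is represented by the set of points on it.\<close>

definition circle :: "'p diagram \<Rightarrow> bool list \<Rightarrow> 'p \<Rightarrow> 'p set" where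
  "circle D v p = {x. (p, x) \<in> (smoothing D v \<union> (smoothing D v)\<inverse>)\<^sup>*}"

definition circles :: "'p diagram \<Rightarrow> bool list \<Rightarrow> 'p set set" where
  "circles D v = circle D v ` points D"


section \<open>Khovanov homology over the integers\<close>

subsection \<open>The Frobenius algebra\<close>

datatype label = L1 | LX

fun label_deg :: "label \<Rightarrow> int" where
  "label_deg L1 = 1"
| "label_deg LX = -1"

fun merge_label :: "label \<Rightarrow> label \<Rightarrow> label \<Rightarrow>\<^sub>0 int" where
  "merge_label L1 L1 = frag_of L1"
| "merge_label L1 LX = frag_of LX"
| "merge_label LX L1 = frag_of LX"
| "merge_label LX LX = 0"

fun split_label :: "label \<Rightarrow> (label \<times> label) \<Rightarrow>\<^sub>0 int" where
  "split_label L1 = frag_of (L1, LX) + frag_of (LX, L1)"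
| "split_label LX = frag_of (LX, LX)"


subsection \<open>The cube of resolutions\<close>

text \<open>
  The tensor power of the Frobenius algebra over the circles of the smoothing \<^term>\<open>v\<close> has as basis
  the labellings of these circles; a generator is a cube vertex with such a labelling.
\<close>

type_synonym 'p gen = "bool list \<times> ('p set \<Rightarrow> label)"

definition weight :: "bool list \<Rightarrow> nat" where
  "weight v = count_list v True"

definition gens :: "'p diagram \<Rightarrow> int \<Rightarrow> int \<Rightarrow> 'p gen set" where
  "gens D i j = {(v, l). length v = length (crossings D) \<and> int (weight v) = i \<and>
     l \<in> circles D v \<rightarrow>\<^sub>E UNIV \<and> (\<Sum>C\<in>circles D v. label_deg (l C)) + int (weight v) = j}"

text \<open>
  The edge changing the \<^term>\<open>k\<close>-th entry of \<^term>\<open>v\<close> to 1.  Opposite points \<^term>\<open>a\<close> and \<^term>\<open>c\<close>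
  of the crossing lie on different arcs of both smoothings, so the edge is a merge if their circles
  differ at \<^term>\<open>v\<close>, and for a planar diagram a split into their circles otherwise.
\<close>

definition edge_map :: "'p diagram \<Rightarrow> nat \<Rightarrow> 'p gen \<Rightarrow> 'p gen \<Rightarrow>\<^sub>0 int" where
  "edge_map D k = (\<lambda>(v, l). case crossings D ! k of (a, b, c, d) \<Rightarrow>
     let v' = v[k := True] in
     if circle D v a \<noteq> circle D v c
     then frag_extend
       (\<lambda>x. frag_of (v', restrict (l(circle D v' a := x)) (circles D v')))
       (merge_label (l (circle D v a)) (l (circle D v c)))
     else frag_extend
       (\<lambda>(x, y). frag_of (v', restrict (l(circle D v' a := x, circle D v' c := y)) (circles D v')))
       (split_label (l (circle D v a))))"

text \<open>An edge is signed by the parity of the number of 1's before the changed entry.\<close>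

definition diff_gen :: "'p diagram \<Rightarrow> 'p gen \<Rightarrow> 'p gen \<Rightarrow>\<^sub>0 int" where
  "diff_gen D g = (\<Sum>k | k < length (crossings D) \<and> \<not> fst g ! k.
     frag_cmul ((-1) ^ weight (take k (fst g))) (edge_map D k g))"

definition diff :: "'p diagram \<Rightarrow> ('p gen \<Rightarrow>\<^sub>0 int) \<Rightarrow> ('p gen \<Rightarrow>\<^sub>0 int)" where
  "diff D = frag_extend (diff_gen D)"

text \<open>The complex before the shifts by crossing signs, and its homology, in homological degree
  \<^term>\<open>i\<close> and quantum grading \<^term>\<open>j\<close>; the differential preserves the latter.\<close>

definition CKh_bar :: "'p diagram \<Rightarrow> int \<Rightarrow> int \<Rightarrow> ('p gen \<Rightarrow>\<^sub>0 int) monoid" where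
  "CKh_bar D i j = free_Abelian_group (gens D i j)"

definition H_bar :: "'p diagram \<Rightarrow> int \<Rightarrow> int \<Rightarrow> ('p gen \<Rightarrow>\<^sub>0 int) set monoid" where
  "H_bar D i j =
     (CKh_bar D i j)\<lparr>carrier := kernel (CKh_bar D i j) (CKh_bar D (i + 1) j) (diff D)\<rparr>
       Mod (diff D ` carrier (CKh_bar D (i - 1) j))"

text \<open>The shift by \<open>{k}\<close> raises the quantum grading by \<^term>\<open>k\<close>, so the part of the shifted module
  in grading \<^term>\<open>j\<close> is the part of the original one in grading \<^term>\<open>j - k\<close>.\<close>

definition Kh :: "'p diagram \<Rightarrow> (strand \<Rightarrow> bool) \<Rightarrow> int \<Rightarrow> int \<Rightarrow> ('p gen \<Rightarrow>\<^sub>0 int) set monoid" where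
  "Kh D ori i j = H_bar D (i + int (n_neg D ori)) (j - (int (n_pos D ori) - 2 * int (n_neg D ori)))"

definition Kh_thin :: "'p diagram \<Rightarrow> (strand \<Rightarrow> bool) \<Rightarrow> bool" where
  "Kh_thin D ori \<longleftrightarrow>
     (\<exists>s. \<forall>i j. j - 2 * i \<notin> {s - 1, s + 1} \<longrightarrow> trivial_group (Kh D ori i j))"


section \<open>Pretzel diagrams\<close>

text \<open>
  The point \<^term>\<open>(c, k, r)\<close> lies in column \<^term>\<open>c\<close>, on the left or the right, below \<^term>\<open>k\<close>
  crossings of that column.  A column without crossings consists of two points, each being both a
  top and a bottom end.
\<close>

datatype side = Left | Right

type_synonym pretzel_point = "nat \<times> nat \<times> side"

text \<open>
  In a positive column the pairs connected by the 0-smoothing are the two upper and the two lower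
  points of a crossing; in a negative column they are the two left and the two right points.
\<close>

definition column_crossing ::
    "nat \<Rightarrow> int \<Rightarrow> nat \<Rightarrow> pretzel_point \<times> pretzel_point \<times> pretzel_point \<times> pretzel_point" where
  "column_crossing c a k =
     (if a > 0 then ((c, k, Right), (c, k, Left), (c, k + 1, Left), (c, k + 1, Right))
      else ((c, k, Left), (c, k + 1, Left), (c, k + 1, Right), (c, k, Right)))"

definition column :: "nat \<Rightarrow> int \<Rightarrow> (pretzel_point \<times> pretzel_point \<times> pretzel_point \<times> pretzel_point) list" where
  "column c a = map (column_crossing c a) [0..<nat \<bar>a\<bar>]"

definition pretzel :: "int \<Rightarrow> int \<Rightarrow> int \<Rightarrow> pretzel_point diagram" where
  "pretzel a\<^sub>1 a\<^sub>2 a\<^sub>3 =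
     \<lparr>crossings = column 0 a\<^sub>1 @ column 1 a\<^sub>2 @ column 2 a\<^sub>3,
      joins =
        [((0, 0, Right), (1, 0, Left)), ((1, 0, Right), (2, 0, Left)), ((2, 0, Right), (0, 0, Left)),
         ((0, nat \<bar>a\<^sub>1\<bar>, Right), (1, nat \<bar>a\<^sub>2\<bar>, Left)), ((1, nat \<bar>a\<^sub>2\<bar>, Right), (2, nat \<bar>a\<^sub>3\<bar>, Left)),
         ((2, nat \<bar>a\<^sub>3\<bar>, Right), (0, nat \<bar>a\<^sub>1\<bar>, Left))]\<rparr>"


subsection \<open>Existence of an orientation\<close>

text \<open>
  Explicit orientation: for odd \<^term>\<open>q\<close> the two strands are antiparallel in every column; for even
  \<^term>\<open>q\<close> they are antiparallel in the last column, run down in the first and up in the second.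
\<close>

definition pretzel_pts :: "nat \<Rightarrow> pretzel_point set" where
  "pretzel_pts n = {(c, k, s). (c = 0 \<or> c = 1) \<and> k \<le> 3 \<or> c = 2 \<and> k \<le> n}"

lemma nth_crossings_pretzel:
  assumes "k < 6 + nat q" "q > 0"
  shows "crossings (pretzel 3 (-3) q) ! k =
     (if k < 3 then column_crossing 0 3 k else if k < 6 then column_crossing 1 (-3) (k - 3)
      else column_crossing 2 q (k - 6))"
  using assms by (auto simp: pretzel_def column_def nth_append)

lemma length_crossings_pretzel: "q > 0 \<Longrightarrow> length (crossings (pretzel 3 (-3) q)) = 6 + nat q"
  by (auto simp: pretzel_def column_def)

definition runs_down :: "nat \<Rightarrow> pretzel_point \<Rightarrow> bool" where
 "runs_down n = (\<lambda>(c,k,s). if odd n \<or> c = 2 then (even k \<longleftrightarrow> s = Left) else c = 0)"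

fun pretzel_ori :: "nat \<Rightarrow> strand \<Rightarrow> bool" where
 "pretzel_ori n (Under k) = (if k < 3 then runs_down n (0,k,Right)
     else if k < 6 then runs_down n (1,k-3,Left)
     else runs_down n (2,k-6,Right))"
|"pretzel_ori n (Over k) = (if k < 3 then runs_down n (0,k,Left)
     else if k < 6 then \<not> runs_down n (1,k-3,Right)
     else runs_down n (2,k-6,Left))"
|"pretzel_ori n (Join k) = (if k < 3 then \<not> runs_down n (k,0,Right)
     else runs_down n (k-3, if k = 5 then n else 3, Right))"

definition strand_below :: "nat \<Rightarrow> pretzel_point \<Rightarrow> strand" where
 "strand_below n = (\<lambda>(c,k,s). if k = (if c = 2 then n else 3) then
    Join (3 + (if s = Right then c else if c = 0 then 2 else c - 1))
    else if (s = Right) = (c \<noteq> 1) then Under (3 * c + k) else Over (3 * c + k))"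

definition strand_above :: "pretzel_point \<Rightarrow> strand" where
 "strand_above = (\<lambda>(c,k,s). if k = 0 then
    Join (if s = Right then c else if c = 0 then 2 else c - 1)
    else if (s = Left) = (c \<noteq> 1) then Under (3 * c + k-1) else Over (3 * c + k-1))"

lemma joins_pretzel: "joins (pretzel 3 (-3) q) =
        [((0, 0, Right), (1, 0, Left)), ((1, 0, Right), (2, 0, Left)), ((2, 0, Right), (0, 0, Left)),
         ((0, 3, Right), (1, 3, Left)), ((1, 3, Right), (2, nat \<bar>q\<bar>, Left)),
         ((2, nat \<bar>q\<bar>, Right), (0, 3, Left))]" by (simp add: pretzel_def)

lemma pretzel_strand_cases:
  assumes "q > 0" "s \<in> strands (pretzel 3 (-3) q)"
  obtains k where "k < 3" "s = Under k"
   | k where "k < 3" "s = Under (k + 3)"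
   | k where "k < nat q" "s = Under (k + 6)"
   | k where "k < 3" "s = Over k"
   | k where "k < 3" "s = Over (k + 3)"
   | k where "k < nat q" "s = Over (k + 6)"
   | "s = Join 0" | "s = Join 1" | "s = Join 2" | "s = Join 3" | "s = Join 4" | "s = Join 5"
proof -
  have m: "k < 3 \<or> (\<exists>i<3. k = i + 3) \<or> (\<exists>i<nat q. k = i + 6)" if "k < 6 + nat q" for k
  proof -
    have "k < 3 \<or> k = (k - 3) + 3 \<and> k - 3 < 3 \<or> k = (k - 6) + 6 \<and> k - 6 < nat q" using that by linarith
    then show ?thesis by blast
  qed
  have j: "k = 0 \<or> k = 1 \<or> k = 2 \<or> k = 3 \<or> k = 4 \<or> k = 5" if "k < 6" for k :: nat using that by presburger
  have e: "(\<exists>k<6 + nat q. s = Under k) \<or> (\<exists>k<6 + nat q. s = Over k) \<or> (\<exists>k<6. s = Join k)"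
    using assms unfolding strands_def by (auto simp: length_crossings_pretzel joins_pretzel)
  then show thesis using m j that by metis
qed

lemma pretzel_ori_ends:
  assumes "q > 0" "s \<in> strands (pretzel 3 (-3) q)"
  defines "D \<equiv> pretzel 3 (-3) q" and "n \<equiv> nat q"
  defines "p \<equiv> tail D (pretzel_ori n) s" and "r \<equiv> head D (pretzel_ori n) s"
  shows "(if runs_down n p then strand_below n p else strand_above p) = s
     \<and> (if runs_down n r then strand_above r else strand_below n r) = s
     \<and> p \<in> pretzel_pts n \<and> r \<in> pretzel_pts n"
proof -
  have n: "n > 0" "nat \<bar>q\<bar> = n" "nat q = n" using assms n_def by auto
  have nth: "k < 3 \<Longrightarrow> crossings (pretzel 3 (-3) q) ! k = column_crossing 0 3 k"
    "k < 3 \<Longrightarrow> crossings (pretzel 3 (-3) q) ! (k + 3) = column_crossing 1 (-3) k"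
    "k < n \<Longrightarrow> crossings (pretzel 3 (-3) q) ! (k + 6) = column_crossing 2 q k" for k
    using assms(1) n_def by (auto simp: nth_crossings_pretzel)
  note simps = p_def r_def D_def n tail_def head_def nth column_crossing_def joins_pretzel
    pretzel_pts_def runs_down_def strand_below_def strand_above_def
  show ?thesis
    using assms(1,2)
  proof (cases rule: pretzel_strand_cases)
    case (1 k)
    then show ?thesis using n assms(1) by (cases "odd n"; cases "even k"; auto simp: simps)
  next
    case (2 k)
    then show ?thesis using n assms(1) by (cases "odd n"; cases "even k"; auto simp: simps)
  next
    case (3 k)
    then show ?thesis using n assms(1) by (cases "odd n"; cases "even k"; auto simp: simps)
  next
    case (4 k)
    then show ?thesis using n assms(1) by (cases "odd n"; cases "even k"; auto simp: simps)
  next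
    case (5 k)
    then show ?thesis using n assms(1) by (cases "odd n"; cases "even k"; auto simp: simps)
  next
    case (6 k)
    then show ?thesis using n assms(1) by (cases "odd n"; cases "even k"; auto simp: simps)
  next
    case 7
    then show ?thesis using n assms(1) by (cases "odd n"; auto simp: simps)
  next
    case 8
    then show ?thesis using n assms(1) by (cases "odd n"; auto simp: simps)
  next
    case 9
    then show ?thesis using n assms(1) by (cases "odd n"; auto simp: simps)
  next
    case 10
    then show ?thesis using n assms(1) by (cases "odd n"; auto simp: simps)
  next
    case 11
    then show ?thesis using n assms(1) by (cases "odd n"; auto simp: simps)
  next
    case 12
    then show ?thesis using n assms(1) by (cases "odd n"; auto simp: simps)
  qed
qed

lemma finite_pretzel_pts: "finite (pretzel_pts n)" and card_pretzel_pts: "card (pretzel_pts n) = 2 * n + 18"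
proof -
  have e: "pretzel_pts n = {0, 1} \<times> ({..3} \<times> {Left, Right}) \<union> {2} \<times> ({..n} \<times> {Left, Right})"
    unfolding pretzel_pts_def using side.exhaust by auto
  show "finite (pretzel_pts n)" unfolding e by simp
  show "card (pretzel_pts n) = 2 * n + 18" unfolding e by (subst card_Un_disjoint) (auto simp: card_cartesian_product)
qed

lemma card_strands_pretzel:
  assumes "q > 0" shows "card (strands (pretzel 3 (-3) q)) = 2 * nat q + 18"
proof -
  have "card (Under ` {..<6 + nat q}) = 6 + nat q" "card (Over ` {..<6 + nat q}) = 6 + nat q"
    "card (Join ` {..<6}) = 6"
    by (auto simp: card_image inj_on_def)
  moreover have "card (Under ` {..<6 + nat q} \<union> Over ` {..<6 + nat q} \<union> Join ` {..<6})
    = card (Under ` {..<6 + nat q}) + card (Over ` {..<6 + nat q}) + card (Join ` {..<6})"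
    by (subst card_Un_disjoint, simp, simp, blast, subst card_Un_disjoint) auto
  ultimately show ?thesis using assms by (simp add: strands_def length_crossings_pretzel joins_pretzel eval_nat_numeral)
qed

lemma pretzel_orientable:
  assumes "q > 0"
  shows "\<exists>ori. is_orientation (pretzel 3 (-3) q) ori"
proof
  let ?D = "pretzel 3 (-3) q" and ?o = "pretzel_ori (nat q)"
  have P: "points ?D = tail ?D ?o ` strands ?D \<union> head ?D ?o ` strands ?D"
    unfolding points_def tail_def head_def by force
  have sub: "points ?D \<subseteq> pretzel_pts (nat q)" unfolding P using pretzel_ori_ends[OF assms] by blast
  let ?n = "nat q"
  have it: "inj_on (tail ?D ?o) (strands ?D)"
    by (rule inj_on_inverseI[where g = "\<lambda>p. if runs_down ?n p then strand_below ?n p else strand_above p"])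
      (use pretzel_ori_ends[OF assms] in blast)
  have ih: "inj_on (head ?D ?o) (strands ?D)"
    by (rule inj_on_inverseI[where g = "\<lambda>p. if runs_down ?n p then strand_above p else strand_below ?n p"])
      (use pretzel_ori_ends[OF assms] in blast)
  have "f ` strands ?D = pretzel_pts (nat q)" if "inj_on f (strands ?D)" "f ` strands ?D \<subseteq> pretzel_pts (nat q)" for f
    using that by (intro card_subset_eq finite_pretzel_pts) (auto simp: card_image card_strands_pretzel[OF assms] card_pretzel_pts)
  then have "tail ?D ?o ` strands ?D = pretzel_pts (nat q)" "head ?D ?o ` strands ?D = pretzel_pts (nat q)"
    using it ih sub P by auto
  then have "tail ?D ?o ` strands ?D = points ?D" "head ?D ?o ` strands ?D = points ?D"
    using P by auto
  then show "is_orientation ?D ?o" using it ih unfolding is_orientation_def bij_betw_def by blast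
qed

end

theory Submission
  imports Defs "HOL-Library.Function_Algebras"
begin

text \<open>
  Resolving a crossing of the third column gives a long exact sequence relating \<open>P(3, -3, q)\<close> to
  \<open>P(3, -3, q - 1)\<close> and to a two-component unlink.  The homology of the unlink lies on the two
  diagonals of \<open>P(3, -3, q - 1)\<close> and, through the class of \<open>1 \<otimes> 1\<close>, on a third one.  The composition of
  the saddle to \<open>P(3, -3, q - 1)\<close> with its reverse is multiplication by \<open>X\<^sub>a + X\<^sub>c\<close>, where \<open>a\<close> and
  \<open>c\<close> lie on the two components, and after a further multiplication by \<open>X\<^sub>c\<close> it is multiplication by
  \<open>X\<^sub>a X\<^sub>c\<close>, which is injective on that class.  Hence the class is not in the kernel of the connecting map and
  the third diagonal vanishes, whatever \<open>q\<close> is.  The induction starts at \<open>q = 0\<close> with the square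
  knot, whose alternating diagram is thin by exact sequences without any cancellation.

  The unlink is simplified by Reidemeister moves of type I and II, and one has to follow the action of
  \<open>X\<^sub>a X\<^sub>c\<close> through them: in a move of type II a point passes to the other strand and its action
  changes sign up to homotopy, which does no harm to injectivity.
\<close>

section \<open>Saddles between partitions\<close>

text \<open>What passes through the moves is the injectivity of X_a X_c, not the vanishing of
  homology: the extra class of the unlink is a genuine homology class, and only its nonzero image
  under the connecting map removes it. No homotopy equivalence is constructed. A move is the
  statement that cycles of a large cube bound if those of a smaller one do, proved by subtracting
  explicit boundaries. Nothing is split or divided, so torsion is covered. The bounding chains are
  built from reversed saddles and one operator, the derivative \<open>delX T\<close> at a circle T
  that no other crossing meets. Planarity is needed for one fact, that every edge of the cube is a
  merge or a split. It is obtained as a parity: the checkerboard orientation turns a smoothing into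
  a permutation, and an edge multiplies it by a transposition. That the first two columns have an
  odd number of crossings matters. Each type II move carries a marked point to the other strand;
  after three of them the two marked points lie on different circles, where X_a X_c does not kill
  the all-1 labelling. After an even number they would lie on the same circle and the product would
  be zero.\<close>

abbreviation supp :: "('b \<Rightarrow>\<^sub>0 int) \<Rightarrow> 'b set" where
  "supp \<equiv> Poly_Mapping.keys"

type_synonym 'p labelling = "'p set \<Rightarrow> label"

text \<open>A partition is given by the map from a point to its block, the form in which
  \<open>circle D v\<close> comes. Only the values at points of \<open>P\<close> are
  constrained.\<close>

definition is_part :: "'p set \<Rightarrow> ('p \<Rightarrow> 'p set) \<Rightarrow> bool" where
  "is_part P f \<longleftrightarrow> (\<forall>p\<in>P. p \<in> f p \<and> (\<forall>q\<in>P. q \<in> f p \<longrightarrow> f q = f p))"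

definition merges :: "'p set \<Rightarrow> ('p \<Rightarrow> 'p set) \<Rightarrow> ('p \<Rightarrow> 'p set) \<Rightarrow> 'p \<Rightarrow> 'p \<Rightarrow> bool" where
  "merges P f f' a c \<longleftrightarrow> f a \<noteq> f c \<and> (\<forall>p\<in>P. f' p = (if p \<in> f a \<union> f c then f a \<union> f c else f p))"

text \<open>Symmetric in \<open>f\<close> and \<open>f'\<close>, so that one hypothesis covers a
  merge, a split and the reverse of either.\<close>

definition linked :: "'p set \<Rightarrow> ('p \<Rightarrow> 'p set) \<Rightarrow> ('p \<Rightarrow> 'p set) \<Rightarrow> 'p \<Rightarrow> 'p \<Rightarrow> bool" where
  "linked P f f' a c \<longleftrightarrow> finite P \<and> a \<in> P \<and> c \<in> P \<and> is_part P f \<and> is_part P f' \<and>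
     (merges P f f' a c \<or> merges P f' f a c)"

definition labs :: "'p set \<Rightarrow> ('p \<Rightarrow> 'p set) \<Rightarrow> 'p labelling set" where
  "labs P f = f ` P \<rightarrow>\<^sub>E UNIV"

definition mulX :: "'p set \<Rightarrow> ('p labelling \<Rightarrow>\<^sub>0 int) \<Rightarrow> ('p labelling \<Rightarrow>\<^sub>0 int)" where
  "mulX T = frag_extend (\<lambda>l. if l T = L1 then frag_of (l(T := LX)) else 0)"

text \<open>The derivative with respect to X_T. As a cobordism it caps off the circle T and gives
  birth to a new one.\<close>

definition delX :: "'p set \<Rightarrow> ('p labelling \<Rightarrow>\<^sub>0 int) \<Rightarrow> ('p labelling \<Rightarrow>\<^sub>0 int)" where
  "delX T = frag_extend (\<lambda>l. if l T = LX then frag_of (l(T := L1)) else 0)"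

definition saddle_gen :: "'p set \<Rightarrow> ('p \<Rightarrow> 'p set) \<Rightarrow> ('p \<Rightarrow> 'p set) \<Rightarrow> 'p \<Rightarrow> 'p \<Rightarrow> 'p labelling \<Rightarrow>
    ('p labelling \<Rightarrow>\<^sub>0 int)" where
  "saddle_gen P f f' a c l =
     (if f a \<noteq> f c
      then frag_extend (\<lambda>x. frag_of (restrict (l(f' a := x)) (f' ` P))) (merge_label (l (f a)) (l (f c)))
      else frag_extend (\<lambda>(x, y). frag_of (restrict (l(f' a := x, f' c := y)) (f' ` P)))
             (split_label (l (f a))))"

definition saddle :: "'p set \<Rightarrow> ('p \<Rightarrow> 'p set) \<Rightarrow> ('p \<Rightarrow> 'p set) \<Rightarrow> 'p \<Rightarrow> 'p \<Rightarrow>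
    ('p labelling \<Rightarrow>\<^sub>0 int) \<Rightarrow> ('p labelling \<Rightarrow>\<^sub>0 int)" where
  "saddle P f f' a c = frag_extend (saddle_gen P f f' a c)"

definition unit_lab :: "'p set \<Rightarrow> ('p \<Rightarrow> 'p set) \<Rightarrow> ('p labelling \<Rightarrow>\<^sub>0 int)" where
  "unit_lab P f = frag_of (\<lambda>C\<in>f ` P. L1)"

lemma label_neq [simp]: "x \<noteq> L1 \<longleftrightarrow> x = LX" "x \<noteq> LX \<longleftrightarrow> x = L1"
  by (cases x; simp)+

lemma mulX_simps [simp]:
  "mulX T 0 = 0" "mulX T (x + y) = mulX T x + mulX T y" "mulX T (x - y) = mulX T x - mulX T y"
  "mulX T (- x) = - mulX T x" "mulX T (frag_cmul k x) = frag_cmul k (mulX T x)"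
  by (simp_all add: mulX_def frag_extend_add frag_extend_diff frag_extend_minus frag_extend_cmul)

lemma delX_simps [simp]:
  "delX T 0 = 0" "delX T (x + y) = delX T x + delX T y" "delX T (x - y) = delX T x - delX T y"
  "delX T (- x) = - delX T x" "delX T (frag_cmul k x) = frag_cmul k (delX T x)"
  by (simp_all add: delX_def frag_extend_add frag_extend_diff frag_extend_minus frag_extend_cmul)

lemma saddle_simps [simp]:
  "saddle P f f' a c 0 = 0" "saddle P f f' a c (x + y) = saddle P f f' a c x + saddle P f f' a c y"
  "saddle P f f' a c (x - y) = saddle P f f' a c x - saddle P f f' a c y"
  "saddle P f f' a c (- x) = - saddle P f f' a c x"
  "saddle P f f' a c (frag_cmul k x) = frag_cmul k (saddle P f f' a c x)"
  by (simp_all add: saddle_def frag_extend_add frag_extend_diff frag_extend_minus frag_extend_cmul)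

lemma mulX_of: "mulX T (frag_of l) = (if l T = L1 then frag_of (l(T := LX)) else 0)"
  by (simp add: mulX_def)

lemma delX_of: "delX T (frag_of l) = (if l T = LX then frag_of (l(T := L1)) else 0)"
  by (simp add: delX_def)

lemma additive_eq:
  assumes "supp z \<subseteq> S" "\<And>l. l \<in> S \<Longrightarrow> G (frag_of l) = H (frag_of l)"
    and "G 0 = H 0" "\<And>x y. G (x - y) = G x - G y" "\<And>x y. H (x - y) = H x - H y"
  shows "G z = (H z :: 'b \<Rightarrow>\<^sub>0 int)"
  using assms(1)
proof (induction z rule: frag_induction)
  case zero
  show ?case using assms(3) assms(5)[of 0 0] by simp
next
  case (diff a b)
  then show ?case using assms(4,5) by simp
qed (use assms(2) in blast)

lemma mulX_commute: "mulX S (mulX T z) = mulX T (mulX S z)"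
  by (rule additive_eq[OF subset_UNIV]) (auto simp: mulX_of fun_upd_twist)

lemma mulX_mulX [simp]: "mulX T (mulX T z) = 0"
  by (rule additive_eq[OF subset_UNIV]) (auto simp: mulX_of)

lemma delX_delX [simp]: "delX T (delX T z) = 0"
  by (rule additive_eq[OF subset_UNIV]) (auto simp: delX_of)

lemma delX_mulX_commute: "S \<noteq> T \<Longrightarrow> delX T (mulX S z) = mulX S (delX T z)"
  by (rule additive_eq[OF subset_UNIV]) (auto simp: delX_of mulX_of fun_upd_twist)

text \<open>The Clifford relation between derivative and multiplication on Z[X]/(X^2). It splits
  every element into a part free of X_T and X_T times such a part.\<close>

lemma delX_mulX: "delX T (mulX T z) = z - mulX T (delX T z)"
proof (rule additive_eq[OF subset_UNIV, where G = "\<lambda>z. delX T (mulX T z)" and H = "\<lambda>z. z - mulX T (delX T z)"])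
  fix l
  show "delX T (mulX T (frag_of l)) = frag_of l - mulX T (delX T (frag_of l))"
    by (cases "l T") (auto simp: delX_of mulX_of fun_upd_idem)
qed (auto simp: algebra_simps)

lemma labs_induct [consumes 2, case_names unit mul]:
  assumes "finite P" "l \<in> labs P f"
    and unit: "Q (\<lambda>C\<in>f ` P. L1)"
    and mul: "\<And>l p. l \<in> labs P f \<Longrightarrow> p \<in> P \<Longrightarrow> l (f p) = L1 \<Longrightarrow> Q l \<Longrightarrow> Q (l(f p := LX))"
  shows "Q l"
  using assms(2)
proof (induction "card {C \<in> f ` P. l C = LX}" arbitrary: l)
  case 0
  then have "\<And>C. C \<in> f ` P \<Longrightarrow> l C = L1" using \<open>finite P\<close> by auto
  then have "l = (\<lambda>C\<in>f ` P. L1)" using "0.prems"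
    unfolding labs_def by (intro PiE_ext[OF "0.prems"[unfolded labs_def]]) auto
  then show ?case using unit by blast
next
  case (Suc n)
  then have "{C \<in> f ` P. l C = LX} \<noteq> {}" by (intro notI) simp
  then obtain p where p: "p \<in> P" "l (f p) = LX" by blast
  let ?l = "l(f p := L1)"
  have "{C \<in> f ` P. ?l C = LX} = {C \<in> f ` P. l C = LX} - {f p}" by auto
  moreover have "f p \<in> {C \<in> f ` P. l C = LX}" using p by simp
  ultimately have "card {C \<in> f ` P. ?l C = LX} = n"
    using Suc.hyps(2) \<open>finite P\<close> by (simp add: card_Diff_singleton)
  moreover have l: "?l \<in> labs P f" using Suc.prems p by (auto simp: labs_def PiE_def extensional_def)
  ultimately have "Q ?l" using Suc.hyps(1) by blast
  then have "Q (?l(f p := LX))" using l p by (intro mul) auto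
  moreover have "?l(f p := LX) = l" using p by (simp add: fun_upd_idem)
  ultimately show ?case by metis
qed

text \<open>The module of a state is cyclic over the polynomial ring in the points, with generator the all-1
  labelling; so identities between the linear maps below need only be checked on this labelling.\<close>

lemma linear_eq:
  assumes "finite P" "supp z \<subseteq> labs P f"
    and "G (unit_lab P f) = H (unit_lab P f)"
    and "G 0 = H 0" "\<And>x y. G (x - y) = G x - G y" "\<And>x y. H (x - y) = H x - H y"
    and "\<And>p x. p \<in> P \<Longrightarrow> supp x \<subseteq> labs P f \<Longrightarrow> G (mulX (f p) x) = M p (G x)"
    and "\<And>p x. p \<in> P \<Longrightarrow> supp x \<subseteq> labs P f \<Longrightarrow> H (mulX (f p) x) = M p (H x)"
  shows "G z = (H z :: 'b \<Rightarrow>\<^sub>0 int)"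
proof (rule additive_eq[where S = "labs P f"])
  fix l assume "l \<in> labs P f"
  with assms(1) show "G (frag_of l) = H (frag_of l)"
  proof (induction rule: labs_induct)
    case unit
    show ?case using assms(3) unfolding unit_lab_def .
  next
    case (mul l p)
    have "frag_of (l(f p := LX)) = mulX (f p) (frag_of l)" using mul by (simp add: mulX_of)
    moreover have "G (mulX (f p) (frag_of l)) = H (mulX (f p) (frag_of l))"
      using mul assms(7,8)[of p "frag_of l"] by simp
    ultimately show ?case by metis
  qed
qed (use assms(2,4-6) in auto)

section \<open>Partitions that differ by one merge\<close>

lemma is_partD: "is_part P f \<Longrightarrow> p \<in> P \<Longrightarrow> p \<in> f p"
  "is_part P f \<Longrightarrow> p \<in> P \<Longrightarrow> q \<in> P \<Longrightarrow> q \<in> f p \<Longrightarrow> f q = f p"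
  unfolding is_part_def by blast+

text \<open>Labels are attached to blocks as sets, so one has to know that neither old block
  survives the merge and that the union was no block before. The last clause is the trichotomy
  behind the later case splits on a point.\<close>

lemma merges_facts:
  assumes "is_part P f" "is_part P f'" "a \<in> P" "c \<in> P" "merges P f f' a c"
  shows "f' a = f a \<union> f c" "f' c = f a \<union> f c" "f a \<notin> f' ` P" "f c \<notin> f' ` P" "f a \<union> f c \<notin> f ` P"
    "f a \<noteq> f c" "f' ` P = insert (f a \<union> f c) (f ` P - {f a, f c})"
    "p \<in> P \<Longrightarrow> f p = f a \<and> f' p = f a \<union> f c \<or> f p = f c \<and> f' p = f a \<union> f c \<or>
       f p \<noteq> f a \<and> f p \<noteq> f c \<and> f' p = f p \<and> f p \<noteq> f a \<union> f c"
proof -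
  have m: "f' p = (if p \<in> f a \<union> f c then f a \<union> f c else f p)" if "p \<in> P" for p
    using assms(5) that by (simp only: merges_def)
  have s: "p \<in> f p" "q \<in> P \<Longrightarrow> q \<in> f p \<Longrightarrow> f q = f p" "p \<in> f' p" "q \<in> P \<Longrightarrow> q \<in> f' p \<Longrightarrow> f' q = f' p"
    if "p \<in> P" for p q
    using is_partD[OF assms(1)] is_partD[OF assms(2)] that by blast+
  have sub: "f q = f p" if "p \<in> P" "q \<in> P" "q \<in> f p" for p q using s(2) that by blast
  show ne: "f a \<noteq> f c" using assms(5) by (simp add: merges_def)
  have self: "a \<in> f a" "c \<in> f c" using s(1) assms(3,4) by blast+
  show ac: "f' a = f a \<union> f c" "f' c = f a \<union> f c" using m[OF assms(3)] m[OF assms(4)] self by simp_all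
  have big: "f a \<union> f c \<noteq> f q" if "q \<in> P" for q
  proof
    assume e: "f a \<union> f c = f q"
    then have "a \<in> f q" "c \<in> f q" using self by auto
    then have "f a = f q" "f c = f q" using sub[OF that assms(3)] sub[OF that assms(4)] by blast+
    then show False using ne by simp
  qed
  then show "f a \<union> f c \<notin> f ` P" by auto
  have no: "f' q \<noteq> f b" if "q \<in> P" "b = a \<or> b = c" for q b
  proof
    assume e: "f' q = f b"
    have b: "b \<in> P" "b \<in> f b" "f' b = f a \<union> f c" using that self ac assms(3,4) by auto
    then have "f' b = f' q" using s(4)[OF that(1), of b] e by simp
    then show False using b e big by simp
  qed
  show "f a \<notin> f' ` P"
  proof
    assume "f a \<in> f' ` P"
    then obtain q where "q \<in> P" "f' q = f a" by auto
    then show False using no by blast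
  qed
  show "f c \<notin> f' ` P"
  proof
    assume "f c \<in> f' ` P"
    then obtain q where "q \<in> P" "f' q = f c" by auto
    then show False using no by blast
  qed
  show pp: "f p = f a \<and> f' p = f a \<union> f c \<or> f p = f c \<and> f' p = f a \<union> f c \<or>
       f p \<noteq> f a \<and> f p \<noteq> f c \<and> f' p = f p \<and> f p \<noteq> f a \<union> f c" if "p \<in> P" for p
  proof -
    consider "p \<in> f a" | "p \<in> f c" | "p \<notin> f a" "p \<notin> f c" by blast
    then show ?thesis
    proof cases
      case 1
      then show ?thesis using m[OF that] sub[OF assms(3) that] by simp
    next
      case 2
      then show ?thesis using m[OF that] sub[OF assms(4) that] by simp
    next
      case 3
      then have "f p \<noteq> f a" "f p \<noteq> f c" using s(1)[OF that] by auto
      then show ?thesis using 3 m[OF that] big[OF that] by simp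
    qed
  qed
  have im: "f' p \<in> insert (f a \<union> f c) (f ` P - {f a, f c})" if "p \<in> P" for p
    using pp[OF that] that by auto
  have im': "f p \<in> f' ` P" if "p \<in> P" "f p \<noteq> f a" "f p \<noteq> f c" for p
  proof -
    have "f' p = f p" using pp[OF that(1)] that(2,3) by simp
    then show ?thesis using that(1) by (metis imageI)
  qed
  show "f' ` P = insert (f a \<union> f c) (f ` P - {f a, f c})"
  proof (intro equalityI subsetI)
    fix C assume "C \<in> insert (f a \<union> f c) (f ` P - {f a, f c})"
    then consider "C = f' a" | q where "q \<in> P" "C = f q" "f q \<noteq> f a" "f q \<noteq> f c" using ac(1) by auto
    then show "C \<in> f' ` P"
    proof cases
      case 1
      then show ?thesis using assms(3) by blast
    next
      case (2 q)
      then show ?thesis using im'[of q] by simp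
    qed
  next
    fix C assume "C \<in> f' ` P"
    then obtain q where "q \<in> P" "C = f' q" by auto
    then show "C \<in> insert (f a \<union> f c) (f ` P - {f a, f c})" using im[of q] by simp
  qed
qed

section \<open>Saddles as linear maps over the ring generated by the points\<close>

lemma saddle_merge:
  assumes "f a \<noteq> f c"
  shows "saddle P f f' a c (frag_of l) =
     (case (l (f a), l (f c)) of (LX, LX) \<Rightarrow> 0
      | (x, y) \<Rightarrow> frag_of (restrict (l(f' a := if x = L1 then y else x)) (f' ` P)))"
  using assms by (cases "l (f a)"; cases "l (f c)") (simp_all add: saddle_def saddle_gen_def)

lemma saddle_split:
  assumes "f a = f c"
  shows "saddle P f f' a c (frag_of l) =
     (case l (f a) of
        L1 \<Rightarrow> frag_of (restrict (l(f' a := L1, f' c := LX)) (f' ` P)) + frag_of (restrict (l(f' a := LX, f' c := L1)) (f' ` P))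
      | LX \<Rightarrow> frag_of (restrict (l(f' a := LX, f' c := LX)) (f' ` P)))"
  using assms by (cases "l (f a)") (simp_all add: saddle_def saddle_gen_def frag_extend_add)

lemma labs_upd: "l \<in> labs P f \<Longrightarrow> p \<in> P \<Longrightarrow> l(f p := x) \<in> labs P f"
  unfolding labs_def by (metis PiE_fun_upd UNIV_I imageI insert_absorb)

text \<open>A dot slides along its circle through the saddle; algebraically, multiplication and
  comultiplication of the Frobenius algebra are A-linear in each factor. This is the linearity that
  \<open>linear_eq\<close> asks for.\<close>

lemma saddle_mulX:
  assumes "linked P f f' a c" "p \<in> P"
  shows "saddle P f f' a c (mulX (f p) z) = mulX (f' p) (saddle P f f' a c z)"
proof (rule additive_eq[OF subset_UNIV, where G = "\<lambda>z. saddle P f f' a c (mulX (f p) z)"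
      and H = "\<lambda>z. mulX (f' p) (saddle P f f' a c z)"])
  fix l
  have L: "is_part P f" "is_part P f'" "a \<in> P" "c \<in> P" "merges P f f' a c \<or> merges P f' f a c"
    using assms(1) unfolding linked_def by blast+
  define S where "S = f' ` P"
  have mem: "f' a \<in> S" "f' c \<in> S" "f' p \<in> S" using L(3,4) assms(2) by (simp_all add: S_def)
  have U: "(restrict g S)(f' p := x) = restrict (g(f' p := x)) S" for g :: "'a labelling" and x
    using mem(3) by (auto simp: restrict_def)
  have V: "restrict g S (f' p) = g (f' p)" for g :: "'a labelling" using mem(3) by simp
  from L(5) show "saddle P f f' a c (mulX (f p) (frag_of l)) = mulX (f' p) (saddle P f f' a c (frag_of l))"
  proof
    assume m: "merges P f f' a c"
    note F = merges_facts[OF L(1-4) m]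
    have ne: "f a \<noteq> f c" "f a \<notin> S" "f c \<notin> S" "f a \<noteq> f' a" "f c \<noteq> f' a"
      using F(3,4,6) mem(1) by (auto simp: S_def)
    \<comment> \<open>An old block is outside the domain of the new labelling, so its label no
      longer matters.\<close>
    have T: "restrict (l(b := y, f' a := x)) S = restrict (l(f' a := x)) S" if "b \<notin> S" for b x y
      by (rule restrict_ext) (use that in auto)
    note simps = saddle_merge[OF ne(1)] mulX_of S_def[symmetric] mem ne ne(1,4,5)[symmetric] U V
    consider "f p = f a" "f' p = f' a" | "f p = f c" "f' p = f' a"
      | "f p \<noteq> f a" "f p \<noteq> f c" "f' p = f p" "f p \<noteq> f' a"
      using F(8)[OF assms(2), folded F(1)] by blast
    then show ?thesis
    proof cases
      case 1
      note UV = U[unfolded 1] V[unfolded 1]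
      show ?thesis unfolding 1 by (cases "l (f a)"; cases "l (f c)") (simp_all add: simps UV T)
    next
      case 2
      note UV = U[unfolded 2] V[unfolded 2]
      show ?thesis unfolding 2 by (cases "l (f a)"; cases "l (f c)") (simp_all add: simps UV T)
    next
      case 3
      have W: "l(f p := LX, f' a := x) = l(f' a := x, f p := LX)" for x
        by (rule ext) (use 3(4) in simp)
      note UV = U[unfolded 3(3)] V[unfolded 3(3)] mem(3)[unfolded 3(3)]
      show ?thesis unfolding 3(3)
        using 3(1,2,4) by (cases "l (f a)"; cases "l (f c)"; cases "l (f p)") (simp_all add: simps UV W)
    qed
  next
    assume m: "merges P f' f a c"
    note F = merges_facts[OF L(2,1,3,4) m]
    have e: "f a = f c" using F(1,2) by simp
    have ne: "f c \<notin> S" "f' a \<noteq> f' c" "f c \<noteq> f' a" "f c \<noteq> f' c"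
      using F(2,5,6) mem(1,2) by (auto simp: S_def)
    have T: "restrict (l(f c := w, f' a := x, f' c := y)) S = restrict (l(f' a := x, f' c := y)) S" for w x y
      by (rule restrict_ext) (use ne in auto)
    have W: "l(f' a := x, f' c := y, f' a := w) = l(f' a := w, f' c := y)" for x y w
      by (rule ext) (use ne(2) in simp)
    note simps = saddle_split[OF e] mulX_of S_def[symmetric] mem ne ne(2-4)[symmetric]
    consider "f p = f c" "f' p = f' a" | "f p = f c" "f' p = f' c"
      | "f p \<noteq> f c" "f' p \<noteq> f' c" "f' p = f p" "f' p \<noteq> f' a"
      using F(8)[OF assms(2), folded F(2)] by blast
    then show ?thesis
    proof cases
      case 1
      note UV = U[unfolded 1] V[unfolded 1]
      show ?thesis unfolding 1 e by (cases "l (f c)") (simp_all add: simps e UV T W)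
    next
      case 2
      note UV = U[unfolded 2] V[unfolded 2]
      show ?thesis unfolding 2 e by (cases "l (f c)") (simp_all add: simps e UV T)
    next
      case 3
      have W: "l(f p := LX, f' a := x, f' c := y) = l(f' a := x, f' c := y, f p := LX)" for x y
        by (rule ext) (use 3 in simp)
      note UV = U[unfolded 3(3)] V[unfolded 3(3)] mem(3)[unfolded 3(3)]
      show ?thesis unfolding 3(3) using 3
        by (cases "l (f c)"; cases "l (f p)") (simp_all add: simps e UV W)
    qed
  qed
qed auto

lemma linkedD:
  assumes "linked P f f' a c"
  shows "finite P" "a \<in> P" "c \<in> P" "is_part P f" "is_part P f'" "linked P f' f a c"
  using assms by (auto simp: linked_def)

lemma unit_in_labs: "(\<lambda>C\<in>f ` P. L1) \<in> labs P f"
  by (auto simp: labs_def)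

lemma delX_unit: "p \<in> P \<Longrightarrow> delX (f p) (unit_lab P f) = 0"
  by (simp add: unit_lab_def delX_of)

lemma saddle_unit_merge:
  assumes "linked P f f' a c" "merges P f f' a c"
  shows "saddle P f f' a c (unit_lab P f) = unit_lab P f'"
proof -
  note F = merges_facts[OF linkedD(4,5,2,3)[OF assms(1)] assms(2)]
  have N: "C = f' a \<or> C \<in> f ` P" if "C \<in> f' ` P" for C using that F(1,7) by auto
  have "restrict ((\<lambda>C\<in>f ` P. L1)(f' a := L1)) (f' ` P) = (\<lambda>C\<in>f' ` P. L1)"
    by (rule restrict_ext) (use N in auto)
  then show ?thesis
    using linkedD(2,3)[OF assms(1)] by (simp add: unit_lab_def saddle_merge[OF F(6)])
qed

lemma saddle_unit_split:
  assumes "linked P f f' a c" "merges P f' f a c"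
  shows "saddle P f f' a c (unit_lab P f) = mulX (f' a) (unit_lab P f') + mulX (f' c) (unit_lab P f')"
proof -
  note F = merges_facts[OF linkedD(5,4,2,3)[OF assms(1)] assms(2)]
  have e: "f a = f c" using F by simp
  have P': "f' a \<in> f' ` P" "f' c \<in> f' ` P" "f a \<in> f ` P" using linkedD[OF assms(1)] by auto
  have N: "C = f' a \<or> C = f' c \<or> C \<in> f ` P" if "C \<in> f' ` P" for C using that F(7) by auto
  have "restrict ((\<lambda>C\<in>f ` P. L1)(f' a := L1, f' c := LX)) (f' ` P) = (\<lambda>C\<in>f' ` P. L1)(f' c := LX)"
    "restrict ((\<lambda>C\<in>f ` P. L1)(f' a := LX, f' c := L1)) (f' ` P) = (\<lambda>C\<in>f' ` P. L1)(f' a := LX)"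
    using N P' F(6) by (auto simp: fun_eq_iff restrict_def)
  then show ?thesis using P' by (simp add: unit_lab_def saddle_split[OF e] mulX_of add.commute)
qed

lemma linked_cases:
  assumes "linked P f f' a c"
  obtains "merges P f f' a c"
      "saddle P f f' a c (unit_lab P f) = unit_lab P f'" "card (f ` P) = Suc (card (f' ` P))"
  | "merges P f' f a c"
      "saddle P f f' a c (unit_lab P f) = mulX (f' a) (unit_lab P f') + mulX (f' c) (unit_lab P f')"
      "card (f' ` P) = Suc (card (f ` P))"
proof -
  have card: "card (g ` P) = Suc (card (g' ` P))" if m: "merges P g g' a c" and p: "is_part P g" "is_part P g'" for g g'
  proof -
    note F = merges_facts[OF p linkedD(2,3)[OF assms] m]
    have ac: "g a \<in> g ` P" "g c \<in> g ` P - {g a}" using linkedD[OF assms] F(6) by auto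
    have fin: "finite (g ` P)" using linkedD(1)[OF assms] by simp
    have "card (g ` P) = Suc (Suc (card (g ` P - {g a} - {g c})))"
      using fin ac by (metis card.remove finite_Diff)
    moreover have "g ` P - {g a} - {g c} = g ` P - {g a, g c}" by auto
    moreover have "card (g' ` P) = Suc (card (g ` P - {g a, g c}))"
      unfolding F(7) using fin F(5) by (subst card_insert_disjoint) auto
    ultimately show ?thesis by simp
  qed
  from assms have "merges P f f' a c \<or> merges P f' f a c" by (simp add: linked_def)
  then show thesis
  proof
    assume m: "merges P f f' a c"
    show thesis
      using that(1)[OF m saddle_unit_merge[OF assms m]] card[OF m linkedD(4,5)[OF assms]] by blast
  next
    assume m: "merges P f' f a c"
    show thesis
      using that(2)[OF m saddle_unit_split[OF assms m]] card[OF m linkedD(5,4)[OF assms]] by blast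
  qed
qed

text \<open>The composite is a tube, and cutting its neck gives X_a + X_c. The formula also covers a
  split followed by a merge, where both terms agree and it reads 2X.\<close>

lemma saddle_saddle:
  assumes L: "linked P f f' a c" and z: "supp z \<subseteq> labs P f"
  shows "saddle P f' f a c (saddle P f f' a c z) = mulX (f a) z + mulX (f c) z"
proof (rule linear_eq[OF linkedD(1)[OF L] z, where M = "\<lambda>p. mulX (f p)"
      and G = "\<lambda>z. saddle P f' f a c (saddle P f f' a c z)" and H = "\<lambda>z. mulX (f a) z + mulX (f c) z"])
  note L' = linkedD(6)[OF L]
  show "saddle P f' f a c (saddle P f f' a c (unit_lab P f)) = mulX (f a) (unit_lab P f) + mulX (f c) (unit_lab P f)"
    using L
  proof (cases rule: linked_cases)
    case 1
    then show ?thesis using saddle_unit_split[OF L' 1(1)] by simp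
  next
    case 2
    then show ?thesis using saddle_unit_merge[OF L' 2(1)] saddle_mulX[OF L', of a] saddle_mulX[OF L', of c] linkedD[OF L]
      by simp
  qed
qed (auto simp: saddle_mulX[OF L] saddle_mulX[OF linkedD(6)[OF L]] mulX_commute algebra_simps)

lemma merges_pair:
  assumes "is_part P f" "is_part P f'" "a \<in> P" "c \<in> P" "merges P f f' a c"
    and "e \<in> P" "g \<in> P" "f e \<noteq> f g" "f' e = f' g"
  shows "f e = f a \<and> f g = f c \<or> f e = f c \<and> f g = f a"
  using merges_facts(8)[OF assms(1-5) assms(6)] merges_facts(8)[OF assms(1-5) assms(7)] assms(8,9) by metis

text \<open>By linearity it suffices to compare the two routes on the all-1 labelling. Of the 16
  patterns of merges and splits, those whose routes change the number of blocks differently are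
  impossible. In the two patterns where both routes merge and then split, or both split and then
  merge, one has to know where the corners lie in \<open>D\<close>.\<close>

lemma saddle_square:
  assumes AB: "linked P A B a c" and CD: "linked P C D a c" and AC: "linked P A C e g" and BD: "linked P B D e g"
    and z: "supp z \<subseteq> labs P A"
  shows "saddle P B D e g (saddle P A B a c z) = saddle P C D a c (saddle P A C e g z)"
proof (rule linear_eq[OF linkedD(1)[OF AB] z, where M = "\<lambda>p. mulX (D p)"
      and G = "\<lambda>z. saddle P B D e g (saddle P A B a c z)" and H = "\<lambda>z. saddle P C D a c (saddle P A C e g z)"])
  have P: "a \<in> P" "c \<in> P" "e \<in> P" "g \<in> P" using linkedD[OF AB] linkedD[OF AC] by auto
  have part: "is_part P A" "is_part P B" "is_part P C" "is_part P D" using linkedD[OF AB] linkedD[OF CD] by auto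
  note X = saddle_mulX[OF AB] saddle_mulX[OF CD] saddle_mulX[OF AC] saddle_mulX[OF BD]
  let ?m = "\<lambda>p. mulX (D p)" and ?u = "unit_lab P D"
  \<comment> \<open>Both routes merge and then split: the values X_e + X_g and X_a + X_c agree
    because both pairs represent the same two blocks of \<open>D\<close>.\<close>
  have m: "D a \<in> {D e, D g}" "D c \<in> {D e, D g}" "D a \<noteq> D c"
    if "merges P A B a c" "merges P D B e g" "merges P A C e g" "merges P D C a c"
  proof -
    have "A e \<noteq> A g" "B e = B g" using that merges_facts(6)[OF part(1,3) P(3,4)] merges_facts(1,2)[OF part(4,2) P(3,4)] by simp_all
    then have "A e = A a \<or> A e = A c" using merges_pair[OF part(1,2) P(1,2) that(1) P(3,4)] by blast
    then have "B e = A a \<union> A c"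
      using merges_facts(5,8)[OF part(1,2) P(1,2) that(1)] P by metis
    then have "a \<in> D e \<union> D g" "c \<in> D e \<union> D g"
      using merges_facts(1)[OF part(4,2) P(3,4) that(2)] is_partD(1)[OF part(1)] P by auto
    then show "D a \<in> {D e, D g}" "D c \<in> {D e, D g}" using is_partD(2)[OF part(4)] P by blast+
    show "D a \<noteq> D c" using merges_facts(6)[OF part(4,3) P(1,2) that(4)] .
  qed
  \<comment> \<open>Both routes split and then merge: all four corners lie in one block of
    \<open>D\<close>, and both values are 2X.\<close>
  have n: "D a = D e" "D c = D a" "D g = D e"
    if "merges P B A a c" "merges P B D e g" "merges P C A e g" "merges P C D a c"
  proof -
    have "C a \<noteq> C c" "A a = A c" using that merges_facts(6)[OF part(3,4) P(1,2)] merges_facts(1,2)[OF part(2,1) P(1,2)] by simp_all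
    then have "C a \<union> C c = C e \<union> C g" using merges_pair[OF part(3,1) P(3,4) that(3) P(1,2)] by blast
    then have "e \<in> D a" using merges_facts(1)[OF part(3,4) P(1,2) that(4)] is_partD(1)[OF part(3)] P by auto
    then show "D a = D e" using is_partD(2)[OF part(4)] P by metis
    show "D c = D a" using merges_facts(1,2)[OF part(3,4) P(1,2) that(4)] by simp
    show "D g = D e" using merges_facts(1,2)[OF part(2,4) P(3,4) that(2)] by simp
  qed
  show "saddle P B D e g (saddle P A B a c (unit_lab P A)) = saddle P C D a c (saddle P A C e g (unit_lab P A))"
    apply (rule linked_cases[OF AB]; rule linked_cases[OF CD]; rule linked_cases[OF AC]; rule linked_cases[OF BD])
    subgoal by (simp add: X P)
    subgoal by (simp add: X P)
    subgoal by (simp add: X P)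
    subgoal by (simp add: X P)
    subgoal by (simp add: X P)
    subgoal using m by (auto simp: X P add.commute)
    subgoal by (simp add: X P)
    subgoal by (simp add: X P)
    subgoal by (simp add: X P)
    subgoal by (simp add: X P)
    subgoal using n by (auto simp: X P)
    subgoal by (simp add: X P)
    subgoal by (simp add: X P)
    subgoal by (simp add: X P)
    subgoal by (simp add: X P)
    subgoal by (simp add: X P mulX_commute algebra_simps)
    done
qed (auto simp: saddle_mulX[OF AB] saddle_mulX[OF CD] saddle_mulX[OF AC] saddle_mulX[OF BD])

text \<open>The derivative is not linear over points on T, so \<open>linear_eq\<close> does not
  apply; the induction over labellings treats the factor X_T separately.\<close>

lemma saddle_delX:
  assumes L: "linked P f f' a c" and t: "t \<in> P" "f t = T" "f' t = T" "a \<notin> T" "c \<notin> T"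
    and z: "supp z \<subseteq> labs P f"
  shows "saddle P f f' a c (delX T z) = delX T (saddle P f f' a c z)"
proof (rule additive_eq[OF z, where G = "\<lambda>z. saddle P f f' a c (delX T z)" and H = "\<lambda>z. delX T (saddle P f f' a c z)"])
  note D = linkedD[OF L] and X = saddle_mulX[OF L]
  have ne: "f' a \<noteq> T" "f' c \<noteq> T" using is_partD(1)[OF D(5)] D t by metis+
  fix l assume "l \<in> labs P f"
  with D(1) show "saddle P f f' a c (delX T (frag_of l)) = delX T (saddle P f f' a c (frag_of l))"
  proof (induction rule: labs_induct)
    case unit
    have u: "delX T (unit_lab P f) = 0" "delX T (unit_lab P f') = 0" using delX_unit[OF t(1)] t by metis+
    from L show ?case unfolding unit_lab_def[symmetric]
      using ne by (cases rule: linked_cases) (simp_all add: u delX_mulX_commute)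
  next
    case (mul l p)
    have e: "frag_of (l(f p := LX)) = mulX (f p) (frag_of l)" using mul by (simp add: mulX_of)
    show ?case
    proof (cases "f p = T")
      case True
      then have "t \<in> f p" using is_partD(1)[OF D(4) t(1)] t by simp
      have p: "p \<in> T" using is_partD(1)[OF D(4)] mul True by blast
      then have f'p: "f' p = T" using is_partD(2)[OF D(5) t(1), of p] t mul by simp
      \<comment> \<open>The labelling is free of X_T and hence, by the induction hypothesis, so is
        its image; the relation \<open>delX_mulX\<close> then cancels X_T on both sides.\<close>
      have 0: "delX T (frag_of l) = 0" using mul True by (simp add: delX_of)
      then have "delX T (saddle P f f' a c (frag_of l)) = 0" using mul.IH by simp
      moreover have "saddle P f f' a c (mulX T (frag_of l)) = mulX T (saddle P f f' a c (frag_of l))"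
        using X[OF mul(2), of "frag_of l"] True f'p by simp
      moreover have "frag_of (l(f p := LX)) = mulX T (frag_of l)" using e True by simp
      ultimately show ?thesis by (simp only: delX_mulX 0) simp
    next
      case False
      have "f' p \<noteq> T"
      proof
        assume "f' p = T"
        then have "p \<in> T" using is_partD(1)[OF D(5)] mul by metis
        then show False using False is_partD(2)[OF D(4) t(1), of p] t mul by simp
      qed
      then show ?thesis unfolding e using False by (simp add: X mul delX_mulX_commute mul.IH)
    qed
  qed
qed auto

text \<open>Split off T, cap it, give birth to it again and merge it back: the tube is replaced by a
  trivial sheet. This makes the split at a free circle a section up to
  \<open>delX T\<close>.\<close>

lemma saddle_delX_saddle:
  assumes L: "linked P f f' a c" and T: "f c = T" "a \<notin> T"
    and z: "supp z \<subseteq> labs P f'"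
  shows "saddle P f f' a c (delX T (saddle P f' f a c z)) = z"
proof (rule additive_eq[OF z, where G = "\<lambda>z. saddle P f f' a c (delX T (saddle P f' f a c z))" and H = "\<lambda>z. z"])
  note D = linkedD[OF L] and X = saddle_mulX[OF L] saddle_mulX[OF linkedD(6)[OF L]]
  have ne: "f a \<noteq> T" using is_partD(1)[OF D(4)] D T by metis
  have m: "merges P f f' a c" using L ne T merges_facts(1,2)[OF D(5,4,2,3)] unfolding linked_def by metis
  have ac: "f' a = f' c" using merges_facts(1,2)[OF D(4,5,2,3) m] by simp
  fix l assume "l \<in> labs P f'"
  with D(1) show "saddle P f f' a c (delX T (saddle P f' f a c (frag_of l))) = frag_of l"
  proof (induction rule: labs_induct)
    case unit
    have u: "delX T (unit_lab P f) = 0" using delX_unit[OF D(3)] T by metis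
    show ?case unfolding unit_lab_def[symmetric]
      using ne u saddle_unit_split[OF D(6) m] saddle_unit_merge[OF L m] T
      by (simp add: delX_mulX_commute delX_mulX)
  next
    case (mul l p)
    have e: "frag_of (l(f' p := LX)) = mulX (f' p) (frag_of l)" using mul by (simp add: mulX_of)
    \<comment> \<open>A point on T is replaced by \<open>a\<close>, which lies on the same circle
      after the merge, so that its X can be pulled past the derivative.\<close>
    obtain q where q: "q \<in> P" "f' q = f' p" "f q \<noteq> T"
    proof (cases "f p = T")
      case True
      then have "c \<in> f p" using is_partD(1)[OF D(4) D(3)] T by simp
      have "f' p = f' a" using merges_facts(1,8)[OF D(4,5,2,3) m] True T mul by metis
      then show ?thesis using that[of a] D ne by simp
    qed (use that[of p] mul in auto)
    have "frag_of (l(f' p := LX)) = mulX (f' q) (frag_of l)" using e q(2) by simp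
    then show ?case using q(1,3) by (simp only: X delX_mulX_commute mul.IH not_False_eq_True)
  qed
qed auto

text \<open>The tube gives X_a z + X_T z, and the derivative by X_T keeps only the coefficient of
  X_T.\<close>

lemma delX_saddle_saddle:
  assumes L: "linked P f f' a c" and T: "f c = T" "a \<notin> T"
    and z: "supp z \<subseteq> labs P f" and 0: "delX T z = 0"
  shows "delX T (saddle P f' f a c (saddle P f f' a c z)) = z"
proof -
  have "f a \<noteq> T" using is_partD(1)[OF linkedD(4)[OF L]] linkedD[OF L] T by metis
  then show ?thesis using saddle_saddle[OF L z] T 0 by (simp add: delX_mulX_commute delX_mulX)
qed

section \<open>The quantum grading of labellings\<close>

definition ldeg :: "'p set \<Rightarrow> ('p \<Rightarrow> 'p set) \<Rightarrow> 'p labelling \<Rightarrow> int" where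
  "ldeg P f l = (\<Sum>C\<in>f ` P. label_deg (l C))"

definition labsd :: "'p set \<Rightarrow> ('p \<Rightarrow> 'p set) \<Rightarrow> int \<Rightarrow> 'p labelling set" where
  "labsd P f e = {l \<in> labs P f. ldeg P f l = e}"

lemma ldeg_upd:
  assumes "finite P" "p \<in> P"
  shows "ldeg P f (l(f p := x)) = ldeg P f l - label_deg (l (f p)) + label_deg x"
proof -
  have s: "ldeg P f g = label_deg (g (f p)) + (\<Sum>C\<in>f ` P - {f p}. label_deg (g C))" for g
    unfolding ldeg_def using assms by (intro sum.remove) auto
  have "(\<Sum>C\<in>f ` P - {f p}. label_deg ((l(f p := x)) C)) = (\<Sum>C\<in>f ` P - {f p}. label_deg (l C))"
    by (rule sum.cong) auto
  then show ?thesis unfolding s[of l] s[of "l(f p := x)"] by simp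
qed

lemma degree_mulX:
  assumes "finite P" "p \<in> P" "supp z \<subseteq> labsd P f e"
  shows "supp (mulX (f p) z) \<subseteq> labsd P f (e - 2)"
  unfolding mulX_def
proof (rule order_trans[OF keys_frag_extend], intro UN_least)
  fix l assume "l \<in> supp z"
  then have "l \<in> labs P f" "ldeg P f l = e" using assms(3) by (auto simp: labsd_def)
  then show "supp (if l (f p) = L1 then frag_of (l(f p := LX)) else 0) \<subseteq> labsd P f (e - 2)"
    using labs_upd[of l P f p LX] assms(2) ldeg_upd[OF assms(1,2), of f l LX] by (auto simp: labsd_def)
qed

lemma degree_delX:
  assumes "finite P" "p \<in> P" "supp z \<subseteq> labsd P f e"
  shows "supp (delX (f p) z) \<subseteq> labsd P f (e + 2)"
  unfolding delX_def
proof (rule order_trans[OF keys_frag_extend], intro UN_least)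
  fix l assume "l \<in> supp z"
  then have "l \<in> labs P f" "ldeg P f l = e" using assms(3) by (auto simp: labsd_def)
  then show "supp (if l (f p) = LX then frag_of (l(f p := L1)) else 0) \<subseteq> labsd P f (e + 2)"
    using labs_upd[of l P f p L1] assms(2) ldeg_upd[OF assms(1,2), of f l L1] by (auto simp: labsd_def)
qed

lemma keys_sub_add: "supp x \<subseteq> S \<Longrightarrow> supp y \<subseteq> S \<Longrightarrow> supp (x + y) \<subseteq> S"
  using keys_add[of x y] by blast

lemma keys_sub_diff: "supp x \<subseteq> S \<Longrightarrow> supp y \<subseteq> S \<Longrightarrow>
    supp (x - y :: 'b \<Rightarrow>\<^sub>0 int) \<subseteq> S"
  using keys_diff[of x y] by blast

lemma degree_saddle:
  assumes L: "linked P f f' a c" and z: "supp z \<subseteq> labsd P f e"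
  shows "supp (saddle P f f' a c z) \<subseteq> labsd P f' (e - 1)"
proof -
  note D = linkedD[OF L]
  have u: "supp (unit_lab P g) \<subseteq> labsd P g (int (card (g ` P)))"
    and lu: "ldeg P g (\<lambda>C\<in>g ` P. L1) = int (card (g ` P))" for g
    unfolding unit_lab_def keys_frag_of labsd_def ldeg_def using unit_in_labs by (auto simp: unit_in_labs)
  have "supp (saddle P f f' a c (frag_of l)) \<subseteq> labsd P f' (ldeg P f l - 1)" if "l \<in> labs P f" for l
    using D(1) that
  proof (induction rule: labs_induct)
    case unit
    from L show ?case
    proof (cases rule: linked_cases)
      case 1
      then show ?thesis unfolding lu unit_lab_def[symmetric] using u[of f'] by simp
    next
      case 2
      have "int (card (f' ` P)) - 2 = int (card (f ` P)) - 1" using 2 by simp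
      then show ?thesis unfolding lu unit_lab_def[symmetric] 2(2)
        using degree_mulX[OF D(1) D(2) u[of f']] degree_mulX[OF D(1) D(3) u[of f']] by (metis keys_sub_add)
    qed
  next
    case (mul l p)
    have e: "frag_of (l(f p := LX)) = mulX (f p) (frag_of l)" using mul by (simp add: mulX_of)
    have d: "ldeg P f (l(f p := LX)) - 1 = ldeg P f l - 1 - 2" using ldeg_upd[OF D(1) mul(2), of f l LX] mul(3) by simp
    show ?case unfolding e saddle_mulX[OF L mul(2)] d by (rule degree_mulX[OF D(1) mul(2) mul.IH])
  qed
  then have "supp (saddle_gen P f f' a c l) \<subseteq> labsd P f' (e - 1)" if "l \<in> supp z" for l
    using that z unfolding saddle_def by (auto simp: labsd_def)
  then show ?thesis unfolding saddle_def by (intro order_trans[OF keys_frag_extend]) blast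
qed

section \<open>Cubes of partitions\<close>

type_synonym 'p chain = "bool list \<Rightarrow> ('p labelling \<Rightarrow>\<^sub>0 int)"
text \<open>Arbitrary families of partitions take the place of the smoothings of a diagram; a face
  of such a cube, with some crossings frozen, is again a cube of the same kind.\<close>

type_synonym 'p family = "bool list \<Rightarrow> 'p \<Rightarrow> 'p set"

abbreviation edge :: "'p set \<Rightarrow> ('p \<times> 'p) list \<Rightarrow> 'p family \<Rightarrow> bool list \<Rightarrow> nat \<Rightarrow>
    ('p labelling \<Rightarrow>\<^sub>0 int) \<Rightarrow> ('p labelling \<Rightarrow>\<^sub>0 int)" where
  "edge P cs F v k \<equiv> saddle P (F (v[k := False])) (F v) (fst (cs ! k)) (snd (cs ! k))"

text \<open>Organised by the target: the value at \<open>v\<close> sums over the edges ending in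
  \<open>v\<close>, whereas \<open>diff_gen\<close> sums over the edges leaving a generator.\<close>

definition bdry :: "'p set \<Rightarrow> ('p \<times> 'p) list \<Rightarrow> 'p family \<Rightarrow> 'p chain \<Rightarrow> 'p chain" where
  "bdry P cs F z = (\<lambda>v. \<Sum>k<length v. if v ! k then frag_cmul ((-1) ^ weight (take k v))
     (edge P cs F v k (z (v[k := False]))) else 0)"

definition chains :: "'p set \<Rightarrow> nat \<Rightarrow> 'p family \<Rightarrow> int \<Rightarrow> int \<Rightarrow> 'p chain set" where
  "chains P n F i j = {z. \<forall>v. supp (z v) \<subseteq>
     (if length v = n \<and> int (weight v) = i then labsd P (F v) (j - i) else {})}"

text \<open>The condition on edges excludes a crossing change that turns one circle into one circle.
  For a link diagram this is what planarity provides.\<close>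

definition good_cube :: "'p set \<Rightarrow> ('p \<times> 'p) list \<Rightarrow> 'p family \<Rightarrow> bool" where
  "good_cube P cs F \<longleftrightarrow> finite P \<and> (\<forall>v. length v = length cs \<longrightarrow> is_part P (F v)) \<and>
     (\<forall>v k. length v = length cs \<longrightarrow> k < length cs \<longrightarrow> v ! k \<longrightarrow>
        linked P (F (v[k := False])) (F v) (fst (cs ! k)) (snd (cs ! k)))"

definition actX :: "'p family \<Rightarrow> 'p \<Rightarrow> 'p chain \<Rightarrow> 'p chain" where
  "actX F p z = (\<lambda>v. mulX (F v p) (z v))"

definition actD :: "'p set \<Rightarrow> 'p chain \<Rightarrow> 'p chain" where
  "actD T z = (\<lambda>v. delX T (z v))"

definition actS :: "'p set \<Rightarrow> 'p family \<Rightarrow> 'p family \<Rightarrow> 'p \<Rightarrow> 'p \<Rightarrow> 'p chain \<Rightarrow> 'p chain" where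
  "actS P F F' a c z = (\<lambda>v. saddle P (F v) (F' v) a c (z v))"

definition link_all :: "'p set \<Rightarrow> nat \<Rightarrow> 'p family \<Rightarrow> 'p family \<Rightarrow> 'p \<Rightarrow> 'p \<Rightarrow> bool" where
  "link_all P n F F' a c \<longleftrightarrow> (\<forall>v. length v = n \<longrightarrow> linked P (F v) (F' v) a c)"

lemma link_all_sym: "link_all P n F F' a c \<Longrightarrow> link_all P n F' F a c"
  by (auto simp: link_all_def intro: linkedD(6))

lemma actX_simps [simp]:
  "actX F p 0 = 0" "actX F p (x + y) = actX F p x + actX F p y" "actX F p (x - y) = actX F p x - actX F p y"
  "actX F p (- x) = - actX F p x"
  by (simp_all add: actX_def fun_eq_iff)

lemma actD_simps [simp]:
  "actD T 0 = 0" "actD T (x + y) = actD T x + actD T y" "actD T (x - y) = actD T x - actD T y"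
  "actD T (- x) = - actD T x"
  by (simp_all add: actD_def fun_eq_iff)

lemma actS_simps [simp]:
  "actS P F F' a c 0 = 0" "actS P F F' a c (x + y) = actS P F F' a c x + actS P F F' a c y"
  "actS P F F' a c (x - y) = actS P F F' a c x - actS P F F' a c y"
  "actS P F F' a c (- x) = - actS P F F' a c x"
  by (simp_all add: actS_def fun_eq_iff)

lemma if_distribs: "(if b then x + y else 0) = (if b then x else 0) + (if b then y else (0::'b::ab_group_add))"
  "(if b then x - y else 0) = (if b then x else 0) - (if b then y else (0::'b))"
  by (cases b; simp)+

lemma frag_cmul_diff_distrib2: "frag_cmul k (x - y) = frag_cmul k x - frag_cmul k y"
  using frag_cmul_distrib2[of k "x - y" y] by (simp add: algebra_simps)

lemma bdry_simps [simp]: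
  "bdry P cs F 0 = 0" "bdry P cs F (x + y) = bdry P cs F x + bdry P cs F y"
  "bdry P cs F (x - y) = bdry P cs F x - bdry P cs F y"
  "bdry P cs F (- x) = - bdry P cs F x"
proof -
  show z: "bdry P cs F 0 = 0" by (rule ext) (simp add: bdry_def cong: if_cong)
  show d: "bdry P cs F (x - y) = bdry P cs F x - bdry P cs F y" for x y
    by (rule ext) (simp add: bdry_def frag_cmul_diff_distrib2 if_distribs sum_subtractf cong: if_cong)
  show "bdry P cs F (x + y) = bdry P cs F x + bdry P cs F y"
    by (rule ext) (simp add: bdry_def frag_cmul_distrib2 if_distribs sum.distrib cong: if_cong)
  show "bdry P cs F (- x) = - bdry P cs F x" using d[of 0 x] z by simp
qed

lemma mulX_sum: "mulX T (\<Sum>k\<in>A. g k) = (\<Sum>k\<in>A. mulX T (g k))"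
  by (induction A rule: infinite_finite_induct) auto

lemma delX_sum: "delX T (\<Sum>k\<in>A. g k) = (\<Sum>k\<in>A. delX T (g k))"
  by (induction A rule: infinite_finite_induct) auto

lemma saddle_sum: "saddle P f f' a c (\<Sum>k\<in>A. g k) = (\<Sum>k\<in>A. saddle P f f' a c (g k))"
  by (induction A rule: infinite_finite_induct) auto

lemma chains_keys:
  assumes "z \<in> chains P n F i j"
  shows "length v = n \<Longrightarrow> supp (z v) \<subseteq> labs P (F v)"
    and "length v \<noteq> n \<Longrightarrow> z v = 0"
proof -
  have k: "supp (z v) \<subseteq> (if length v = n \<and> int (weight v) = i then labsd P (F v) (j - i) else {})"
    using assms by (simp add: chains_def)
  show "supp (z v) \<subseteq> labs P (F v)"
    using k by (force simp: labsd_def split: if_splits)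
  show "z v = 0" if "length v \<noteq> n" using k that by simp
qed

lemma chains_closed [intro, simp]:
  "0 \<in> chains P n F i j"
  "x \<in> chains P n F i j \<Longrightarrow> y \<in> chains P n F i j \<Longrightarrow> x + y \<in> chains P n F i j"
  "x \<in> chains P n F i j \<Longrightarrow> y \<in> chains P n F i j \<Longrightarrow> x - y \<in> chains P n F i j"
  "x \<in> chains P n F i j \<Longrightarrow> - x \<in> chains P n F i j"
  unfolding chains_def by (simp_all add: keys_sub_add keys_sub_diff del: if_split)

lemma weight_append: "weight (xs @ ys) = weight xs + weight ys"
  by (simp add: weight_def)

lemma weight_Cons: "weight (b # xs) = of_bool b + weight xs"
  by (simp add: weight_def)

lemma weight_upd: "k < length v \<Longrightarrow> v ! k \<Longrightarrow> weight v = Suc (weight (v[k := False]))"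
proof -
  assume k: "k < length v" "v ! k"
  have v: "v = take k v @ True # drop (Suc k) v" using id_take_nth_drop[OF k(1)] k(2) by simp
  have "weight v = weight (take k v) + Suc (weight (drop (Suc k) v))"
    by (subst v) (simp add: weight_append weight_Cons)
  moreover have "weight (v[k := False]) = weight (take k v) + weight (drop (Suc k) v)"
    unfolding upd_conv_take_nth_drop[OF k(1)] by (simp add: weight_append weight_Cons)
  ultimately show ?thesis by simp
qed

lemma good_cubeD:
  assumes "good_cube P cs F"
  shows "finite P" "length v = length cs \<Longrightarrow> is_part P (F v)"
    "length v = length cs \<Longrightarrow> k < length cs \<Longrightarrow> v ! k \<Longrightarrow>
       linked P (F (v[k := False])) (F v) (fst (cs ! k)) (snd (cs ! k))"
  using assms by (simp_all add: good_cube_def)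

lemma keys_cmul_sub: "supp x \<subseteq> S \<Longrightarrow> supp (frag_cmul k x) \<subseteq> S"
  using keys_cmul by blast

lemma bdry_chains:
  assumes G: "good_cube P cs F" and z: "z \<in> chains P (length cs) F i j" and i: "i' = i + 1"
  shows "bdry P cs F z \<in> chains P (length cs) F i' j"
  unfolding chains_def
proof (intro CollectI allI)
  fix v
  let ?S = "if length v = length cs \<and> int (weight v) = i' then labsd P (F v) (j - i') else {}"
  have "supp (if v ! k then frag_cmul ((-1) ^ weight (take k v))
     (edge P cs F v k (z (v[k := False]))) else 0) \<subseteq> ?S"
    if k: "k < length v" for k
  proof (cases "v ! k \<and> length v = length cs")
    case True
    then have L: "linked P (F (v[k := False])) (F v) (fst (cs ! k)) (snd (cs ! k))"
      using good_cubeD(3)[OF G] k by simp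
    have w: "weight v = Suc (weight (v[k := False]))" using weight_upd k True by blast
    have zk: "supp (z (v[k := False])) \<subseteq> (if int (weight (v[k := False])) = i then labsd P (F (v[k := False])) (j - i) else {})"
      using z[unfolded chains_def, THEN CollectD, rule_format, of "v[k := False]"] True by simp
    show ?thesis
    proof (cases "int (weight v) = i'")
      case t: True
      then have "supp (z (v[k := False])) \<subseteq> labsd P (F (v[k := False])) (j - i)" using zk w i by simp
      from degree_saddle[OF L this] show ?thesis using True t i by (simp add: keys_cmul_sub algebra_simps)
    next
      case False
      then have "z (v[k := False]) = 0" using zk w i by simp
      then show ?thesis by simp
    qed
  next
    case False
    then have "v ! k \<Longrightarrow> z (v[k := False]) = 0" using chains_keys(2)[OF z, of "v[k := False]"] by auto
    then show ?thesis by auto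
  qed
  then show "supp (bdry P cs F z v) \<subseteq> ?S"
    unfolding bdry_def by (intro order_trans[OF keys_sum] UN_least) auto
qed

lemma actX_chains:
  assumes "finite P" "p \<in> P" "z \<in> chains P n F i j" "j' = j - 2"
  shows "actX F p z \<in> chains P n F i j'"
  unfolding chains_def
proof (intro CollectI allI)
  fix v
  have "supp (z v) \<subseteq> (if length v = n \<and> int (weight v) = i then labsd P (F v) (j - i) else {})"
    using assms(3) by (simp add: chains_def)
  then show "supp (actX F p z v) \<subseteq> (if length v = n \<and> int (weight v) = i then labsd P (F v) (j' - i) else {})"
    using degree_mulX[OF assms(1,2), of "z v" "F v" "j - i"] assms(4)
    by (auto simp: actX_def algebra_simps split: if_splits)
qed

lemma actD_chains:
  assumes "finite P" "t \<in> P" "\<And>v. length v = n \<Longrightarrow> F v t = T" "z \<in> chains P n F i j" "j' = j + 2"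
  shows "actD T z \<in> chains P n F i j'"
  unfolding chains_def
proof (intro CollectI allI)
  fix v
  have k: "supp (z v) \<subseteq> (if length v = n \<and> int (weight v) = i then labsd P (F v) (j - i) else {})"
    using assms(4) by (simp add: chains_def)
  have e: "j' - i = j - i + 2" using assms(5) by simp
  show "supp (actD T z v) \<subseteq> (if length v = n \<and> int (weight v) = i then labsd P (F v) (j' - i) else {})"
  proof (cases "length v = n \<and> int (weight v) = i")
    case True
    then show ?thesis using degree_delX[OF assms(1,2), of "z v" "F v" "j - i"] k assms(3)[of v]
      unfolding actD_def e by simp
  next
    case False
    then have "z v = 0" using k by auto
    then show ?thesis by (simp add: actD_def)
  qed
qed

lemma actS_chains:
  assumes "link_all P n F F' a c" "z \<in> chains P n F i j" "j' = j - 1"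
  shows "actS P F F' a c z \<in> chains P n F' i j'"
  unfolding chains_def
proof (intro CollectI allI)
  fix v
  have k: "supp (z v) \<subseteq> (if length v = n \<and> int (weight v) = i then labsd P (F v) (j - i) else {})"
    using assms(2) by (simp add: chains_def)
  have e: "j' - i = j - i - 1" using assms(3) by simp
  show "supp (actS P F F' a c z v) \<subseteq> (if length v = n \<and> int (weight v) = i then labsd P (F' v) (j' - i) else {})"
  proof (cases "length v = n \<and> int (weight v) = i")
    case True
    then have "linked P (F v) (F' v) a c" using assms(1) by (simp add: link_all_def)
    then show ?thesis using degree_saddle[of P "F v" "F' v" a c "z v" "j - i"] k True
      unfolding actS_def e by simp
  next
    case False
    then have "z v = 0" using k by auto
    then show ?thesis by (simp add: actS_def)
  qed
qed

lemma actX_commute: "actX F p (actX F q z) = actX F q (actX F p z)"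
  by (simp add: actX_def fun_eq_iff mulX_commute)

lemma actX_actX [simp]: "actX F p (actX F p z) = 0"
  by (simp add: actX_def fun_eq_iff)

lemma actD_actD [simp]: "actD T (actD T z) = 0"
  by (simp add: actD_def fun_eq_iff)

lemma actX_cong:
  assumes "\<And>v. length v = n \<Longrightarrow> F v p = F v q" "z \<in> chains P n F i j"
  shows "actX F p z = actX F q z"
proof
  fix v show "actX F p z v = actX F q z v"
    using assms(1)[of v] chains_keys(2)[OF assms(2), of v] by (cases "length v = n") (simp_all add: actX_def)
qed

lemma actS_actX:
  assumes "link_all P n F F' a c" "p \<in> P" "z \<in> chains P n F i j"
  shows "actS P F F' a c (actX F p z) = actX F' p (actS P F F' a c z)"
proof
  fix v show "actS P F F' a c (actX F p z) v = actX F' p (actS P F F' a c z) v"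
    using assms(1) saddle_mulX[of P "F v" "F' v" a c p] assms(2) chains_keys(2)[OF assms(3), of v]
    by (cases "length v = n") (simp_all add: actX_def actS_def link_all_def)
qed

lemma actS_actS:
  assumes "link_all P n F F' a c" "z \<in> chains P n F i j"
  shows "actS P F' F a c (actS P F F' a c z) = actX F a z + actX F c z"
proof
  fix v show "actS P F' F a c (actS P F F' a c z) v = (actX F a z + actX F c z) v"
    using assms(1) saddle_saddle[of P "F v" "F' v" a c "z v"] chains_keys[OF assms(2), of v]
    by (cases "length v = n") (simp_all add: actX_def actS_def link_all_def)
qed

lemma actS_square:
  assumes "link_all P n A B a c" "link_all P n C D a c" "link_all P n A C e g" "link_all P n B D e g"
    "z \<in> chains P n A i j"
  shows "actS P B D e g (actS P A B a c z) = actS P C D a c (actS P A C e g z)"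
proof
  fix v show "actS P B D e g (actS P A B a c z) v = actS P C D a c (actS P A C e g z) v"
    using assms(1-4) saddle_square[of P "A v" "B v" a c "C v" "D v" e g "z v"] chains_keys[OF assms(5), of v]
    by (cases "length v = n") (simp_all add: actS_def link_all_def)
qed

lemma actX_bdry:
  assumes G: "good_cube P cs F" and p: "p \<in> P" and z: "z \<in> chains P (length cs) F i j"
  shows "actX F p (bdry P cs F z) = bdry P cs F (actX F p z)"
proof
  fix v
  have "mulX (F v p) (edge P cs F v k (z (v[k := False])))
      = edge P cs F v k (mulX (F (v[k := False]) p) (z (v[k := False])))"
    if "k < length v" "v ! k" for k
  proof (cases "length v = length cs")
    case True
    then show ?thesis using saddle_mulX[OF good_cubeD(3)[OF G True, of k] p] that by simp
  next
    case False
    then show ?thesis using chains_keys(2)[OF z, of "v[k := False]"] by simp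
  qed
  then show "actX F p (bdry P cs F z) v = bdry P cs F (actX F p z) v"
    unfolding actX_def bdry_def mulX_sum by (intro sum.cong) auto
qed

lemma actD_bdry:
  assumes G: "good_cube P cs F" and t: "t \<in> P" "\<And>v. length v = length cs \<Longrightarrow> F v t = T"
    and off: "\<And>k. k < length cs \<Longrightarrow> fst (cs ! k) \<notin> T \<and> snd (cs ! k) \<notin> T"
    and z: "z \<in> chains P (length cs) F i j"
  shows "actD T (bdry P cs F z) = bdry P cs F (actD T z)"
proof
  fix v
  have "delX T (edge P cs F v k (z (v[k := False])))
      = edge P cs F v k (delX T (z (v[k := False])))"
    if "k < length v" "v ! k" for k
  proof (cases "length v = length cs")
    case True
    then show ?thesis
      using saddle_delX[OF good_cubeD(3)[OF G True, of k] t(1) t(2) t(2), of "z (v[k := False])"] that off[of k]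
        chains_keys(1)[OF z, of "v[k := False]"] by simp
  next
    case False
    then show ?thesis using chains_keys(2)[OF z, of "v[k := False]"] by simp
  qed
  then show "actD T (bdry P cs F z) v = bdry P cs F (actD T z) v"
    unfolding actD_def bdry_def delX_sum by (intro sum.cong) auto
qed

lemma actS_bdry:
  assumes G: "good_cube P cs F" "good_cube P cs F'" and L: "link_all P (length cs) F F' a c"
    and z: "z \<in> chains P (length cs) F i j"
  shows "actS P F F' a c (bdry P cs F z) = bdry P cs F' (actS P F F' a c z)"
proof
  fix v
  have "saddle P (F v) (F' v) a c (edge P cs F v k (z (v[k := False])))
      = saddle P (F' (v[k := False])) (F' v) (fst (cs ! k)) (snd (cs ! k))
         (saddle P (F (v[k := False])) (F' (v[k := False])) a c (z (v[k := False])))"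
    if "k < length v" "v ! k" for k
  proof (cases "length v = length cs")
    case True
    then show ?thesis
      using saddle_square[OF good_cubeD(3)[OF G(1) True, of k] good_cubeD(3)[OF G(2) True, of k], of a c "z (v[k := False])"] that
        chains_keys(1)[OF z, of "v[k := False]"] L by (simp add: link_all_def)
  next
    case False
    then show ?thesis using chains_keys(2)[OF z, of "v[k := False]"] by simp
  qed
  then show "actS P F F' a c (bdry P cs F z) v = bdry P cs F' (actS P F F' a c z) v"
    unfolding actS_def bdry_def saddle_sum by (intro sum.cong) auto
qed

lemma actD_actX:
  assumes "good_cube P cs F" "p \<in> P" "p \<notin> T" "z \<in> chains P (length cs) F i j"
  shows "actD T (actX F p z) = actX F p (actD T z)"
proof
  fix v show "actD T (actX F p z) v = actX F p (actD T z) v"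
    using is_partD(1)[OF good_cubeD(2)[OF assms(1), of v] assms(2)] assms(3)
      chains_keys(2)[OF assms(4), of v] delX_mulX_commute[of "F v p" T]
    by (cases "length v = length cs") (auto simp: actD_def actX_def)
qed

lemma actD_actX_self:
  assumes "\<And>v. length v = n \<Longrightarrow> F v t = T" "z \<in> chains P n F i j"
  shows "actD T (actX F t z) = z - actX F t (actD T z)"
proof
  fix v show "actD T (actX F t z) v = (z - actX F t (actD T z)) v"
    using assms(1)[of v] chains_keys(2)[OF assms(2), of v] by (cases "length v = n") (simp_all add: actD_def actX_def delX_mulX)
qed

lemma actS_actD_actS:
  assumes L: "link_all P n F F' a c" and T: "\<And>v. length v = n \<Longrightarrow> F v c = T" "a \<notin> T"
    and z: "z \<in> chains P n F' i j"
  shows "actS P F F' a c (actD T (actS P F' F a c z)) = z"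
proof
  fix v show "actS P F F' a c (actD T (actS P F' F a c z)) v = z v"
    using L saddle_delX_saddle[of P "F v" "F' v" a c T "z v"] T chains_keys[OF z, of v]
    by (cases "length v = n") (simp_all add: actD_def actS_def link_all_def)
qed

lemma actD_actS_actS:
  assumes L: "link_all P n F F' a c" and T: "\<And>v. length v = n \<Longrightarrow> F v c = T" "a \<notin> T"
    and z: "z \<in> chains P n F i j" and 0: "actD T z = 0"
  shows "actD T (actS P F' F a c (actS P F F' a c z)) = z"
proof
  fix v
  have "delX T (z v) = 0" using 0 unfolding actD_def by (metis zero_fun_apply)
  then show "actD T (actS P F' F a c (actS P F F' a c z)) v = z v"
    using L delX_saddle_saddle[of P "F v" "F' v" a c T "z v"] T chains_keys[OF z, of v]
    by (cases "length v = n") (simp_all add: actD_def actS_def link_all_def)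
qed

subsection \<open>Faces\<close>

definition ins :: "nat \<Rightarrow> 'b \<Rightarrow> 'b list \<Rightarrow> 'b list" where
  "ins k b u = take k u @ b # drop k u"

definition del :: "nat \<Rightarrow> 'b list \<Rightarrow> 'b list" where
  "del k u = take k u @ drop (Suc k) u"

text \<open>Translates positions of a face into positions of the cube it came from.\<close>

definition skip :: "nat \<Rightarrow> nat \<Rightarrow> nat" where
  "skip k m = (if m < k then m else Suc m)"

definition face0 :: "nat \<Rightarrow> 'p chain \<Rightarrow> 'p chain" where
  "face0 k z = (\<lambda>u. z (ins k False u))"

text \<open>The sign makes the differential of the cube restrict to minus that of the face, for every
  position \<open>k\<close>.\<close>

definition face1 :: "nat \<Rightarrow> 'p chain \<Rightarrow> 'p chain" where
  "face1 k z = (\<lambda>u. frag_cmul ((-1) ^ weight (take k u)) (z (ins k True u)))"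

lemma length_ins [simp]: "length (ins k b u) = Suc (length u)"
  by (simp add: ins_def)

lemma length_del: "k < length u \<Longrightarrow> length (del k u) = length u - 1"
  by (simp add: del_def)

lemma nth_ins:
  assumes "k \<le> length u" shows "ins k b u ! k = b" "m < length u \<Longrightarrow> ins k b u ! skip k m = u ! m"
  using assms by (auto simp: ins_def skip_def nth_append min_def Suc_diff_le)

lemma nth_del: "k < length u \<Longrightarrow> m < length u - 1 \<Longrightarrow> del k u ! m = u ! skip k m"
  by (auto simp: del_def skip_def nth_append min_def)

lemma ins_del: "k < length v \<Longrightarrow> ins k (v ! k) (del k v) = v"
  by (simp add: ins_def del_def min_def id_take_nth_drop[symmetric])

lemma del_ins: "k \<le> length u \<Longrightarrow> del k (ins k b u) = u"
  by (simp add: ins_def del_def min_def)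

lemma ins_upd:
  assumes "k \<le> length u"
  shows "(ins k b u)[k := x] = ins k x u" "m < length u \<Longrightarrow> (ins k b u)[skip k m := x] = ins k b (u[m := x])"
  using assms by (auto simp: ins_def skip_def list_update_append min_def take_update_swap drop_update_swap Suc_diff_le
      list_update_beyond split: nat.split)

lemma weight_ins: "weight (ins k b u) = of_bool b + weight u"
proof -
  have "weight u = weight (take k u) + weight (drop k u)" by (metis append_take_drop_id weight_append)
  then show ?thesis by (simp add: ins_def weight_append weight_Cons)
qed

lemma weight_take_ins:
  assumes "k \<le> length u"
  shows "weight (take k (ins k b u)) = weight (take k u)"
    "m < length u \<Longrightarrow> weight (take (skip k m) (ins k b u)) = weight (take m u) + (if m < k then 0 else of_bool b)"
proof -
  show "weight (take k (ins k b u)) = weight (take k u)" using assms by (simp add: ins_def)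
  assume m: "m < length u"
  show "weight (take (skip k m) (ins k b u)) = weight (take m u) + (if m < k then 0 else of_bool b)"
  proof (cases "m < k")
    case True
    then show ?thesis using assms by (simp add: ins_def skip_def min_def)
  next
    case False
    have "take m u = take k u @ take (m - k) (drop k u)"
      using take_add[of k "m - k" u] False by simp
    moreover have "take (skip k m) (ins k b u) = take k u @ b # take (m - k) (drop k u)"
      using False assms by (simp add: ins_def skip_def Suc_diff_le)
    ultimately show ?thesis using False by (simp add: weight_append weight_Cons)
  qed
qed

lemma sum_skip:
  assumes "k \<le> n"
  shows "(\<Sum>m<Suc n. g m) = g k + (\<Sum>m<n. g (skip k m) :: 'b::comm_monoid_add)"
proof -
  have "{..<Suc n} = insert k (skip k ` {..<n})"
  proof (intro equalityI subsetI)
    fix m assume m: "m \<in> {..<Suc n}"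
    consider "m < k" | "m = k" | "m > k" by linarith
    then show "m \<in> insert k (skip k ` {..<n})"
    proof cases
      case 1
      then have "m = skip k m" "m < n" using assms by (auto simp: skip_def)
      then show ?thesis by blast
    next
      case 3
      then have "m = skip k (m - 1)" "m - 1 < n" using m by (auto simp: skip_def)
      then show ?thesis by blast
    qed simp
  qed (use assms in \<open>auto simp: skip_def\<close>)
  moreover have "k \<notin> skip k ` {..<n}" "inj_on (skip k) {..<n}" by (auto simp: skip_def inj_on_def split: if_splits)
  ultimately show ?thesis by (simp add: sum.reindex)
qed

lemma face_simps [simp]:
  "face0 k 0 = 0" "face0 k (x + y) = face0 k x + face0 k y" "face0 k (x - y) = face0 k x - face0 k y"
  "face1 k 0 = 0" "face1 k (x + y) = face1 k x + face1 k y" "face1 k (x - y) = face1 k x - face1 k y"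
  by (simp_all add: face0_def face1_def fun_eq_iff frag_cmul_distrib2 frag_cmul_diff_distrib2)

lemma face_chains:
  assumes "z \<in> chains P (Suc n) F i j" "i' = i - 1" "j' = j - 1"
  shows "face0 k z \<in> chains P n (\<lambda>u. F (ins k False u)) i j"
    and "face1 k z \<in> chains P n (\<lambda>u. F (ins k True u)) i' j'"
proof -
  have z: "supp (z (ins k b u)) \<subseteq> (if length u = n \<and> int (weight u) = i - of_bool b then labsd P (F (ins k b u)) (j - i) else {})" for b u
    using assms(1)[unfolded chains_def, THEN CollectD, rule_format, of "ins k b u"] by (simp add: weight_ins eq_diff_eq add.commute)
  show "face0 k z \<in> chains P n (\<lambda>u. F (ins k False u)) i j"
    unfolding chains_def face0_def using z[of False] by simp
  show "face1 k z \<in> chains P n (\<lambda>u. F (ins k True u)) i' j'"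
    unfolding chains_def face1_def
  proof (intro CollectI allI keys_cmul_sub)
    fix v
    have e: "j' - i' = j - i" using assms(2,3) by simp
    show "supp (z (ins k True v)) \<subseteq>
        (if length v = n \<and> int (weight v) = i' then labsd P (F (ins k True v)) (j' - i') else {})"
      unfolding e unfolding assms(2) using z[of True v] by simp
  qed
qed

lemma face_inj:
  assumes "z \<in> chains P (Suc n) F i j" "w \<in> chains P (Suc n) F i' j'" "k \<le> n"
    and "face0 k z = face0 k w" "face1 k z = face1 k w"
  shows "z = w"
proof
  fix v
  have c: "frag_cmul ((-1) ^ e) x = frag_cmul ((-1) ^ e) y \<Longrightarrow> x = y" for e :: nat and x y :: "'a labelling \<Rightarrow>\<^sub>0 int"
    by (cases "even e") (simp_all add: frag_cmul_minus_one del: minus_frag_cmul)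
  show "z v = w v"
  proof (cases "length v = Suc n")
    case True
    then have v: "v = ins k (v ! k) (del k v)" using ins_del[of k v] assms(3) by simp
    show ?thesis
    proof (cases "v ! k")
      case True
      then show ?thesis using v fun_cong[OF assms(5), of "del k v"] c by (auto simp: face1_def)
    next
      case False
      then show ?thesis using v fun_cong[OF assms(4), of "del k v"] by (auto simp: face0_def)
    qed
  qed (use assms(1,2) chains_keys(2) in metis)
qed

lemma face_glue:
  assumes "z0 \<in> chains P n (\<lambda>u. F (ins k False u)) i j" "z1 \<in> chains P n (\<lambda>u. F (ins k True u)) i' j'"
    "i' = i - 1" "j' = j - 1" "k \<le> n"
  obtains z where "z \<in> chains P (Suc n) F i j" "face0 k z = z0" "face1 k z = z1"
proof
  define z where "z = (\<lambda>v. if length v = Suc n then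
     (if v ! k then frag_cmul ((-1) ^ weight (take k (del k v))) (z1 (del k v)) else z0 (del k v)) else 0)"
  show "z \<in> chains P (Suc n) F i j"
    unfolding chains_def
  proof (intro CollectI allI)
    fix v
    show "supp (z v) \<subseteq> (if length v = Suc n \<and> int (weight v) = i then labsd P (F v) (j - i) else {})"
    proof (cases "length v = Suc n")
      case True
      then have v: "v = ins k (v ! k) (del k v)" "length (del k v) = n" using ins_del[of k v] assms(5) by (simp_all add: length_del)
      have w: "weight v = of_bool (v ! k) + weight (del k v)" by (subst v(1)) (rule weight_ins)
      show ?thesis
      proof (cases "v ! k")
        case t: True
        have e: "j' - i' = j - i" "int (weight v) = i \<longleftrightarrow> int (weight (del k v)) = i'" "F (ins k True (del k v)) = F v"
          using assms(3,4) w t v(1) by auto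
        have "supp (z1 (del k v)) \<subseteq> (if length (del k v) = n \<and> int (weight (del k v)) = i' then labsd P (F (ins k True (del k v))) (j' - i') else {})"
          using assms(2)[unfolded chains_def] by simp
        then have "supp (z1 (del k v)) \<subseteq> (if int (weight v) = i then labsd P (F v) (j - i) else {})"
          unfolding e using v(2) by simp
        then show ?thesis using True t by (simp add: z_def keys_cmul_sub)
      next
        case f: False
        have "supp (z0 (del k v)) \<subseteq> (if length (del k v) = n \<and> int (weight (del k v)) = i then labsd P (F (ins k False (del k v))) (j - i) else {})"
          using assms(1)[unfolded chains_def] by simp
        then show ?thesis using True f w v by (auto simp: z_def)
      qed
    qed (simp add: z_def)
  qed
  show "face0 k z = z0"
  proof
    fix u show "face0 k z u = z0 u"
      using chains_keys(2)[OF assms(1), of u] assms(5) nth_ins(1)[of k u False] del_ins[of k u False]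
      by (cases "length u = n") (simp_all add: face0_def z_def)
  qed
  have "frag_cmul ((-1) ^ e) (frag_cmul ((-1) ^ e) x) = x" for e :: nat and x :: "'a labelling \<Rightarrow>\<^sub>0 int"
    by (simp add: power_add[symmetric])
  then show "face1 k z = z1"
    using chains_keys(2)[OF assms(2)] assms(5) nth_ins(1)[of k _ True] del_ins[of k _ True]
    by (auto simp: face1_def z_def fun_eq_iff)
qed

lemma good_cube_faces:
  assumes G: "good_cube P cs F" and n: "length cs = Suc n" "k \<le> n"
  shows "good_cube P (del k cs) (\<lambda>u. F (ins k b u))"
    and "link_all P n (\<lambda>u. F (ins k False u)) (\<lambda>u. F (ins k True u)) (fst (cs ! k)) (snd (cs ! k))"
    and "length (del k cs) = n"
proof -
  show l: "length (del k cs) = n" using n by (simp add: length_del)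
  show "good_cube P (del k cs) (\<lambda>u. F (ins k b u))"
    unfolding good_cube_def l
  proof (intro conjI allI impI)
    show "finite P" using good_cubeD(1)[OF G] .
    fix v :: "bool list" assume v: "length v = n"
    then show "is_part P (F (ins k b v))" using good_cubeD(2)[OF G] n by simp
    fix m assume m: "m < n" "v ! m"
    have s: "skip k m < Suc n" using m by (simp add: skip_def)
    show "linked P (F (ins k b (v[m := False]))) (F (ins k b v)) (fst (del k cs ! m)) (snd (del k cs ! m))"
      using good_cubeD(3)[OF G, of "ins k b v" "skip k m"] v n m s nth_ins(2)[of k v m b] ins_upd(2)[of k v m b False]
        nth_del[of k cs m] by simp
  qed
  show "link_all P n (\<lambda>u. F (ins k False u)) (\<lambda>u. F (ins k True u)) (fst (cs ! k)) (snd (cs ! k))"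
    unfolding link_all_def
  proof (intro allI impI)
    fix v :: "bool list" assume v: "length v = n"
    then show "linked P (F (ins k False v)) (F (ins k True v)) (fst (cs ! k)) (snd (cs ! k))"
      using good_cubeD(3)[OF G, of "ins k True v" k] n nth_ins(1)[of k v True] ins_upd(1)[of k v True False] by simp
  qed
qed

text \<open>This exhibits the cube as the mapping cone of the saddle at position \<open>k\<close>.
  With the sign built into \<open>face1\<close> the formula is the same for all \<open>k\<close>, so
  crossings may be resolved in any order.\<close>

lemma face_bdry:
  assumes n: "length cs = Suc n" "k \<le> n" and z: "z \<in> chains P (Suc n) F i j"
  shows "face0 k (bdry P cs F z) = bdry P (del k cs) (\<lambda>u. F (ins k False u)) (face0 k z)"
    and "face1 k (bdry P cs F z) =
      actS P (\<lambda>u. F (ins k False u)) (\<lambda>u. F (ins k True u)) (fst (cs ! k)) (snd (cs ! k)) (face0 k z)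
        - bdry P (del k cs) (\<lambda>u. F (ins k True u)) (face1 k z)"
proof -
  let ?t = "\<lambda>v m. if v ! m then frag_cmul ((-1) ^ weight (take m v))
     (saddle P (F (v[m := False])) (F v) (fst (cs ! m)) (snd (cs ! m)) (z (v[m := False]))) else 0"
  have out: "z (ins k b u) = 0" "z (ins k b (u[m := False])) = 0" if "length u \<noteq> n" for b u m
    using chains_keys(2)[OF z] that by simp_all
  have b: "bdry P cs F z (ins k b u) = ?t (ins k b u) k + (\<Sum>m<length u. ?t (ins k b u) (skip k m))" if "length u = n" for b u
    unfolding bdry_def using sum_skip[of k n "?t (ins k b u)"] n(2) that by simp
  have z0: "bdry P cs F z (ins k b u) = 0" if "length u \<noteq> n" for b u
    unfolding bdry_def using chains_keys(2)[OF z] that by (intro sum.neutral) auto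
  show "face0 k (bdry P cs F z) = bdry P (del k cs) (\<lambda>u. F (ins k False u)) (face0 k z)"
  proof
    fix u
    show "face0 k (bdry P cs F z) u = bdry P (del k cs) (\<lambda>u. F (ins k False u)) (face0 k z) u"
    proof (cases "length u = n")
      case True
      have "face0 k (bdry P cs F z) u = (\<Sum>m<length u. ?t (ins k False u) (skip k m))"
        unfolding face0_def b[OF True] using nth_ins(1)[of k u False] n(2) True by simp
      also have "\<dots> = bdry P (del k cs) (\<lambda>u. F (ins k False u)) (face0 k z) u"
        unfolding bdry_def face0_def
        by (intro sum.cong refl) (use True n in \<open>simp add: nth_ins(2) ins_upd(2) weight_take_ins(2) nth_del\<close>)
      finally show ?thesis .
    next
      case False
      then show ?thesis unfolding face0_def z0[OF False] by (simp add: bdry_def out cong: if_cong)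
    qed
  qed
  show "face1 k (bdry P cs F z) =
      actS P (\<lambda>u. F (ins k False u)) (\<lambda>u. F (ins k True u)) (fst (cs ! k)) (snd (cs ! k)) (face0 k z)
        - bdry P (del k cs) (\<lambda>u. F (ins k True u)) (face1 k z)"
  proof
    fix u
    let ?e = "(-1) ^ weight (take k u) :: int"
    let ?S = "actS P (\<lambda>u. F (ins k False u)) (\<lambda>u. F (ins k True u)) (fst (cs ! k)) (snd (cs ! k)) (face0 k z)"
    show "face1 k (bdry P cs F z) u = (?S - bdry P (del k cs) (\<lambda>u. F (ins k True u)) (face1 k z)) u"
    proof (cases "length u = n")
      case True
      have k: "k \<le> length u" using n True by simp
      have e: "?e * ?e = 1" by (simp add: power_add[symmetric])
      have "frag_cmul ?e (?t (ins k True u) k) = ?S u"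
        by (simp add: nth_ins(1)[OF k] ins_upd(1)[OF k] weight_take_ins(1)[OF k] e actS_def face0_def)
      moreover have "frag_cmul ?e (\<Sum>m<length u. ?t (ins k True u) (skip k m)) =
          - bdry P (del k cs) (\<lambda>u. F (ins k True u)) (face1 k z) u"
        unfolding bdry_def frag_cmul_sum sum_negf[symmetric]
      proof (intro sum.cong refl)
        fix m assume "m \<in> {..<length u}"
        then have m: "m < length u" by simp
        \<comment> \<open>Before \<open>k\<close>, changing the entry \<open>m\<close> alters the
          sign in \<open>face1\<close>; after \<open>k\<close>, the entry \<open>True\<close> at
          \<open>k\<close> is counted once in the edge sign. Either way one sign change
          results.\<close>
        have sg: "?e * (-1) ^ (weight (take m u) + (if m < k then 0 else 1)) =
          - ((-1) ^ weight (take m u) * (-1) ^ weight (take k (u[m := False])))" if "u ! m"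
        proof (cases "m < k")
          case True
          then have "weight (take k u) = Suc (weight ((take k u)[m := False]))"
            using weight_upd[of m "take k u"] m that k by simp
          then show ?thesis using True by (simp add: take_update_swap)
        next
          case False
          then show ?thesis by (simp add: mult.commute)
        qed
        show "frag_cmul ?e (?t (ins k True u) (skip k m)) =
          - (if u ! m then frag_cmul ((-1) ^ weight (take m u)) (saddle P (F (ins k True (u[m := False]))) (F (ins k True u))
              (fst (del k cs ! m)) (snd (del k cs ! m)) (face1 k z (u[m := False]))) else 0)"
        proof (cases "u ! m")
          case t: True
          show ?thesis
          proof (cases "m < k")
            case lt: True
            then show ?thesis using m k n True t sg[OF t]
              by (simp add: nth_ins(2) ins_upd(2) weight_take_ins(2) nth_del face1_def)
          next
            case ge: False
            then show ?thesis using m k n True t sg[OF t]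
              by (simp add: nth_ins(2) ins_upd(2) weight_take_ins(2) nth_del face1_def mult.commute)
          qed
        next
          case False
          then show ?thesis using m k by (simp add: nth_ins(2))
        qed
      qed
      ultimately show ?thesis unfolding face1_def[of k "bdry P cs F z"] b[OF True] by (simp add: frag_cmul_distrib2)
    next
      case False
      then show ?thesis unfolding face1_def z0[OF False] by (simp add: bdry_def actS_def face0_def out cong: if_cong)
    qed
  qed
qed

section \<open>Exactness lemmas for cubes\<close>

definition bounds :: "'p set \<Rightarrow> ('p \<times> 'p) list \<Rightarrow> 'p family \<Rightarrow> int \<Rightarrow> int \<Rightarrow> 'p chain \<Rightarrow> bool" where
  "bounds P cs F i j z \<longleftrightarrow> (\<exists>w\<in>chains P (length cs) F (i - 1) j. bdry P cs F w = z)"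

definition exact_at :: "'p set \<Rightarrow> ('p \<times> 'p) list \<Rightarrow> 'p family \<Rightarrow> int \<Rightarrow> int \<Rightarrow> bool" where
  "exact_at P cs F i j \<longleftrightarrow>
     (\<forall>z\<in>chains P (length cs) F i j. bdry P cs F z = 0 \<longrightarrow> bounds P cs F i j z)"

text \<open>Injectivity of multiplication by X_p X_q on the homology in bidegree (i, j); the product
  has quantum degree -4.\<close>

definition inj_XX :: "'p set \<Rightarrow> ('p \<times> 'p) list \<Rightarrow> 'p family \<Rightarrow> 'p \<Rightarrow> 'p \<Rightarrow> int \<Rightarrow> int \<Rightarrow> bool" where
  "inj_XX P cs F p q i j \<longleftrightarrow> (\<forall>z\<in>chains P (length cs) F i j. bdry P cs F z = 0 \<longrightarrow>
     bounds P cs F i (j - 4) (actX F p (actX F q z)) \<longrightarrow> bounds P cs F i j z)"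

text \<open>Because X_p^2 = 0, injectivity for equal points forces every class to vanish. Exactness
  thus becomes a case of \<open>inj_XX\<close>, and a move proved for the latter serves
  both.\<close>

lemma exact_at_iff_inj_XX: "exact_at P cs F i j \<longleftrightarrow> inj_XX P cs F p p i j"
proof -
  have "bounds P cs F i (j - 4) 0" unfolding bounds_def by (rule bexI[of _ 0]) simp_all
  then show ?thesis by (auto simp: exact_at_def inj_XX_def)
qed

section \<open>The mapping cone of the saddle at one crossing\<close>

locale cone =
  fixes P :: "'p set" and cs :: "('p \<times> 'p) list" and F :: "'p family" and k n :: nat
  assumes good: "good_cube P cs F" and len: "length cs = Suc n" and kn: "k \<le> n"
begin

abbreviation "cs' \<equiv> del k cs"
abbreviation "F0 \<equiv> \<lambda>u. F (ins k False u)"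
abbreviation "F1 \<equiv> \<lambda>u. F (ins k True u)"
abbreviation "a \<equiv> fst (cs ! k)"
abbreviation "c \<equiv> snd (cs ! k)"
abbreviation "d \<equiv> bdry P cs F"
abbreviation "d0 \<equiv> bdry P cs' F0"
abbreviation "d1 \<equiv> bdry P cs' F1"
abbreviation "S \<equiv> actS P F0 F1 a c"
abbreviation "S' \<equiv> actS P F1 F0 a c"
abbreviation "C \<equiv> chains P (Suc n) F"
abbreviation "C0 \<equiv> chains P n F0"
abbreviation "C1 \<equiv> chains P n F1"

lemma finite_P: "finite P"
  using good_cubeD(1)[OF good] .

lemmas good01 = good_cube_faces(1)[OF good len kn]
lemmas link = good_cube_faces(2)[OF good len kn]
lemmas link' = link_all_sym[OF link]
lemmas len' = good_cube_faces(3)[OF good len kn]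

lemma ac: "a \<in> P" "c \<in> P"
  using link[unfolded link_all_def, rule_format, of "replicate n False"] by (simp_all add: linked_def)

lemma d_C: "z \<in> C i j \<Longrightarrow> i' = i + 1 \<Longrightarrow> d z \<in> C i' j"
  using bdry_chains[OF good, unfolded len] .

lemma d0_C: "z \<in> C0 i j \<Longrightarrow> i' = i + 1 \<Longrightarrow> d0 z \<in> C0 i' j"
  using bdry_chains[OF good01, unfolded len'] .

lemma X_C: "p \<in> P \<Longrightarrow> z \<in> chains P m G i j \<Longrightarrow> j' = j - 2 \<Longrightarrow> actX G p z \<in> chains P m G i j'"
  using actX_chains[OF finite_P] .

lemmas S_C = actS_chains[OF link]
lemmas S'_C = actS_chains[OF link']

lemma f_C: "z \<in> C i j \<Longrightarrow> face0 k z \<in> C0 i j"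
  "z \<in> C i j \<Longrightarrow> i' = i - 1 \<Longrightarrow> j' = j - 1 \<Longrightarrow> face1 k z \<in> C1 i' j'"
  using face_chains(1)[of z P n F i j "i - 1" "j - 1" k] face_chains(2)[of z P n F i j i' j' k] by simp_all

lemma f_d: "z \<in> C i j \<Longrightarrow> face0 k (d z) = d0 (face0 k z)"
  "z \<in> C i j \<Longrightarrow> face1 k (d z) = S (face0 k z) - d1 (face1 k z)"
  using face_bdry[OF len kn, of z P F i j] by simp_all

lemma X_d0: "p \<in> P \<Longrightarrow> z \<in> C0 i j \<Longrightarrow> actX F0 p (d0 z) = d0 (actX F0 p z)"
  using actX_bdry[OF good01] by (simp add: len')

lemma S_d: "z \<in> C0 i j \<Longrightarrow> S (d0 z) = d1 (S z)"
  using actS_bdry[OF good01 good01] link by (simp add: len')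

lemma S'_d: "z \<in> C1 i j \<Longrightarrow> S' (d1 z) = d0 (S' z)"
  using actS_bdry[OF good01 good01] link' by (simp add: len')

lemma f_X: "face0 k (actX F p z) = actX F0 p (face0 k z)" "face1 k (actX F p z) = actX F1 p (face1 k z)"
  by (simp_all add: face0_def face1_def actX_def)

lemma glue:
  assumes "z0 \<in> C0 i j" "z1 \<in> C1 i' j'" "i' = i - 1" "j' = j - 1"
  obtains z where "z \<in> C i j" "face0 k z = z0" "face1 k z = z1"
  by (rule face_glue[where F = F, OF assms(1) assms(2) assms(3,4) kn]) (rule that)

lemma boundsI:
  assumes "z \<in> C i j" "w0 \<in> C0 (i - 1) j" "w1 \<in> C1 (i - 2) (j - 1)"
    and "face0 k z = d0 w0" "face1 k z = S w0 - d1 w1"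
  shows "bounds P cs F i j z"
proof -
  obtain w where w: "w \<in> C (i - 1) j" "face0 k w = w0" "face1 k w = w1"
    using glue[OF assms(2,3)] by auto
  have "d w = z"
    by (rule face_inj[OF d_C[OF w(1) refl] assms(1) kn]) (simp_all add: f_d[OF w(1)] w assms)
  then show ?thesis using w(1) by (auto simp: bounds_def len)
qed

lemma boundsE:
  assumes "bounds P cs F i j z"
  obtains w where "w \<in> C (i - 1) j" "d w = z" "face0 k w \<in> C0 (i - 1) j" "face1 k w \<in> C1 (i - 2) (j - 1)"
    "face0 k z = d0 (face0 k w)" "face1 k z = S (face0 k w) - d1 (face1 k w)"
proof -
  obtain w where w: "w \<in> C (i - 1) j" "d w = z" using assms by (auto simp: bounds_def len)
  show thesis
    by (rule that[OF w f_C(1)[OF w(1)] f_C(2)[OF w(1)]]) (use f_d[OF w(1)] w(2) in auto)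
qed

lemma cycleD:
  assumes "z \<in> C i j" "d z = 0"
  shows "d0 (face0 k z) = 0" "d1 (face1 k z) = S (face0 k z)"
  using f_d[OF assms(1)] assms(2) by auto

lemma bounds0: "bounds P cs' F0 i j z \<longleftrightarrow> (\<exists>w\<in>C0 (i - 1) j. d0 w = z)"
  and bounds1: "bounds P cs' F1 i j z \<longleftrightarrow> (\<exists>w\<in>C1 (i - 1) j. d1 w = z)"
  by (simp_all add: bounds_def len')

text \<open>The connecting map of the long exact sequence is injective on the classes on which \<open>X\<^sub>c X\<^sub>a\<close> is:
  composing the saddle with its reverse is multiplication by \<open>X\<^sub>a + X\<^sub>c\<close>.\<close>

lemma exact_of_inj_XX:
  assumes 0: "inj_XX P cs' F0 c a i j" and 1: "exact_at P cs' F1 (i - 1) (j - 1)"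
  shows "exact_at P cs F i j"
  unfolding exact_at_def len
proof (intro ballI impI)
  fix z assume z: "z \<in> C i j" and dz: "d z = 0"
  define z0 z1 where "z0 = face0 k z" and "z1 = face1 k z"
  have z0: "z0 \<in> C0 i j" and z1: "z1 \<in> C1 (i - 1) (j - 1)" using f_C z by (auto simp: z0_def z1_def)
  have e: "d0 z0 = 0" "d1 z1 = S z0" using cycleD[OF z dz] by (auto simp: z0_def z1_def)
  have S'z1: "S' z1 \<in> C0 (i - 1) (j - 2)" using S'_C[OF z1] by simp
  have "actX F0 a z0 + actX F0 c z0 = d0 (S' z1)"
    using actS_actS[OF link z0] S'_d[OF z1] e(2) by simp
  \<comment> \<open>The further factor X_c kills the summand X_c z0 and leaves only X_a X_c.\<close>
  then have "actX F0 c (actX F0 a z0 + actX F0 c z0) = actX F0 c (d0 (S' z1))" by simp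
  then have "actX F0 c (actX F0 a z0) = d0 (actX F0 c (S' z1))"
    using X_d0[OF ac(2) S'z1] by simp
  moreover have "actX F0 c (S' z1) \<in> C0 (i - 1) (j - 4)" using X_C[OF ac(2) S'z1] by simp
  ultimately have "bounds P cs' F0 i (j - 4) (actX F0 c (actX F0 a z0))" unfolding bounds0 by metis
  then obtain w0 where w0: "w0 \<in> C0 (i - 1) j" "d0 w0 = z0"
    using 0 z0 e(1) unfolding inj_XX_def len' bounds0 by blast
  have Sw0: "S w0 \<in> C1 (i - 1) (j - 1)" using S_C[OF w0(1)] by simp
  \<comment> \<open>With the 0-face bounded by \<open>w0\<close>, what is left of \<open>z\<close>
    is a cycle of the 1-face.\<close>
  have "d1 (z1 - S w0) = 0" using e(2) S_d[OF w0(1)] w0(2) by simp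
  then obtain w1 where w1: "w1 \<in> C1 (i - 1 - 1) (j - 1)" "d1 w1 = z1 - S w0"
    using 1 z1 Sw0 unfolding exact_at_def len' bounds1 by (meson chains_closed(3))
  show "bounds P cs F i j z"
    by (rule boundsI[OF z w0(1), of "- w1"]) (use w0 w1 in \<open>auto simp: z0_def z1_def\<close>)
qed

end

text \<open>Induction on the dimension through the cone at position 0: in the 1-face the two mixed
  terms cancel because the saddle is a chain map.\<close>

lemma bdry_bdry:
  assumes "good_cube P cs F" "z \<in> chains P (length cs) F i j"
  shows "bdry P cs F (bdry P cs F z) = 0"
  using assms
proof (induction "length cs" arbitrary: cs F z i j)
  case 0
  have "bdry P cs F x = 0" if x: "x \<in> chains P (length cs) F i' j'" for x i' j'
  proof
    fix v show "bdry P cs F x v = 0 v"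
      unfolding bdry_def using chains_keys(2)[OF x] 0(1) by (cases "v = []") (auto intro!: sum.neutral)
  qed
  from this[OF 0(3)] show ?case by (simp only: bdry_simps)
next
  case (Suc n)
  interpret cone P cs F 0 n by unfold_locales (use Suc in auto)
  have z: "z \<in> C i j" using Suc.prems(2) len by simp
  have dz: "d z \<in> C (i + 1) j" "d (d z) \<in> C (i + 2) j" using d_C[OF z refl] d_C[OF d_C[OF z refl], of "i + 2"] by auto
  have IH: "d0 (d0 (face0 0 z)) = 0" "d1 (d1 (face1 0 z)) = 0"
    using Suc.hyps(1)[OF _ good01] f_C[OF z] len' by metis+
  show ?case
    by (rule face_inj[OF dz(2) chains_closed(1) kn]) (simp_all add: f_d[OF dz(1)] f_d[OF z] IH S_d[OF f_C(1)[OF z]])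
qed

section \<open>Type I moves in which the 0-smoothing splits off the free circle\<close>

locale cone_free0 = cone +
  fixes T
  assumes T: "length u = n \<Longrightarrow> F0 u c = T" and aT: "a \<notin> T"
    and off: "m < n \<Longrightarrow> fst (cs' ! m) \<notin> T \<and> snd (cs' ! m) \<notin> T"
begin

abbreviation "del_T \<equiv> actD T"

lemma D_C: "z \<in> C0 i j \<Longrightarrow> j' = j + 2 \<Longrightarrow> del_T z \<in> C0 i j'"
  using actD_chains[OF finite_P ac(2), of n F0 T z i j j'] T by simp

lemma D_d: "z \<in> C0 i j \<Longrightarrow> del_T (d0 z) = d0 (del_T z)"
  using actD_bdry[OF good01 ac(2), of False T] T off by (simp add: len')

lemma D_X: "p \<in> P \<Longrightarrow> p \<notin> T \<Longrightarrow> z \<in> C0 i j \<Longrightarrow> del_T (actX F0 p z) = actX F0 p (del_T z)"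
  using actD_actX[OF good01] by (simp add: len')

lemma D_Xc: "z \<in> C0 i j \<Longrightarrow> del_T (actX F0 c z) = z - actX F0 c (del_T z)"
  using actD_actX_self[of n F0 c T z P i j] T by simp

lemma SDS': "z \<in> C1 i j \<Longrightarrow> S (del_T (S' z)) = z"
  using actS_actD_actS[OF link T aT] .

lemma DS'S: "z \<in> C0 i j \<Longrightarrow> del_T z = 0 \<Longrightarrow> del_T (S' (S z)) = z"
  using actD_actS_actS[OF link T aT] .

lemma F1_ac: "z \<in> C1 i j \<Longrightarrow> actX F1 c z = actX F1 a z"
proof (rule actX_cong[of n])
  fix v :: "bool list" assume v: "length v = n"
  then have L: "linked P (F0 v) (F1 v) a c" using link by (simp add: link_all_def)
  have "F0 v c \<noteq> F0 v a" using T[OF v] aT is_partD(1)[OF linkedD(4)[OF L] ac(1)] by metis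
  then have "merges P (F0 v) (F1 v) a c"
    using L merges_facts(1,2)[OF linkedD(5,4,2,3)[OF L]] unfolding linked_def by metis
  from merges_facts(1,2)[OF linkedD(4,5,2,3)[OF L] this] show "F1 v c = F1 v a" by simp
qed

lemma T_cong:
  assumes "p \<in> P" "p \<in> T" "z \<in> C0 i j" shows "actX F0 p z = actX F0 c z"
proof (rule actX_cong[of n, OF _ assms(3)])
  fix v :: "bool list" assume v: "length v = n"
  have "is_part P (F0 v)" using good_cubeD(2)[OF good01] v len' by metis
  from is_partD(2)[OF this ac(2) assms(1)] show "F0 v p = F0 v c" using T[OF v] assms(2) by simp
qed

text \<open>After the merge X_c acts as X_a. Replacing X_c by X_a in the decomposition of
  \<open>z\<close> along X_c gives a chain \<open>g\<close> without X_T and with the same image; the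
  merge is injective on such chains, so \<open>g\<close> vanishes, and this is the asserted
  formula.\<close>

lemma kernel_S:
  assumes z: "z \<in> C0 i j" and S0: "S z = 0"
  shows "z = actX F0 c (del_T z) - actX F0 a (del_T z)"
proof -
  have Dz: "del_T z \<in> C0 i (j + 2)" using D_C[OF z] by simp
  define g where "g = del_T (actX F0 c z) + actX F0 a (del_T z)"
  have XcDz: "actX F0 c (del_T z) \<in> C0 i j" "actX F0 a (del_T z) \<in> C0 i j" using X_C[OF _ Dz] ac by auto
  have zc: "z = actX F0 c (del_T z) + del_T (actX F0 c z)" using D_Xc[OF z] by simp
  have Xcz: "actX F0 c z \<in> C0 i (j - 2)" using X_C[OF ac(2) z] by simp
  have g: "g \<in> C0 i j" using D_C[OF Xcz] XcDz by (auto simp: g_def)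
  have Dg: "del_T g = 0" unfolding g_def using D_X[OF ac(1) aT Dz] by simp
  have SDz: "S (del_T z) \<in> C1 i (j + 1)" using S_C[OF Dz, of "j + 1"] by simp
  have "S z = S (actX F0 c (del_T z)) + S (del_T (actX F0 c z))" using arg_cong[OF zc, of S] by simp
  also have "S (actX F0 c (del_T z)) = actX F1 a (S (del_T z))"
    using actS_actX[OF link ac(2) Dz] F1_ac[OF SDz] by simp
  also have "\<dots> = S (actX F0 a (del_T z))" using actS_actX[OF link ac(1) Dz] by simp
  finally have "S z = S g" unfolding g_def actS_simps by (simp only: add.commute)
  then have "S g = 0" using S0 by (rule trans[OF sym])
  then have "g = 0" using DS'S[OF g Dg] by simp
  then have "del_T (actX F0 c z) = - actX F0 a (del_T z)" by (simp add: g_def eq_neg_iff_add_eq_0)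
  then show ?thesis using zc by simp
qed

lemma S_kernel:
  assumes z: "z \<in> C0 i j" shows "S (actX F0 c z - actX F0 a z) = 0"
proof -
  have "S z \<in> C1 i (j - 1)" using S_C[OF z] by simp
  then show ?thesis using actS_actX[OF link ac(1) z] actS_actX[OF link ac(2) z] F1_ac by simp
qed

text \<open>The cube retracts onto the kernel of the merge, whose elements are (X_c - X_a) h with
  \<open>h\<close> free of X_T; by h to S h this is a shifted copy of the complex of the 1-face.
  Since all squares vanish, X_c acts on this kernel as -X_a, so a point on T may be traded for
  \<open>a\<close>, and the sign does not affect injectivity.\<close>

lemma inj_XX_free0:
  assumes 1: "inj_XX P cs' F1 p' q i (j + 1)"
    and p: "p \<in> P" "p \<in> T \<and> p' = a \<or> p \<notin> T \<and> p' = p" and q: "q \<in> P" "q \<notin> T"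
  shows "inj_XX P cs F p q i j"
  unfolding inj_XX_def len
proof (intro ballI impI)
  fix z assume z: "z \<in> C i j" and dz: "d z = 0" and bz: "bounds P cs F i (j - 4) (actX F p (actX F q z))"
  define z0 z1 where "z0 = face0 k z" and "z1 = face1 k z"
  have z0: "z0 \<in> C0 i j" and z1: "z1 \<in> C1 (i - 1) (j - 1)" using f_C z by (auto simp: z0_def z1_def)
  have e: "d0 z0 = 0" "d1 z1 = S z0" using cycleD[OF z dz] by (auto simp: z0_def z1_def)
  \<comment> \<open>A preimage of \<open>z1\<close> under the merge; subtracting the boundary that
    it defines clears the 1-face and leaves \<open>zz\<close> in the kernel of
    \<open>S\<close>.\<close>
  define y where "y = del_T (S' z1)"
  have S'z1: "S' z1 \<in> C0 (i - 1) (j - 2)" using S'_C[OF z1] by simp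
  have y: "y \<in> C0 (i - 1) j" using D_C[OF S'z1] by (simp add: y_def)
  have Sy: "S y = z1" using SDS'[OF z1] by (simp add: y_def)
  define zz where "zz = z0 - d0 y"
  have zz: "zz \<in> C0 i j" using z0 d0_C[OF y] by (simp add: zz_def)
  have "S zz = 0" using S_d[OF y] e(2) Sy by (simp add: zz_def)
  define h where "h = del_T zz"
  have h: "h \<in> C0 i (j + 2)" using D_C[OF zz] by (simp add: h_def)
  have zzh: "zz = actX F0 c h - actX F0 a h" using kernel_S[OF zz \<open>S zz = 0\<close>] by (simp add: h_def)
  have dzz: "d0 zz = 0" using e(1) bdry_bdry[OF good01, unfolded len', OF y] by (simp add: zz_def)
  have dh: "d0 h = 0" using D_d[OF zz] dzz by (simp add: h_def)
  have Dh: "del_T h = 0" by (simp add: h_def)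
  have p': "p' \<in> P" using p ac by auto
  have Xqh: "actX F0 q h \<in> C0 i j" using X_C[OF q(1) h] by simp
  obtain w' where w': "w' \<in> C0 (i - 1) (j - 2)" "actX F0 p' (actX F0 q h) = d0 w'"
  proof -
    obtain w where w: "face0 k w \<in> C0 (i - 1) (j - 4)" "actX F0 p (actX F0 q z0) = d0 (face0 k w)"
      using boundsE[OF bz] unfolding f_X z0_def by metis
    have Xqy: "actX F0 q y \<in> C0 (i - 1) (j - 2)" using X_C[OF q(1) y] by simp
    have XXy: "actX F0 p (actX F0 q y) \<in> C0 (i - 1) (j - 4)" using X_C[OF p(1) Xqy] by simp
    \<comment> \<open>The correction by \<open>y\<close> turns the chain that bounds the product
      with \<open>z0\<close> into one that bounds the product with \<open>zz\<close>.\<close>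
    let ?w = "face0 k w - actX F0 p (actX F0 q y)"
    have w0: "?w \<in> C0 (i - 1) (j - 4)" using w XXy by auto
    have "actX F0 p (actX F0 q zz) = d0 ?w"
      using w(2) X_d0[OF q(1) y] X_d0[OF p(1) Xqy] by (simp add: zz_def)
    then have DXX: "del_T (actX F0 p (actX F0 q zz)) = d0 (del_T ?w)" using D_d[OF w0] by simp
    have Dw: "del_T ?w \<in> C0 (i - 1) (j - 2)" using D_C[OF w0] by simp
    have Xh: "actX F0 a h \<in> C0 i j" "actX F0 c h \<in> C0 i j" using X_C[OF _ h] ac by auto
    have XXh: "actX F0 q (actX F0 a h) \<in> C0 i (j - 2)" "actX F0 q (actX F0 c h) \<in> C0 i (j - 2)"
      using X_C[OF q(1) Xh(1)] X_C[OF q(1) Xh(2)] by auto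
    have Xqzz: "actX F0 q zz \<in> C0 i (j - 2)" using X_C[OF q(1) zz] by simp
    show thesis
    proof (cases "p \<in> T")
      case True
      \<comment> \<open>In X_c (X_c - X_a) h only -X_c X_a h survives, and \<open>del_T\<close> then
        strips the factor X_c.\<close>
      have "actX F0 p (actX F0 q zz) = actX F0 c (actX F0 q zz)" using T_cong[OF p(1) True Xqzz] .
      also have "\<dots> = - actX F0 c (actX F0 q (actX F0 a h))"
        using actX_commute[of F0 q c h] by (simp add: zzh)
      finally have "d0 (del_T ?w) = - del_T (actX F0 c (actX F0 q (actX F0 a h)))" using DXX by simp
      also have "\<dots> = - actX F0 q (actX F0 a h)"
        using D_Xc[OF XXh(1)] D_X[OF q Xh(1)] D_X[OF ac(1) aT h] Dh by simp
      finally have "d0 (- del_T ?w) = actX F0 q (actX F0 a h)" by (simp only: bdry_simps(4) minus_minus)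
      then have "actX F0 a (actX F0 q h) = d0 (- del_T ?w)" using actX_commute[of F0 a q h] by simp
      moreover have "p' = a" using p(2) True by blast
      ultimately show thesis using that[OF chains_closed(4)[OF Dw]] by (simp only:)
    next
      case False
      have "del_T (actX F0 p (actX F0 q zz)) = actX F0 p (actX F0 q (del_T zz))"
        using D_X[OF p(1) False Xqzz] D_X[OF q zz] by simp
      then show thesis using that[of "del_T ?w"] Dw p(2) False DXX by (auto simp: h_def)
    qed
  qed
  have Sh: "S h \<in> C1 i (j + 1)" using S_C[OF h, of "j + 1"] by simp
  have "d1 (S h) = 0" using S_d[OF h] dh by simp
  moreover have "actX F1 p' (actX F1 q (S h)) = d1 (S w')"
    using actS_actX[OF link q(1) h] actS_actX[OF link p' Xqh] S_d[OF w'(1)] w'(2) by simp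
  moreover have "S w' \<in> C1 (i - 1) (j + 1 - 4)" using S_C[OF w'(1)] by simp
  ultimately obtain w1 where w1: "w1 \<in> C1 (i - 1) (j + 1)" "d1 w1 = S h"
    using 1 Sh unfolding inj_XX_def len' bounds1 by metis
  have S'w1: "S' w1 \<in> C0 (i - 1) j" using S'_C[OF w1(1)] by simp
  \<comment> \<open>The bounding chain found in the 1-face is carried back: on chains free of X_T
    the merge is inverted by the reverse saddle followed by \<open>del_T\<close>.\<close>
  define g where "g = del_T (S' w1)"
  have g: "g \<in> C0 (i - 1) (j + 2)" using D_C[OF S'w1] by (simp add: g_def)
  have "d0 g = h" using D_d[OF S'w1] S'_d[OF w1(1)] w1(2) DS'S[OF h Dh] by (simp add: g_def)
  then have dg: "d0 (actX F0 c g - actX F0 a g) = zz"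
    using X_d0[OF ac(1) g] X_d0[OF ac(2) g] zzh by simp
  have Xg: "actX F0 c g - actX F0 a g \<in> C0 (i - 1) j" using X_C[OF _ g] ac by auto
  show "bounds P cs F i j z"
  proof (rule boundsI[OF z, of "y + (actX F0 c g - actX F0 a g)" 0])
    show "face0 k z = d0 (y + (actX F0 c g - actX F0 a g))"
      using dg by (simp only: bdry_simps) (simp add: zz_def z0_def)
    show "face1 k z = S (y + (actX F0 c g - actX F0 a g)) - d1 0"
      using S_kernel[OF g] Sy by (simp only: actS_simps bdry_simps) (simp add: z1_def)
  qed (use y Xg in auto)
qed

end

section \<open>Type I moves in which the 1-smoothing splits off the free circle\<close>

locale cone_free1 = cone +
  fixes T
  assumes T: "length u = n \<Longrightarrow> F1 u c = T" and aT: "a \<notin> T"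
    and off: "m < n \<Longrightarrow> fst (cs' ! m) \<notin> T \<and> snd (cs' ! m) \<notin> T"
begin

abbreviation "del_T \<equiv> actD T"

lemma D_C: "z \<in> C1 i j \<Longrightarrow> j' = j + 2 \<Longrightarrow> del_T z \<in> C1 i j'"
  using actD_chains[OF finite_P ac(2), of n F1 T z i j j'] T by simp

lemma D_d: "z \<in> C1 i j \<Longrightarrow> del_T (d1 z) = d1 (del_T z)"
  using actD_bdry[OF good01 ac(2), of True T] T off by (simp add: len')

lemma S'DS: "z \<in> C0 i j \<Longrightarrow> S' (del_T (S z)) = z"
  using actS_actD_actS[OF link' T aT] .

lemma DSS': "z \<in> C1 i j \<Longrightarrow> del_T z = 0 \<Longrightarrow> del_T (S (S' z)) = z"
  using actD_actS_actS[OF link' T aT] .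

text \<open>Here \<open>S\<close> is a split with left inverse given by \<open>del_T\<close> and
  \<open>S'\<close>. The 0-face cancels, and what remains are the chains of the 1-face free of X_T,
  which \<open>S'\<close> carries to the 0-face in bidegree (i - 1, j - 2).\<close>

lemma exact_free1:
  assumes 0: "exact_at P cs' F0 (i - 1) (j - 2)"
  shows "exact_at P cs F i j"
  unfolding exact_at_def len
proof (intro ballI impI)
  fix z assume z: "z \<in> C i j" and dz: "d z = 0"
  define z0 z1 where "z0 = face0 k z" and "z1 = face1 k z"
  have z0: "z0 \<in> C0 i j" and z1: "z1 \<in> C1 (i - 1) (j - 1)" using f_C z by (auto simp: z0_def z1_def)
  have e: "d0 z0 = 0" "d1 z1 = S z0" using cycleD[OF z dz] by (auto simp: z0_def z1_def)
  have Dz1: "del_T z1 \<in> C1 (i - 1) (j + 1)" using D_C[OF z1, of "j + 1"] by simp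
  \<comment> \<open>The left inverse of the split applied to \<open>z1\<close>; since
    \<open>z1\<close> has boundary \<open>S z0\<close>, this chain bounds \<open>z0\<close>.\<close>
  define w0 where "w0 = S' (del_T z1)"
  have w0: "w0 \<in> C0 (i - 1) j" using S'_C[OF Dz1] by (simp add: w0_def)
  have dw0: "d0 w0 = z0" using S'_d[OF Dz1] D_d[OF z1] e(2) S'DS[OF z0] by (simp add: w0_def)
  \<comment> \<open>The remainder is free of X_T because \<open>del_T\<close> after \<open>S\<close>
    and \<open>S'\<close> is the identity on \<open>del_T z1\<close>.\<close>
  define zz where "zz = z1 - S w0"
  have zz: "zz \<in> C1 (i - 1) (j - 1)" using z1 S_C[OF w0] by (simp add: zz_def)
  have dzz: "d1 zz = 0" using e(2) S_d[OF w0] dw0 by (simp add: zz_def)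
  have Dzz: "del_T zz = 0" using DSS'[OF Dz1] by (simp add: zz_def w0_def)
  have y: "S' zz \<in> C0 (i - 1) (j - 2)" using S'_C[OF zz] by simp
  have "d0 (S' zz) = 0" using S'_d[OF zz] dzz by simp
  then obtain h where h: "h \<in> C0 (i - 1 - 1) (j - 2)" "d0 h = S' zz"
    using 0 y unfolding exact_at_def len' bounds0 by blast
  have Sh: "S h \<in> C1 (i - 2) (j - 3)" using S_C[OF h(1)] by simp
  have DSh: "del_T (S h) \<in> C1 (i - 2) (j - 1)" using D_C[OF Sh] by simp
  have "d1 (del_T (S h)) = zz" using D_d[OF Sh] S_d[OF h(1)] h(2) DSS'[OF zz Dzz] by simp
  then show "bounds P cs F i j z"
    by (intro boundsI[OF z w0, of "- del_T (S h)"]) (use DSh dw0 in \<open>auto simp: z0_def z1_def zz_def\<close>)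
qed

end

subsection \<open>The second Reidemeister move\<close>

text \<open>The cube over the two crossings of a bigon; \<open>k\<close> counts positions after the
  crossing \<open>l\<close> has been removed. In the state \<open>F01\<close> the bigon closes up to
  the circle \<open>T\<close>, which contains the second corner of both crossings and meets no other
  crossing; \<open>F10\<close> is the state in which the strands are pulled apart.\<close>

locale square =
  fixes P :: "'p set" and cs :: "('p \<times> 'p) list" and F :: "'p family" and l k n :: nat and T :: "'p set"
  assumes good: "good_cube P cs F" and len: "length cs = Suc (Suc n)" and ln: "l \<le> Suc n" and kn: "k \<le> n"
    and T: "length u = n \<Longrightarrow> F (ins l True (ins k False u)) (snd (del l cs ! k)) = T"
      "length u = n \<Longrightarrow> F (ins l True (ins k False u)) (snd (cs ! l)) = T"
    and aT: "fst (del l cs ! k) \<notin> T" "fst (cs ! l) \<notin> T"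
    and off: "m < n \<Longrightarrow> fst (del k (del l cs) ! m) \<notin> T \<and> snd (del k (del l cs) ! m) \<notin> T"
begin

sublocale o: cone P cs F l "Suc n"
  by unfold_locales (use good len ln in auto)

sublocale i0: cone P "del l cs" "\<lambda>u. F (ins l False u)" k n
  by unfold_locales (use o.good01 o.len' kn in auto)

sublocale i1: cone_free0 P "del l cs" "\<lambda>u. F (ins l True u)" k n T
  by unfold_locales (use o.good01 o.len' kn T aT off in auto)

abbreviation "F00 \<equiv> \<lambda>u. F (ins l False (ins k False u))"
abbreviation "F10 \<equiv> \<lambda>u. F (ins l False (ins k True u))"
abbreviation "F01 \<equiv> \<lambda>u. F (ins l True (ins k False u))"
abbreviation "F11 \<equiv> \<lambda>u. F (ins l True (ins k True u))"
abbreviation "al \<equiv> fst (cs ! l)"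
abbreviation "cl \<equiv> snd (cs ! l)"
abbreviation "R0 \<equiv> actS P F00 F01 al cl"
abbreviation "R0' \<equiv> actS P F01 F00 al cl"
abbreviation "R1 \<equiv> actS P F10 F11 al cl"

lemma linkR: "link_all P n F00 F01 al cl" "link_all P n F10 F11 al cl"
  using o.link by (simp_all add: link_all_def)

lemmas linkR' = linkR[THEN link_all_sym]
lemmas R0_C = actS_chains[OF linkR(1)]
lemmas R0'_C = actS_chains[OF linkR'(1)]
lemmas R1_C = actS_chains[OF linkR(2)]

lemma R_d: "z \<in> i0.C0 i j \<Longrightarrow> R0 (i0.d0 z) = i1.d0 (R0 z)"
  "z \<in> i1.C0 i j \<Longrightarrow> R0' (i1.d0 z) = i0.d0 (R0' z)"
  "z \<in> i0.C1 i j \<Longrightarrow> R1 (i0.d1 z) = i1.d1 (R1 z)"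
  using actS_bdry[OF i0.good01 i1.good01] actS_bdry[OF i1.good01 i0.good01] linkR linkR' by (simp_all add: i0.len')

lemma R0'DR0: "z \<in> i0.C0 i j \<Longrightarrow> R0' (actD T (R0 z)) = z"
  using actS_actD_actS[OF linkR'(1) T(2) aT(2)] .

lemma DR0R0': "z \<in> i1.C0 i j \<Longrightarrow> actD T z = 0 \<Longrightarrow> actD T (R0 (R0' z)) = z"
  using actD_actS_actS[OF linkR'(1) T(2) aT(2)] .

lemma RS: "z \<in> i0.C0 i j \<Longrightarrow> i1.S (R0 z) = R1 (i0.S z)"
  using actS_square[OF linkR(1,2) i0.link i1.link] .

lemma RS': "z \<in> i0.C1 i j \<Longrightarrow> R0 (i0.S' z) = i1.S' (R1 z)"
  using actS_square[OF i0.link' i1.link' linkR(2,1)] .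

lemma face_R: "face0 k (o.S z) = R0 (face0 k z)" "face1 k (o.S z) = R1 (face1 k z)"
  by (simp_all add: face0_def face1_def actS_def)

lemma e_C:
  assumes "z \<in> o.C i j" "i' = i - 1" "j' = j - 1" "i'' = i - 2" "j'' = j - 2"
  shows "face0 k (face0 l z) \<in> i0.C0 i j" "face1 k (face0 l z) \<in> i0.C1 i' j'"
    "face0 k (face1 l z) \<in> i1.C0 i' j'" "face1 k (face1 l z) \<in> i1.C1 i'' j''"
  using i0.f_C[OF o.f_C(1)[OF assms(1)]] i1.f_C[OF o.f_C(2)[OF assms(1-3)]] assms by simp_all

lemma e_d:
  assumes "z \<in> o.C i j"
  shows "face0 k (face0 l (o.d z)) = i0.d0 (face0 k (face0 l z))"
    "face1 k (face0 l (o.d z)) = i0.S (face0 k (face0 l z)) - i0.d1 (face1 k (face0 l z))"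
    "face0 k (face1 l (o.d z)) = R0 (face0 k (face0 l z)) - i1.d0 (face0 k (face1 l z))"
    "face1 k (face1 l (o.d z)) = R1 (face1 k (face0 l z)) - i1.S (face0 k (face1 l z)) + i1.d1 (face1 k (face1 l z))"
  using o.f_d[OF assms] i0.f_d[OF o.f_C(1)[OF assms]] i1.f_d[OF o.f_C(2)[OF assms refl refl]]
  by (simp_all add: face_R)

text \<open>The bounding chain is glued from three components, with 0 at \<open>F11\<close>: this
  suffices because the merge from \<open>F01\<close> already reaches everything at
  \<open>F11\<close>.\<close>

lemma bounds_quadI:
  assumes z: "z \<in> o.C i j" and w: "w00 \<in> i0.C0 (i - 1) j" "w10 \<in> i0.C1 (i - 2) (j - 1)" "w01 \<in> i1.C0 (i - 2) (j - 1)"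
    and e: "face0 k (face0 l z) = i0.d0 w00" "face1 k (face0 l z) = i0.S w00 - i0.d1 w10"
    "face0 k (face1 l z) = R0 w00 - i1.d0 w01" "face1 k (face1 l z) = R1 w10 - i1.S w01"
  shows "bounds P cs F i j z"
proof -
  obtain u where u: "u \<in> o.C0 (i - 1) j" "face0 k u = w00" "face1 k u = w10" using i0.glue[OF w(1,2)] by auto
  obtain v where v: "v \<in> o.C1 (i - 2) (j - 1)" "face0 k v = w01" "face1 k v = 0"
    using i1.glue[OF w(3), of 0] by auto
  obtain w where w: "w \<in> o.C (i - 1) j" "face0 l w = u" "face1 l w = v" using o.glue[OF u(1) v(1)] by auto
  have dw: "o.d w \<in> o.C i j" using o.d_C[OF w(1)] by simp
  have "face0 l (o.d w) = face0 l z"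
    by (rule face_inj[OF o.f_C(1)[OF dw] o.f_C(1)[OF z] kn]) (simp_all add: e_d[OF w(1)] w u e)
  moreover have "face1 l (o.d w) = face1 l z"
    by (rule face_inj[OF o.f_C(2)[OF dw refl refl] o.f_C(2)[OF z refl refl] kn]) (simp_all add: e_d[OF w(1)] w u v e)
  ultimately have "o.d w = z" by (rule face_inj[OF dw z ln])
  then show ?thesis using w(1) by (auto simp: bounds_def len)
qed

text \<open>On the complex of the state \<open>F10\<close>, on which the second Reidemeister move retracts the cube,
  a point \<open>p\<close> on the far side of the bigon acts as minus the other point \<open>p'\<close>, up to homotopy.\<close>

lemma inj_XX_square:
  assumes 1: "inj_XX P (del k (del l cs)) F10 t p' (i - 1) (j - 1)"
    and t: "t \<in> P" "t \<notin> T" and p: "p \<in> P" "p \<in> T" "p' \<in> P"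
    and pp: "\<And>v. length v = n \<Longrightarrow> F10 v p = F10 v i0.a \<and> F10 v p' = F10 v i0.c \<or>
       F10 v p = F10 v i0.c \<and> F10 v p' = F10 v i0.a"
  shows "inj_XX P cs F t p i j"
  unfolding inj_XX_def len
proof (intro ballI impI)
  fix z assume z: "z \<in> o.C i j" and dz: "o.d z = 0" and bz: "bounds P cs F i (j - 4) (actX F t (actX F p z))"
  let ?del_T = "actD T"
  define z00 z10 z01 z11 where "z00 = face0 k (face0 l z)" and "z10 = face1 k (face0 l z)"
    and "z01 = face0 k (face1 l z)" and "z11 = face1 k (face1 l z)"
  note zdefs = z00_def z10_def z01_def z11_def
  have zC: "z00 \<in> i0.C0 i j" "z10 \<in> i0.C1 (i - 1) (j - 1)" "z01 \<in> i1.C0 (i - 1) (j - 1)" "z11 \<in> i1.C1 (i - 2) (j - 2)"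
    using e_C[OF z] by (simp_all add: zdefs)
  have cyc: "i0.d0 z00 = 0" "i0.d1 z10 = i0.S z00" "i1.d0 z01 = R0 z00" "i1.S z01 = R1 z10 + i1.d1 z11"
    using e_d[OF z] unfolding dz face_simps zdefs by (simp_all add: algebra_simps)
  have S'z11: "i1.S' z11 \<in> i1.C0 (i - 2) (j - 3)" using i1.S'_C[OF zC(4)] by simp
  \<comment> \<open>Clears the \<open>F11\<close> component, using the section of the merge from
    \<open>F01\<close>. The minus sign matches the sign of that merge in the differential.\<close>
  define y01 where "y01 = - ?del_T (i1.S' z11)"
  have y01: "y01 \<in> i1.C0 (i - 2) (j - 1)" using i1.D_C[OF S'z11] by (simp add: y01_def)
  have Sy01: "i1.S y01 = - z11" using i1.SDS'[OF zC(4)] by (simp add: y01_def)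
  have dy01: "i1.d0 y01 \<in> i1.C0 (i - 1) (j - 1)" using i1.d0_C[OF y01] by simp
  define q where "q = z01 + i1.d0 y01"
  have q: "q \<in> i1.C0 (i - 1) (j - 1)" using zC(3) dy01 by (simp add: q_def)
  have dq: "i1.d0 q = R0 z00" using cyc(3) bdry_bdry[OF i1.good01, unfolded i1.len', OF y01] by (simp add: q_def)
  have Dq: "?del_T q \<in> i1.C0 (i - 1) (j + 1)" using i1.D_C[OF q, of "j + 1"] by simp
  \<comment> \<open>The left inverse of the split \<open>R0\<close> applied to the
    \<open>F01\<close> component, which bounds \<open>z00\<close>.\<close>
  define y00 where "y00 = R0' (?del_T q)"
  have y00: "y00 \<in> i0.C0 (i - 1) j" using R0'_C[OF Dq] by (simp add: y00_def)
  have dy00: "i0.d0 y00 = z00"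
    using R_d(2)[OF Dq] i1.D_d[OF q] dq R0'DR0[OF zC(1)] by (simp add: y00_def)
  have Ry00: "R0 y00 \<in> i1.C0 (i - 1) (j - 1)" using R0_C[OF y00] by simp
  have Sy00: "i0.S y00 \<in> i0.C1 (i - 1) (j - 1)" using i0.S_C[OF y00] by simp
  \<comment> \<open>The normalised cycle has only the components \<open>x\<close> at
    \<open>F10\<close> and \<open>r\<close> at \<open>F01\<close>; the fact \<open>r_eq\<close>
    below shows that \<open>r\<close> is determined by \<open>x\<close>.\<close>
  define x where "x = z10 - i0.S y00"
  define r where "r = q - R0 y00"
  have x: "x \<in> i0.C1 (i - 1) (j - 1)" using zC(2) Sy00 by (simp add: x_def)
  have r: "r \<in> i1.C0 (i - 1) (j - 1)" using q Ry00 by (simp add: r_def)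
  have dx: "i0.d1 x = 0" using cyc(2) i0.S_d[OF y00] dy00 by (simp add: x_def)
  have Dr: "?del_T r = 0" using DR0R0'[OF Dq] by (simp add: r_def y00_def)
  have Sr: "i1.S r = R1 x"
    using cyc(4) i1.S_d[OF y01] Sy01 RS[OF y00] by (simp add: r_def q_def x_def)
  have r_eq: "?del_T (i1.S' (R1 x)) = r" using i1.DS'S[OF r Dr] Sr by simp
  have "bounds P (del k (del l cs)) F10 (i - 1) (j - 1 - 4) (actX F10 t (actX F10 p' x))"
  proof -
    obtain w where w: "w \<in> o.C (i - 1) (j - 4)" "o.d w = actX F t (actX F p z)"
      using bz by (auto simp: bounds_def len)
    define w00 w10 w01 where "w00 = face0 k (face0 l w)" and "w10 = face1 k (face0 l w)" and "w01 = face0 k (face1 l w)"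
    have wC: "w00 \<in> i0.C0 (i - 1) (j - 4)" "w10 \<in> i0.C1 (i - 2) (j - 5)" "w01 \<in> i1.C0 (i - 2) (j - 5)"
      using e_C[OF w(1)] by (simp_all add: w00_def w10_def w01_def)
    have we: "i0.d0 w00 = actX F00 t (actX F00 p z00)" "i0.S w00 - i0.d1 w10 = actX F10 t (actX F10 p z10)"
      "R0 w00 - i1.d0 w01 = actX F01 t (actX F01 p z01)"
      using e_d(1-3)[OF w(1)] unfolding w(2) o.f_X i0.f_X i1.f_X w00_def w10_def w01_def zdefs by simp_all
    have S'x: "i0.S' x \<in> i0.C0 (i - 1) (j - 2)" using i0.S'_C[OF x] by simp
    have Xy00: "actX F00 p y00 \<in> i0.C0 (i - 1) (j - 2)" using o.X_C[OF p(1) y00] by simp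
    have Xy01: "actX F01 p y01 \<in> i1.C0 (i - 2) (j - 3)" using o.X_C[OF p(1) y01] by simp
    \<comment> \<open>The last summand is the homotopy: the saddle applied to \<open>S' x\<close>
      gives X_a x + X_c x, that is X_p x + X_p' x, and so trades X_p for -X_p'.\<close>
    define v00 where "v00 = w00 - actX F00 t (actX F00 p y00) - actX F00 t (i0.S' x)"
    define v01 where "v01 = w01 - actX F01 t (actX F01 p y01)"
    have v00: "v00 \<in> i0.C0 (i - 1) (j - 4)"
      using wC o.X_C[OF t(1) Xy00] o.X_C[OF t(1) S'x] by (simp add: v00_def)
    have v01: "v01 \<in> i1.C0 (i - 2) (j - 5)"
      using wC o.X_C[OF t(1) Xy01] by (simp add: v01_def)
    have XX: "actX F10 i0.a x + actX F10 i0.c x = actX F10 p x + actX F10 p' x"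
    proof
      fix v show "(actX F10 i0.a x + actX F10 i0.c x) v = (actX F10 p x + actX F10 p' x) v"
        using pp[of v] chains_keys(2)[OF x, of v] by (cases "length v = n") (auto simp: actX_def)
    qed
    have "i0.S v00 - i0.d1 w10 = actX F10 t (actX F10 p z10) - actX F10 t (actX F10 p (i0.S y00))
        - actX F10 t (actX F10 i0.a x + actX F10 i0.c x)"
      unfolding v00_def using we(2) actS_actX[OF i0.link t(1) Xy00] actS_actX[OF i0.link p(1) y00]
        actS_actX[OF i0.link t(1) S'x] actS_actS[OF i0.link' x] by (simp add: algebra_simps)
    then have A: "i0.S v00 - i0.d1 w10 = - actX F10 t (actX F10 p' x)"
      unfolding XX by (simp add: x_def)
    have Xr: "actX F01 i1.a r \<in> i1.C0 (i - 1) (j - 3)" using o.X_C[OF i1.ac(1) r] by simp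
    have "R0 v00 - i1.d0 v01 = actX F01 t (actX F01 p z01) - actX F01 t (actX F01 p (R0 y00))
        + actX F01 t (actX F01 p (i1.d0 y01)) - actX F01 t (i1.S' (R1 x))"
      unfolding v00_def v01_def using we(3) actS_actX[OF linkR(1) t(1) Xy00] actS_actX[OF linkR(1) p(1) y00]
        actS_actX[OF linkR(1) t(1) S'x] RS'[OF x] i1.X_d0[OF t(1) Xy01] i1.X_d0[OF p(1) y01] by (simp add: algebra_simps)
    also have "\<dots> = actX F01 t (actX F01 p r) - actX F01 t (i1.S' (i1.S r))"
      unfolding Sr by (simp add: r_def q_def)
    \<comment> \<open>On T the point \<open>p\<close> acts as X_c, which cancels one term of the
      tube X_a + X_c; the term that remains is free of X_T.\<close>
    also have "\<dots> = - actX F01 t (actX F01 i1.a r)"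
      using actS_actS[OF i1.link r] i1.T_cong[OF p(1,2) r] by simp
    finally have "?del_T (R0 v00 - i1.d0 v01) = - ?del_T (actX F01 t (actX F01 i1.a r))" by simp
    then have "?del_T (R0 v00) = i1.d0 (?del_T v01)"
      using i1.D_X[OF t Xr] i1.D_X[OF i1.ac(1) aT(1) r] Dr i1.D_d[OF v01] by simp
    \<comment> \<open>So \<open>v00\<close> is the boundary of a chain at \<open>F00\<close>, and
      its saddle image can be absorbed into \<open>w10\<close>.\<close>
    then have B: "v00 = R0' (i1.d0 (?del_T v01))" using R0'DR0[OF v00] by simp
    have Dv01: "?del_T v01 \<in> i1.C0 (i - 2) (j - 3)" using i1.D_C[OF v01] by simp
    have R'v: "R0' (?del_T v01) \<in> i0.C0 (i - 2) (j - 4)" using R0'_C[OF Dv01] by simp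
    have "i0.S v00 = i0.d1 (i0.S (R0' (?del_T v01)))" unfolding B using R_d(2)[OF Dv01] i0.S_d[OF R'v] by simp
    then have "i0.d1 (w10 - i0.S (R0' (?del_T v01))) = actX F10 t (actX F10 p' x)" using A by (simp add: algebra_simps)
    moreover have "w10 - i0.S (R0' (?del_T v01)) \<in> i0.C1 (i - 1 - 1) (j - 1 - 4)"
      using wC(2) i0.S_C[OF R'v] by simp
    ultimately show ?thesis unfolding i0.bounds1 by blast
  qed
  then obtain m where m: "m \<in> i0.C1 (i - 1 - 1) (j - 1)" "i0.d1 m = x"
    using 1 x dx unfolding inj_XX_def i0.len' i0.bounds1 by blast
  have Rm: "R1 m \<in> i1.C1 (i - 2) (j - 2)" using R1_C[OF m(1)] by simp
  have S'Rm: "i1.S' (R1 m) \<in> i1.C0 (i - 2) (j - 3)" using i1.S'_C[OF Rm] by simp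
  have DS'Rm: "?del_T (i1.S' (R1 m)) \<in> i1.C0 (i - 2) (j - 1)" using i1.D_C[OF S'Rm] by simp
  have dm: "i1.d0 (?del_T (i1.S' (R1 m))) = r"
    using i1.D_d[OF S'Rm] i1.S'_d[OF Rm] R_d(3)[OF m(1)] m(2) r_eq by simp
  show "bounds P cs F i j z"
  proof (rule bounds_quadI[OF z y00, of "- m" "y01 - ?del_T (i1.S' (R1 m))"])
    show "face1 k (face0 l z) = i0.S y00 - i0.d1 (- m)" using m(2) by (simp add: x_def zdefs)
    show "face0 k (face1 l z) = R0 y00 - i1.d0 (y01 - ?del_T (i1.S' (R1 m)))" using dm by (simp add: r_def q_def zdefs)
    show "face1 k (face1 l z) = R1 (- m) - i1.S (y01 - ?del_T (i1.S' (R1 m)))"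
      using i1.SDS'[OF Rm] Sy01 by (simp add: zdefs)
  qed (use dy00 m(1) y01 DS'Rm in \<open>simp_all add: zdefs\<close>)
qed

end

section \<open>From cubes to Khovanov homology\<close>

definition corners :: "'p diagram \<Rightarrow> ('p \<times> 'p) list" where
  "corners D = map (\<lambda>(a, b, c, d). (a, c)) (crossings D)"

definition vpart :: "('p gen \<Rightarrow>\<^sub>0 int) \<Rightarrow> 'p chain" where
  "vpart z v = frag_extend (\<lambda>(v', l). if v' = v then frag_of l else 0) z"

lemma lookup_vpart: "poly_mapping.lookup (vpart z v) l = poly_mapping.lookup z (v, l)"
proof -
  have "supp z \<subseteq> UNIV" by simp
  then show ?thesis
  proof (induction z rule: frag_induction)
    case (one x)
    then show ?case by (cases x) (auto simp: vpart_def)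
  next
    case (diff a b)
    then show ?case by (simp add: vpart_def frag_extend_diff lookup_minus)
  qed (simp add: vpart_def)
qed

lemma vpart_inj: "vpart x = vpart y \<Longrightarrow> x = y"
  by (rule poly_mapping_eqI) (metis lookup_vpart prod.exhaust)

lemma vpart_simps [simp]: "vpart 0 = 0" "vpart (x - y) = vpart x - vpart y"
  by (simp_all add: vpart_def fun_eq_iff frag_extend_diff)

lemma vpart_keys: "l \<in> supp (vpart z v) \<longleftrightarrow> (v, l) \<in> supp z"
  by (simp add: in_keys_iff lookup_vpart)

lemma gens_iff: "(v, l) \<in> gens D i j \<longleftrightarrow> length v = length (corners D) \<and> int (weight v) = i \<and>
    l \<in> labsd (points D) (circle D v) (j - i)"
  by (auto simp: gens_def labsd_def labs_def ldeg_def corners_def circles_def)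

lemma keys_sub_if: "supp x \<subseteq> (if b then S else {}) \<longleftrightarrow> (\<forall>l. l \<in> supp x \<longrightarrow> b \<and> l \<in> S)"
  by (cases b) (auto simp del: keys_eq_empty)

lemma vpart_chains: "vpart z \<in> chains (points D) (length (corners D)) (circle D) i j \<longleftrightarrow>
    supp z \<subseteq> gens D i j"
proof -
  have "supp z \<subseteq> gens D i j \<longleftrightarrow> (\<forall>v l. (v, l) \<in> supp z \<longrightarrow> (v, l) \<in> gens D i j)" by auto
  also have "\<dots> \<longleftrightarrow> vpart z \<in> chains (points D) (length (corners D)) (circle D) i j"
    unfolding chains_def gens_iff vpart_keys[symmetric] mem_Collect_eq keys_sub_if by blast
  finally show ?thesis by simp
qed

lemma vpart_at: "vpart (frag_extend (\<lambda>l. frag_of (w, l)) y) v = (if w = v then y else 0)"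
proof (rule additive_eq[OF subset_UNIV, where G = "\<lambda>y. vpart (frag_extend (\<lambda>l. frag_of (w, l)) y) v"])
qed (auto simp: vpart_def frag_extend_diff)

lemma vpart_sum: "finite A \<Longrightarrow> vpart (\<Sum>k\<in>A. g k) v = (\<Sum>k\<in>A. vpart (g k) v)"
  by (simp add: vpart_def frag_extend_sum)

lemma vpart_surj:
  assumes "z \<in> chains P n F i j"
  obtains x where "vpart x = z"
proof
  have fin: "finite {w :: bool list. length w = n}"
    using finite_lists_length_eq[of "UNIV :: bool set" n] by simp
  show "vpart (\<Sum>w | length w = n. frag_extend (\<lambda>l. frag_of (w, l)) (z w)) = z"
  proof
    fix v show "vpart (\<Sum>w | length w = n. frag_extend (\<lambda>l. frag_of (w, l)) (z w)) v = z v"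
      unfolding vpart_sum[OF fin] vpart_at using fin chains_keys(2)[OF assms, of v] by (simp add: sum.delta')
  qed
qed

lemma edge_map_eq:
  assumes "k < length (crossings D)"
  shows "edge_map D k (v, l) = frag_extend (\<lambda>l'. frag_of (v[k := True], l'))
    (saddle_gen (points D) (circle D v) (circle D (v[k := True])) (fst (corners D ! k)) (snd (corners D ! k)) l)"
proof -
  obtain a b c d where x: "crossings D ! k = (a, b, c, d)" by (metis prod_cases4)
  have y: "corners D ! k = (a, c)" using assms x by (simp add: corners_def)
  show ?thesis
    by (cases "l (circle D v a)"; cases "l (circle D v c)")
      (simp_all add: edge_map_def saddle_gen_def x y circles_def frag_extend_add Let_def)
qed

text \<open>The same edges are listed by source on one side and by target on the other. The signs
  agree because both depend only on the entries before the changed one.\<close>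

lemma vpart_diff:
  assumes "supp z \<subseteq> {(v, l). length v = length (corners D)}"
  shows "vpart (diff D z) = bdry (points D) (corners D) (circle D) (vpart z)"
proof -
  let ?n = "length (corners D)" and ?B = "bdry (points D) (corners D) (circle D)"
  let ?s = "\<lambda>v w k. saddle_gen (points D) (circle D v) (circle D w) (fst (corners D ! k)) (snd (corners D ! k))"
  have n: "length (crossings D) = ?n" by (simp add: corners_def)
  have "vpart (diff D z) w = ?B (vpart z) w" for w
  proof (rule additive_eq[OF assms, where G = "\<lambda>z. vpart (diff D z) w" and H = "\<lambda>z. ?B (vpart z) w"])
    fix g assume "g \<in> {(v :: bool list, l :: 'a labelling). length v = ?n}"
    then obtain v l where g: "g = (v, l)" "length v = ?n" by auto
    have vp: "vpart (frag_of (v, l)) u = (if v = u then frag_of l else 0)" for u by (simp add: vpart_def)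
    have cm: "vpart (frag_cmul e x) w = frag_cmul e (vpart x w)" for e x by (simp add: vpart_def frag_extend_cmul)
    have "vpart (diff D (frag_of g)) w = (\<Sum>k | k < ?n \<and> \<not> v ! k. frag_cmul ((-1) ^ weight (take k v))
        (if v[k := True] = w then ?s v (v[k := True]) k l else 0))"
      unfolding g(1) diff_def by (simp add: diff_gen_def n vpart_sum cm edge_map_eq vpart_at)
    also have "\<dots> = (\<Sum>k<?n. if \<not> v ! k \<and> v[k := True] = w then frag_cmul ((-1) ^ weight (take k v)) (?s v w k l) else 0)"
      by (rule sum.mono_neutral_cong_left) auto
    also have "\<dots> = ?B (vpart (frag_of g)) w"
    proof (cases "length w = ?n")
      case True
      have "(if \<not> v ! k \<and> v[k := True] = w then frag_cmul ((-1) ^ weight (take k v)) (?s v w k l) else 0)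
        = (if w ! k then frag_cmul ((-1) ^ weight (take k w)) (saddle (points D) (circle D (w[k := False])) (circle D w)
            (fst (corners D ! k)) (snd (corners D ! k)) (vpart (frag_of (v, l)) (w[k := False]))) else 0)"
        if k: "k < ?n" for k
      proof (cases "w ! k \<and> w[k := False] = v")
        case True
        then have "\<not> v ! k" "v[k := True] = w" "take k v = take k w" using k g(2) \<open>length w = ?n\<close>
          by (auto simp: list_update_same_conv)
        then show ?thesis using True by (simp add: vp saddle_def)
      next
        case False
        then have "\<not> (\<not> v ! k \<and> v[k := True] = w)" using k g(2) by (auto simp: list_update_same_conv)
        then show ?thesis using False by (auto simp: vp)
      qed
      then show ?thesis unfolding bdry_def g(1) using True by (intro sum.cong) auto
    next
      case False
      have "(\<Sum>k<?n. if \<not> v ! k \<and> v[k := True] = w then frag_cmul ((-1) ^ weight (take k v)) (?s v w k l) else 0) = 0"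
        using False g(2) by (intro sum.neutral) auto
      moreover have "?B (vpart (frag_of g)) w = 0"
        unfolding bdry_def g(1) vp using False g(2) by (intro sum.neutral) auto
      ultimately show ?thesis by simp
    qed
    finally show "vpart (diff D (frag_of g)) w = ?B (vpart (frag_of g)) w" .
  qed (simp_all add: diff_def frag_extend_diff)
  then show ?thesis by (rule ext)
qed

text \<open>When every cycle is a boundary, the coset of any cycle is the set of boundaries itself,
  and the group axioms are checked on this single coset.\<close>

lemma trivial_H_bar:
  assumes "exact_at (points D) (corners D) (circle D) i j"
  shows "trivial_group (H_bar D i j)"
proof -
  define N where "N = diff D ` carrier (CKh_bar D (i - 1) j)"
  define K where "K = kernel (CKh_bar D i j) (CKh_bar D (i + 1) j) (diff D)"
  define G where "G = (CKh_bar D i j)\<lparr>carrier := K\<rparr>"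
  have gens_len: "supp z \<subseteq> gens D i' j \<Longrightarrow> supp z \<subseteq> {(v, l). length v = length (corners D)}" for z i'
    by (auto simp: gens_iff)
  have KN: "x \<in> N" if "x \<in> K" for x
  proof -
    have x: "supp x \<subseteq> gens D i j" "diff D x = 0"
      using that by (simp_all add: K_def kernel_def CKh_bar_def)
    have "vpart x \<in> chains (points D) (length (corners D)) (circle D) i j" using x(1) vpart_chains by blast
    moreover have "bdry (points D) (corners D) (circle D) (vpart x) = 0"
      using vpart_diff[OF gens_len[OF x(1)]] x(2) by simp
    ultimately obtain w where w: "w \<in> chains (points D) (length (corners D)) (circle D) (i - 1) j"
      "bdry (points D) (corners D) (circle D) w = vpart x"
      using assms unfolding exact_at_def bounds_def by blast
    obtain y where y: "vpart y = w" using vpart_surj[OF w(1)] .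
    then have k: "supp y \<subseteq> gens D (i - 1) j" using w(1) vpart_chains by blast
    have "vpart (diff D y) = vpart x" using vpart_diff[OF gens_len[OF k]] y w(2) by simp
    then have "diff D y = x" by (rule vpart_inj)
    then show ?thesis using k by (auto simp: N_def CKh_bar_def)
  qed
  have dadd: "diff D (x + y) = diff D x + diff D y" "diff D (x - y) = diff D x - diff D y" for x y
    by (simp_all add: diff_def frag_extend_add frag_extend_diff)
  have N: "x + y \<in> N" "x - y \<in> N" if xy: "x \<in> N" "y \<in> N" for x y
  proof -
    obtain u where "x = diff D u" "u \<in> carrier (CKh_bar D (i - 1) j)"
      using xy(1) unfolding N_def by blast
    moreover obtain v where "y = diff D v" "v \<in> carrier (CKh_bar D (i - 1) j)"
      using xy(2) unfolding N_def by blast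
    ultimately show "x + y \<in> N" "x - y \<in> N"
      using keys_sub_add[of u "gens D (i - 1) j" v] keys_sub_diff[of u "gens D (i - 1) j" v]
      unfolding N_def by (auto simp: CKh_bar_def dadd[symmetric] intro!: imageI)
  qed
  have mult: "x \<otimes>\<^bsub>G\<^esub> y = x + y" for x y by (simp add: G_def CKh_bar_def)
  have cos: "N #>\<^bsub>G\<^esub> a = N" if "a \<in> K" for a
  proof -
    have "x \<in> (\<lambda>h. h + a) ` N" if "x \<in> N" for x
      using N(2)[OF that KN[OF \<open>a \<in> K\<close>]] by (intro image_eqI[of _ _ "x - a"]) auto
    then have "(\<lambda>h. h + a) ` N = N" using N(1) KN[OF \<open>a \<in> K\<close>] by auto
    then show ?thesis by (auto simp: r_coset_def mult)
  qed
  have "0 \<in> K" by (simp add: K_def kernel_def CKh_bar_def diff_def)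
  then have "0 \<in> N" by (rule KN)
  have "rcosets\<^bsub>G\<^esub> N = {N}"
    using cos \<open>0 \<in> K\<close> by (auto simp: RCOSETS_def G_def)
  then have car: "carrier (G Mod N) = {N}" by (simp add: FactGroup_def)
  have NN: "N <#>\<^bsub>G\<^esub> N = N"
  proof -
    have "x \<in> (\<Union>h\<in>N. \<Union>k\<in>N. {h + k})" if "x \<in> N" for x
      using that \<open>0 \<in> N\<close> by (intro UN_I[of x] UN_I[of 0]) auto
    then show ?thesis unfolding set_mult_def mult using N(1) by auto
  qed
  have mN: "N \<otimes>\<^bsub>G Mod N\<^esub> N = N" "\<one>\<^bsub>G Mod N\<^esub> = N" by (simp_all add: FactGroup_def NN)
  have "group (G Mod N)"
    using mN by (intro groupI) (simp_all add: car)
  then have "trivial_group (G Mod N)" unfolding trivial_group_def using car mN(2) by simp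
  then show ?thesis by (simp add: H_bar_def G_def K_def N_def)
qed

section \<open>Local structure of a smoothing\<close>

definition cl :: "('p \<times> 'p) set \<Rightarrow> 'p \<Rightarrow> 'p set" where
  "cl E p = {x. (p, x) \<in> (E \<union> E\<inverse>)\<^sup>*}"

lemma circle_eq_cl: "circle D v = cl (smoothing D v)"
  by (auto simp: circle_def cl_def fun_eq_iff)

lemma cl_refl: "p \<in> cl E p"
  by (simp add: cl_def)

lemma cl_sym: "q \<in> cl E p \<Longrightarrow> p \<in> cl E q"
proof -
  have "sym ((E \<union> E\<inverse>)\<^sup>*)" by (intro sym_rtrancl) (auto simp: sym_def)
  then show "q \<in> cl E p \<Longrightarrow> p \<in> cl E q" by (auto simp: cl_def sym_def)
qed

lemma cl_trans: "q \<in> cl E p \<Longrightarrow> r \<in> cl E q \<Longrightarrow> r \<in> cl E p"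
  by (auto simp: cl_def)

lemma cl_eq: "q \<in> cl E p \<Longrightarrow> cl E q = cl E p"
  by (meson cl_sym cl_trans subsetI subset_antisym)

lemma cl_arc: "(p, q) \<in> E \<Longrightarrow> q \<in> cl E p"
  by (auto simp: cl_def)

lemma cl_mono: "E \<subseteq> E' \<Longrightarrow> cl E p \<subseteq> cl E' p"
  unfolding cl_def using rtrancl_mono[of "E \<union> E\<inverse>" "E' \<union> E'\<inverse>"] by blast

lemma is_part_cl: "is_part P (cl E)"
  unfolding is_part_def using cl_refl cl_eq by fast

lemma cl_closed:
  assumes "p \<in> T" "\<And>x y. (x, y) \<in> E \<Longrightarrow> x \<in> T \<longleftrightarrow> y \<in> T"
  shows "cl E p \<subseteq> T"
proof
  fix x assume "x \<in> cl E p"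
  then have "(p, x) \<in> (E \<union> E\<inverse>)\<^sup>*" by (simp add: cl_def)
  then show "x \<in> T" by (induction rule: rtrancl_induct) (use assms in auto)
qed

lemma cl_two_arcs:
  assumes "E = E0 \<union> {(a, b), (c, d)}"
  defines "U \<equiv> cl E0 a \<union> cl E0 b \<union> cl E0 c \<union> cl E0 d"
  shows "cl E a \<union> cl E c = U" "p \<in> U \<Longrightarrow> cl E p = cl E a \<or> cl E p = cl E c" "p \<notin> U \<Longrightarrow> cl E p = cl E0 p"
proof -
  have ab: "b \<in> cl E a" "d \<in> cl E c" using assms(1) by (auto intro: cl_arc)
  have E0: "cl E0 x \<subseteq> cl E x" for x using assms(1) by (intro cl_mono) auto
  have Usub: "U \<subseteq> cl E a \<union> cl E c" using E0 cl_eq[OF ab(1)] cl_eq[OF ab(2)] unfolding U_def by blast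
  have in_U: "a \<in> U" "b \<in> U" "c \<in> U" "d \<in> U"
    using cl_refl[of a E0] cl_refl[of b E0] cl_refl[of c E0] cl_refl[of d E0] unfolding U_def by blast+
  have Umem: "x \<in> U \<longleftrightarrow> a \<in> cl E0 x \<or> b \<in> cl E0 x \<or> c \<in> cl E0 x \<or> d \<in> cl E0 x" for x
    unfolding U_def using cl_sym[of x E0] cl_sym[of _ E0 x] by blast
  have arcU: "x \<in> U \<longleftrightarrow> y \<in> U" if "(x, y) \<in> E" for x y
  proof (cases "(x, y) \<in> E0")
    case True
    then have "cl E0 y = cl E0 x" by (intro cl_eq cl_arc)
    then show ?thesis unfolding Umem by simp
  next
    case False
    then show ?thesis using that assms(1) in_U by auto
  qed
  have "cl E a \<subseteq> U" by (rule cl_closed[OF in_U(1) arcU])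
  moreover have "cl E c \<subseteq> U" by (rule cl_closed[OF in_U(3) arcU])
  ultimately show eq: "cl E a \<union> cl E c = U" using Usub by blast
  show "p \<in> U \<Longrightarrow> cl E p = cl E a \<or> cl E p = cl E c" using eq cl_eq[of p E a] cl_eq[of p E c] by blast
  show "cl E p = cl E0 p" if "p \<notin> U"
  proof
    have "x \<in> cl E0 p \<longleftrightarrow> y \<in> cl E0 p" if "(x, y) \<in> E" for x y
    proof (cases "(x, y) \<in> E0")
      case True
      then show ?thesis using cl_arc[OF True] cl_sym[OF cl_arc[OF True]] cl_trans[of x E0 p y] cl_trans[of y E0 p x] by blast
    next
      case False
      then have "x \<in> U" "y \<in> U" using that assms(1) in_U by auto
      moreover have "z \<notin> cl E0 p" if "z \<in> U" for z
        using that \<open>p \<notin> U\<close> cl_eq[of z E0 p] unfolding Umem by auto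
      ultimately show ?thesis by blast
    qed
    then show "cl E p \<subseteq> cl E0 p" by (rule cl_closed[OF cl_refl])
  qed (rule E0)
qed

text \<open>The components through the four ends of a crossing have the same union in both
  smoothings, and in each smoothing they form at most two blocks. The hypothesis \<open>one\<close>
  says that the number of blocks differs, so one smoothing is a merge of the other.\<close>

lemma linked_cl:
  assumes E: "E = E0 \<union> {(a, b), (c, d)}" and E': "E' = E0 \<union> {(a, d), (b, c)}"
    and one: "(cl E a = cl E c) \<noteq> (cl E' a = cl E' c)" and P: "finite P" "a \<in> P" "c \<in> P"
  shows "linked P (cl E) (cl E') a c"
proof -
  let ?U = "cl E0 a \<union> cl E0 b \<union> cl E0 c \<union> cl E0 d"
  have E'': "E' \<union> E'\<inverse> = (E0 \<union> {(a, d), (c, b)}) \<union> (E0 \<union> {(a, d), (c, b)})\<inverse>" using E' by auto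
  have clE': "cl E' = cl (E0 \<union> {(a, d), (c, b)})" unfolding cl_def E'' ..
  have U': "cl E0 a \<union> cl E0 d \<union> cl E0 c \<union> cl E0 b = ?U" by blast
  note 1 = cl_two_arcs[OF E] and 2 = cl_two_arcs[of "E0 \<union> {(a, d), (c, b)}" E0 a d c b, OF refl, folded clE', unfolded U']
  have m: "merges P (cl F) (cl F') a c"
    if "cl F a \<noteq> cl F c" "cl F' a = cl F' c" "cl F a \<union> cl F c = ?U" "cl F' a \<union> cl F' c = ?U"
      "\<And>p. p \<in> ?U \<Longrightarrow> cl F' p = cl F' a \<or> cl F' p = cl F' c" "\<And>p. p \<notin> ?U \<Longrightarrow> cl F p = cl F' p" for F F'
    unfolding merges_def
  proof (intro conjI ballI)
    fix p
    show "cl F' p = (if p \<in> cl F a \<union> cl F c then cl F a \<union> cl F c else cl F p)"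
    proof (cases "p \<in> ?U")
      case True
      then have "cl F' p = cl F' c" using that(5)[OF True] that(2) by argo
      also have "\<dots> = ?U" using that(2,4) by simp
      finally show ?thesis using True that(3) by (simp only: if_True)
    next
      case False
      then show ?thesis using that(6)[OF False] that(3) by (simp only: if_False)
    qed
  qed (rule that(1))
  have "merges P (cl E) (cl E') a c \<or> merges P (cl E') (cl E) a c"
  proof (cases "cl E a = cl E c")
    case True
    then have "merges P (cl E') (cl E) a c" using one 1 2 by (intro m) auto
    then show ?thesis ..
  next
    case False
    then have "merges P (cl E) (cl E') a c" using one 1 2 by (intro m) auto
    then show ?thesis ..
  qed
  then show ?thesis using P is_part_cl unfolding linked_def by blast
qed

section \<open>Orbits and transpositions\<close>

text \<open>Forward powers only: for an injective map a finite forward orbit is already a full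
  cycle.\<close>

definition orb :: "('p \<Rightarrow> 'p) \<Rightarrow> 'p \<Rightarrow> 'p set" where
  "orb \<sigma> x = {(\<sigma> ^^ m) x | m. True}"

lemma orb_period:
  assumes "inj \<sigma>" "finite (orb \<sigma> x)"
  obtains m where "m > 0" "(\<sigma> ^^ m) x = x"
proof -
  have "\<not> inj (\<lambda>m. (\<sigma> ^^ m) x)"
  proof
    assume "inj (\<lambda>m. (\<sigma> ^^ m) x)"
    moreover have "range (\<lambda>m. (\<sigma> ^^ m) x) = orb \<sigma> x" by (auto simp: orb_def)
    ultimately show False using assms(2) finite_imageD by (metis infinite_UNIV_nat)
  qed
  then obtain i j where ij: "(\<sigma> ^^ i) x = (\<sigma> ^^ j) x" "i < j" by (metis injI linorder_neqE_nat)
  then have "(\<sigma> ^^ i) ((\<sigma> ^^ (j - i)) x) = (\<sigma> ^^ i) x"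
    by (metis add_diff_inverse_nat comp_apply funpow_add less_imp_not_less)
  then have "(\<sigma> ^^ (j - i)) x = x" using inj_fn[OF assms(1)] by (metis injD)
  then show thesis using that ij(2) by (metis zero_less_diff)
qed

lemma orb_sym:
  assumes "inj \<sigma>" "finite (orb \<sigma> x)" "y \<in> orb \<sigma> x" shows "x \<in> orb \<sigma> y"
proof -
  obtain m where m: "m > 0" "(\<sigma> ^^ m) x = x" using orb_period[OF assms(1,2)] .
  have p: "(\<sigma> ^^ (m * k)) x = x" for k
    by (induction k) (auto simp: funpow_add m(2))
  obtain i where i: "y = (\<sigma> ^^ i) x" using assms(3) by (auto simp: orb_def)
  have "(\<sigma> ^^ (m * i - i)) y = (\<sigma> ^^ (m * i - i + i)) x" unfolding i by (simp add: funpow_add)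
  also have "m * i - i + i = m * i" using m(1) by (cases m) auto
  finally show ?thesis using p by (auto simp: orb_def intro: exI[of _ "m * i - i"])
qed

text \<open>Multiplying a permutation by a transposition joins the cycles of the two points if they
  are distinct and cuts their common cycle in two otherwise.\<close>

lemma orb_transpose:
  assumes \<sigma>: "inj \<sigma>" "finite (orb \<sigma> s)" "finite (orb \<sigma> t)" and st: "s \<noteq> t"
    and \<sigma>': "\<sigma>' = \<sigma>(s := \<sigma> t, t := \<sigma> s)" "inj \<sigma>'" "finite (orb \<sigma>' s)" "finite (orb \<sigma>' t)"
  shows "(t \<in> orb \<sigma> s) \<noteq> (t \<in> orb \<sigma>' s)"
proof (cases "t \<in> orb \<sigma> s")
  case False
  define m where "m = (LEAST m. m > 0 \<and> (\<sigma> ^^ m) t = t)"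
  have "\<exists>m. m > 0 \<and> (\<sigma> ^^ m) t = t" using orb_period[OF \<sigma>(1,3)] by blast
  then have m: "m > 0" "(\<sigma> ^^ m) t = t" unfolding m_def by (metis (mono_tags, lifting) LeastI_ex)+
  have min: "(\<sigma> ^^ i) t \<noteq> t" if "0 < i" "i < m" for i using not_less_Least[of i] that unfolding m_def by blast
  have ns: "(\<sigma> ^^ i) t \<noteq> s" for i using False orb_sym[OF \<sigma>(1,3)] by (auto simp: orb_def)
  \<comment> \<open>From \<open>s\<close> the new map follows the old cycle of \<open>t\<close>,
    which avoids \<open>s\<close>, until it arrives at \<open>t\<close>.\<close>
  have "(\<sigma>' ^^ Suc i) s = (\<sigma> ^^ Suc i) t" if "i < m" for i
    using that
  proof (induction i)
    case 0
    then show ?case using \<sigma>'(1) st by simp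
  next
    case (Suc i)
    then have "(\<sigma>' ^^ Suc (Suc i)) s = \<sigma>' ((\<sigma> ^^ Suc i) t)" by simp
    also have "\<dots> = \<sigma> ((\<sigma> ^^ Suc i) t)" unfolding \<sigma>'(1) using min[of "Suc i"] ns[of "Suc i"] Suc.prems by simp
    finally show ?case by simp
  qed
  from this[of "m - 1"] have "(\<sigma>' ^^ m) s = t" using m by simp
  then have "t \<in> orb \<sigma>' s" by (auto simp: orb_def)
  then show ?thesis using False by simp
next
  case True
  define m where "m = (LEAST m. (\<sigma> ^^ m) s = t)"
  have "\<exists>m. (\<sigma> ^^ m) s = t" using True by (auto simp: orb_def)
  then have m: "(\<sigma> ^^ m) s = t" unfolding m_def by (rule LeastI_ex)
  then have m0: "m > 0" using st by (cases m) auto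
  have min: "(\<sigma> ^^ i) s \<noteq> t" if "i < m" for i using not_less_Least[of i] that unfolding m_def by blast
  have ns: "(\<sigma> ^^ i) s \<noteq> s" if "0 < i" "i < m" for i
  proof
    assume "(\<sigma> ^^ i) s = s"
    moreover have "(\<sigma> ^^ m) s = (\<sigma> ^^ (m - i)) ((\<sigma> ^^ i) s)"
      using that by (metis comp_apply funpow_add le_add_diff_inverse2 less_imp_le)
    ultimately show False using m min[of "m - i"] that by simp
  qed
  \<comment> \<open>From \<open>t\<close> the new map follows the old arc from \<open>s\<close> to
    \<open>t\<close> and closes up there, without passing through \<open>s\<close>.\<close>
  have step: "(\<sigma>' ^^ Suc i) t = (\<sigma> ^^ Suc i) s" if "i < m" for i
    using that
  proof (induction i)
    case 0
    then show ?case using \<sigma>'(1) st by simp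
  next
    case (Suc i)
    then have "(\<sigma>' ^^ Suc (Suc i)) t = \<sigma>' ((\<sigma> ^^ Suc i) s)" by simp
    also have "\<dots> = \<sigma> ((\<sigma> ^^ Suc i) s)" unfolding \<sigma>'(1) using min[of "Suc i"] ns[of "Suc i"] Suc.prems by simp
    finally show ?case by simp
  qed
  have per: "(\<sigma>' ^^ m) t = t" using step[of "m - 1"] m m0 by simp
  have "s \<notin> orb \<sigma>' t"
  proof
    assume "s \<in> orb \<sigma>' t"
    then obtain i where i: "(\<sigma>' ^^ i) t = s" by (auto simp: orb_def)
    have "(\<sigma>' ^^ (i mod m)) t = s" using i funpow_mod_eq[OF per] by simp
    moreover have "i mod m < m" using m0 by simp
    ultimately show False using step[of "i mod m - 1"] ns[of "i mod m"] st by (cases "i mod m") auto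
  qed
  then have "t \<notin> orb \<sigma>' s" using orb_sym[OF \<sigma>'(2,3)] by blast
  then show ?thesis using True by simp
qed

lemma cl_graph:
  assumes "inj \<sigma>" "finite S" "\<And>x. x \<in> S \<Longrightarrow> \<sigma> x \<in> S" "p \<in> S"
    and E: "\<And>x y. (x, y) \<in> E \<union> E\<inverse> \<longleftrightarrow> x \<in> S \<and> y \<in> S \<and> (\<sigma> x = y \<or> \<sigma> y = x)"
  shows "cl E p = orb \<sigma> p" "finite (orb \<sigma> p)"
proof -
  have S: "(\<sigma> ^^ m) x \<in> S" if "x \<in> S" for x m by (induction m) (use that assms(3) in auto)
  then have sub: "orb \<sigma> x \<subseteq> S" if "x \<in> S" for x using that by (auto simp: orb_def)
  then show fin: "finite (orb \<sigma> p)" using assms(2,4) finite_subset by blast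
  have fin': "finite (orb \<sigma> x)" if "x \<in> S" for x using sub[OF that] assms(2) finite_subset by blast
  have tr: "z \<in> orb \<sigma> x" if yz: "y \<in> orb \<sigma> x" "z \<in> orb \<sigma> y" for x y z
  proof -
    obtain i where "y = (\<sigma> ^^ i) x" using yz(1) by (auto simp: orb_def)
    moreover obtain j where "z = (\<sigma> ^^ j) y" using yz(2) by (auto simp: orb_def)
    ultimately have "z = (\<sigma> ^^ (j + i)) x" by (simp add: funpow_add)
    then show ?thesis by (auto simp: orb_def)
  qed
  have s1: "\<sigma> x \<in> orb \<sigma> x" for x unfolding orb_def by (auto intro: exI[of _ 1])
  have arc: "x \<in> orb \<sigma> p \<longleftrightarrow> y \<in> orb \<sigma> p" if "(x, y) \<in> E" for x y
  proof -
    have xy: "x \<in> S" "y \<in> S" "\<sigma> x = y \<or> \<sigma> y = x" using E[of x y] that by auto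
    then have "y \<in> orb \<sigma> x" "x \<in> orb \<sigma> y" using s1 orb_sym[OF assms(1)] fin' by metis+
    then show ?thesis using tr by blast
  qed
  show "cl E p = orb \<sigma> p"
  proof
    have "p \<in> orb \<sigma> p" unfolding orb_def by (auto intro: exI[of _ 0])
    then show "cl E p \<subseteq> orb \<sigma> p" by (rule cl_closed) (rule arc)
    have "(\<sigma> ^^ m) p \<in> cl E p" for m
    proof (induction m)
      case (Suc m)
      have "((\<sigma> ^^ m) p, (\<sigma> ^^ Suc m) p) \<in> E \<union> E\<inverse>"
        unfolding E using S[OF assms(4), of m] S[OF assms(4), of "Suc m"] by simp
      then show ?case using Suc unfolding cl_def by (simp add: rtrancl.rtrancl_into_rtrancl)
    qed (simp add: cl_refl)
    then show "orb \<sigma> p \<subseteq> cl E p" by (auto simp: orb_def)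
  qed
qed

section \<open>The smoothings of the pretzel diagram\<close>

definition ht :: "nat \<Rightarrow> nat \<Rightarrow> nat" where
  "ht n c = (if c = 2 then n else 3)"

text \<open>The crossing below the points \<open>(c, k, _)\<close> is smoothed horizontally; in the negative column
  this is the 1-smoothing.\<close>

definition hor :: "bool list \<Rightarrow> nat \<Rightarrow> nat \<Rightarrow> bool" where
  "hor v c k \<longleftrightarrow> (v ! (3 * c + k) \<longleftrightarrow> c = 1)"

definition nx :: "nat \<Rightarrow> nat" where
  "nx c = (if c = 2 then 0 else Suc c)"

definition pv :: "nat \<Rightarrow> nat" where
  "pv c = (if c = 0 then 2 else c - 1)"

text \<open>Orienting the left strand of every column down and the right strand up is the checkerboard
  orientation of the diagram; it induces an orientation of every smoothing, whose circles are the
  orbits of the following permutation.\<close>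

definition step :: "nat \<Rightarrow> bool list \<Rightarrow> pretzel_point \<Rightarrow> pretzel_point" where
  "step n v = (\<lambda>(c, k, s). if (c, k, s) \<notin> pretzel_pts n then (c, k, s)
     else if s = Left then
       (if k < ht n c then (if hor v c k then (c, k, Right) else (c, Suc k, Left)) else (pv c, ht n (pv c), Right))
     else if k > 0 then (if hor v c (k - 1) then (c, k, Left) else (c, k - 1, Right)) else (nx c, 0, Left))"

definition unstep :: "nat \<Rightarrow> bool list \<Rightarrow> pretzel_point \<Rightarrow> pretzel_point" where
  "unstep n v = (\<lambda>(c, k, s). if (c, k, s) \<notin> pretzel_pts n then (c, k, s)
     else if s = Right then
       (if k < ht n c then (if hor v c k then (c, k, Left) else (c, Suc k, Right)) else (nx c, ht n (nx c), Left))
     else if k > 0 then (if hor v c (k - 1) then (c, k, Right) else (c, k - 1, Left)) else (pv c, 0, Right))"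

lemma pretzel_pts_iff: "(c, k, s) \<in> pretzel_pts n \<longleftrightarrow> c \<le> 2 \<and> k \<le> ht n c"
  by (auto simp: pretzel_pts_def ht_def)

lemma side_neq [simp]: "s \<noteq> Left \<longleftrightarrow> s = Right" "s \<noteq> Right \<longleftrightarrow> s = Left"
  by (cases s; simp)+

lemma nx_pv: "c \<le> 2 \<Longrightarrow> nx (pv c) = c" "c \<le> 2 \<Longrightarrow> pv (nx c) = c" "c \<le> 2 \<Longrightarrow> nx c \<le> 2" "c \<le> 2 \<Longrightarrow> pv c \<le> 2"
  by (auto simp: nx_def pv_def)

lemma step_pts: "x \<in> pretzel_pts n \<Longrightarrow> step n v x \<in> pretzel_pts n"
  by (cases x) (auto simp: step_def pretzel_pts_iff nx_pv)

lemma unstep_step: "unstep n v (step n v x) = x"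
proof (cases "x \<in> pretzel_pts n")
  case True
  obtain c k s where x: "x = (c, k, s)" by (cases x)
  have ck: "c \<le> 2" "k \<le> ht n c" using True by (simp_all add: x pretzel_pts_iff)
  then have "k < ht n c \<or> k = ht n c" by linarith
  then show ?thesis using ck
    by (cases s) (auto simp: x step_def unstep_def pretzel_pts_iff nx_pv split: if_splits)
next
  case False
  then show ?thesis by (cases x) (auto simp: step_def unstep_def)
qed

lemma inj_step: "inj (step n v)"
  using unstep_step by (metis injI)

lemma index_decode:
  assumes "k < 6 + n" obtains c j where "c \<le> 2" "j < ht n c" "k = 3 * c + j"
proof -
  consider "k < 3" | "3 \<le> k" "k < 6" | "6 \<le> k" by linarith
  then show thesis
  proof cases
    case 1
    then show ?thesis using that[of 0 k] by (simp add: ht_def)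
  next
    case 2
    then show ?thesis using that[of 1 "k - 3"] by (simp add: ht_def)
  next
    case 3
    then show ?thesis using that[of 2 "k - 6"] assms by (simp add: ht_def)
  qed
qed

lemma le2: "c \<le> 2 \<longleftrightarrow> c = 0 \<or> c = 1 \<or> c = (2 :: nat)"
  by auto

lemma index_inj: "c \<le> 2 \<Longrightarrow> c' \<le> 2 \<Longrightarrow> j < ht n c \<Longrightarrow> j' < ht n c' \<Longrightarrow> 3 * c + j = 3 * c' + j' \<Longrightarrow> c = c' \<and> j = j'"
  by (auto simp: le2 ht_def)

lemma index_less: "c \<le> 2 \<Longrightarrow> j < ht n c \<Longrightarrow> 3 * c + j < 6 + n"
  by (auto simp: le2 ht_def)

text \<open>Two strands enter a crossing in the checkerboard orientation, the left one from above
  and the right one from below. Changing the smoothing exchanges their continuations.\<close>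

lemma step_upd:
  assumes "c \<le> 2" "j < ht n c" "length v = 6 + n"
  shows "step n (v[3 * c + j := \<not> v ! (3 * c + j)]) =
    (step n v)((c, j, Left) := step n v (c, Suc j, Right), (c, Suc j, Right) := step n v (c, j, Left))"
proof
  fix x :: pretzel_point
  obtain c' k s where x: "x = (c', k, s)" by (cases x)
  let ?v = "v[3 * c + j := \<not> v ! (3 * c + j)]"
  have h: "hor ?v c1 i = (if c1 = c \<and> i = j then \<not> hor v c1 i else hor v c1 i)" if ci: "c1 \<le> 2" "i < ht n c1" for c1 i
  proof (cases "c1 = c \<and> i = j")
    case True
    have "3 * c + j < length v" using index_less[OF assms(1,2)] assms(3) by simp
    then have "?v ! (3 * c + j) = (\<not> v ! (3 * c + j))" by simp
    then show ?thesis using True by (simp add: hor_def) metis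
  next
    case False
    then have "3 * c1 + i \<noteq> 3 * c + j" using index_inj[OF ci(1) assms(1) ci(2) assms(2)] by blast
    then have "?v ! (3 * c1 + i) = v ! (3 * c1 + i)" by simp
    then show ?thesis unfolding hor_def if_not_P[OF False] by simp
  qed
  have hc: "hor ?v c j = (\<not> hor v c j)" using h[OF assms(1,2)] by simp
  consider "x = (c, j, Left)" | "x = (c, Suc j, Right)" | "x \<noteq> (c, j, Left)" "x \<noteq> (c, Suc j, Right)" by blast
  then show "step n ?v x = ((step n v)((c, j, Left) := step n v (c, Suc j, Right), (c, Suc j, Right) := step n v (c, j, Left))) x"
  proof cases
    case 1
    then show ?thesis using assms(1,2) hc by (simp add: step_def pretzel_pts_iff)
  next
    case 2
    then show ?thesis using assms(1,2) hc by (simp add: step_def pretzel_pts_iff)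
  next
    case 3
    have "step n ?v x = step n v x"
    proof (cases "x \<in> pretzel_pts n")
      case True
      then have ck: "c' \<le> 2" "k \<le> ht n c'" by (simp_all add: x pretzel_pts_iff)
      show ?thesis
      proof (cases s)
        case Left
        then have "\<not> (c' = c \<and> k = j)" using 3(1) x by simp
        then have "k < ht n c' \<Longrightarrow> hor ?v c' k = hor v c' k" using h[OF ck(1), of k] by auto
        then show ?thesis by (simp add: x Left step_def)
      next
        case Right
        show ?thesis
        proof (cases k)
          case (Suc i)
          then have "\<not> (c' = c \<and> i = j)" using 3(2) x Right by simp
          then have "hor ?v c' i = hor v c' i" using h[OF ck(1), of i] ck Suc by auto
          then show ?thesis by (simp add: x Right step_def Suc)
        qed (simp add: x Right step_def)
      qed
    qed (simp add: x step_def)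
    then show ?thesis using 3 by simp
  qed
qed

locale pretzel_knot =
  fixes q :: int
  assumes q0: "q > 0"
begin

abbreviation "D \<equiv> pretzel 3 (-3) q"
abbreviation "n \<equiv> nat q"
abbreviation "pts \<equiv> pretzel_pts n"
abbreviation "arcs v c j \<equiv> smoothing_arcs (v ! (3 * c + j)) (crossings D ! (3 * c + j))"

lemma crossing_at:
  assumes "c \<le> 2" "j < ht n c"
  shows "crossings D ! (3 * c + j) =
    (if c = 1 then ((c, j, Left), (c, Suc j, Left), (c, Suc j, Right), (c, j, Right))
     else ((c, j, Right), (c, j, Left), (c, Suc j, Left), (c, Suc j, Right)))"
  using nth_crossings_pretzel[of "3 * c + j" q] index_less[OF assms] assms q0
  by (auto simp: le2 ht_def column_crossing_def)

lemma smoothing_sym: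
  assumes "c \<le> 2" "j < ht n c"
  shows "arcs v c j \<union> (arcs v c j)\<inverse> =
    (if hor v c j then {((c, j, Left), (c, j, Right)), ((c, j, Right), (c, j, Left)),
        ((c, Suc j, Left), (c, Suc j, Right)), ((c, Suc j, Right), (c, Suc j, Left))}
     else {((c, j, Left), (c, Suc j, Left)), ((c, Suc j, Left), (c, j, Left)),
        ((c, j, Right), (c, Suc j, Right)), ((c, Suc j, Right), (c, j, Right))})"
  unfolding crossing_at[OF assms] hor_def by (cases "v ! (3 * c + j)") auto

lemma smoothing_eq: "smoothing D v = set (joins D) \<union>
    (\<Union>c\<in>{..2}. \<Union>j\<in>{..<ht n c}. arcs v c j)"
proof -
  have "(\<Union>k<6 + n. smoothing_arcs (v ! k) (crossings D ! k)) =
    (\<Union>c\<in>{..2}. \<Union>j\<in>{..<ht n c}. arcs v c j)" (is "?L = ?R")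
  proof (intro equalityI subsetI)
    fix x assume "x \<in> ?L"
    then obtain k where k: "k < 6 + n" "x \<in> smoothing_arcs (v ! k) (crossings D ! k)" by blast
    obtain c j where "c \<le> 2" "j < ht n c" "k = 3 * c + j" using index_decode[OF k(1)] .
    then show "x \<in> ?R" using k(2) by auto
  next
    fix x assume "x \<in> ?R"
    then show "x \<in> ?L" using index_less by blast
  qed
  then show ?thesis using length_crossings_pretzel[OF q0] by (simp add: smoothing_def)
qed

lemma smoothing_graph:
  "(x, y) \<in> smoothing D v \<union> (smoothing D v)\<inverse> \<longleftrightarrow> x \<in> pts \<and> y \<in> pts \<and> (step n v x = y \<or> step n v y = x)"
proof
  have J: "x \<in> pts \<and> y \<in> pts \<and> (step n v x = y \<or> step n v y = x)" if "(x, y) \<in> set (joins D)" for x y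
    using that q0 by (auto simp: joins_pretzel step_def pretzel_pts_iff ht_def nx_def pv_def)
  have A: "x \<in> pts \<and> y \<in> pts \<and> (step n v x = y \<or> step n v y = x)"
    if "c \<le> 2" "j < ht n c" "(x, y) \<in> arcs v c j" for c j x y
  proof -
    have "(x, y) \<in> arcs v c j \<union> (arcs v c j)\<inverse>"
      using that(3) by blast
    then show ?thesis unfolding smoothing_sym[OF that(1,2)] using that(1,2)
      by (auto simp: step_def pretzel_pts_iff split: if_splits)
  qed
  assume "(x, y) \<in> smoothing D v \<union> (smoothing D v)\<inverse>"
  then have "(x, y) \<in> smoothing D v \<or> (y, x) \<in> smoothing D v" by auto
  then show "x \<in> pts \<and> y \<in> pts \<and> (step n v x = y \<or> step n v y = x)"
    unfolding smoothing_eq using J[of x y] J[of y x] A[of _ _ x y] A[of _ _ y x] by auto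
next
  have B: "(x, step n v x) \<in> smoothing D v \<union> (smoothing D v)\<inverse>" if "x \<in> pts" for x
  proof -
    obtain c k s where x: "x = (c, k, s)" by (cases x)
    have ck: "c \<le> 2" "k \<le> ht n c" using that by (simp_all add: x pretzel_pts_iff)
    have S: "r \<in> smoothing D v \<union> (smoothing D v)\<inverse>"
      if "j < ht n c" "r \<in> arcs v c j \<union> (arcs v c j)\<inverse>" for r j
      using that ck(1) unfolding smoothing_eq by fast
    have T: "r \<in> smoothing D v \<union> (smoothing D v)\<inverse>" if "r \<in> set (joins D) \<union> (set (joins D))\<inverse>" for r
      using that unfolding smoothing_eq by fast
    show ?thesis
    proof (cases s)
      case Left
      show ?thesis
      proof (cases "k < ht n c")
        case True
        show ?thesis by (rule S[OF True]) (use True ck in \<open>simp add: smoothing_sym[OF ck(1) True] x Left step_def pretzel_pts_iff\<close>)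
      next
        case False
        then have "k = ht n c" using ck by simp
        then show ?thesis using ck q0
          by (intro T) (auto simp: le2 x Left step_def pretzel_pts_iff joins_pretzel ht_def pv_def)
      qed
    next
      case Right
      show ?thesis
      proof (cases "k > 0")
        case True
        then obtain i where k: "k = Suc i" by (cases k) auto
        then have i: "i < ht n c" using ck by simp
        show ?thesis by (rule S[OF i]) (use ck k in \<open>simp add: smoothing_sym[OF ck(1) i] x Right step_def pretzel_pts_iff\<close>)
      next
        case False
        then show ?thesis using ck q0
          by (intro T) (auto simp: le2 x Right step_def pretzel_pts_iff joins_pretzel ht_def nx_def)
      qed
    qed
  qed
  assume "x \<in> pts \<and> y \<in> pts \<and> (step n v x = y \<or> step n v y = x)"
  then show "(x, y) \<in> smoothing D v \<union> (smoothing D v)\<inverse>" using B[of x] B[of y] by auto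
qed

lemma points_D: "points D = pts"
proof
  have "p \<in> pts" if p: "p \<in> points D" for p
  proof -
    obtain s where s: "s \<in> strands D" "p = fst (ends D s) \<or> p = snd (ends D s)"
      using p unfolding points_def by auto
    then have "p = tail D (pretzel_ori n) s \<or> p = head D (pretzel_ori n) s" by (auto simp: tail_def head_def)
    then show ?thesis using pretzel_ori_ends[OF q0 s(1)] by auto
  qed
  then show "points D \<subseteq> pts" by blast
next
  have "{(c, j, Left), (c, Suc j, Left), (c, Suc j, Right), (c, j, Right)} \<subseteq> points D" if c: "c \<le> 2" "j < ht n c" for c j
  proof -
    have "3 * c + j < length (crossings D)" using index_less[OF c] length_crossings_pretzel[OF q0] by simp
    then have "Under (3 * c + j) \<in> strands D" "Over (3 * c + j) \<in> strands D" by (auto simp: strands_def)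
    then have "\<forall>p\<in>{fst (ends D (Under (3 * c + j))), snd (ends D (Under (3 * c + j))),
       fst (ends D (Over (3 * c + j))), snd (ends D (Over (3 * c + j)))}. p \<in> points D"
      unfolding points_def by blast
    then show ?thesis by (auto simp: crossing_at[OF c] split: if_splits)
  qed
  note A = this
  have "(c, k, s) \<in> points D" if "c \<le> 2" "k \<le> ht n c" for c k s
  proof (cases "k < ht n c")
    case True
    then show ?thesis using A[OF that(1) True] by (cases s) auto
  next
    case False
    then have "k = Suc (k - 1)" "k - 1 < ht n c" using that q0 by (auto simp: ht_def split: if_splits)
    then show ?thesis using A[OF that(1), of "k - 1"] by (cases s) auto
  qed
  then show "pts \<subseteq> points D" using pretzel_pts_iff by auto
qed

lemma circle_orb:
  assumes "p \<in> pts" shows "circle D v p = orb (step n v) p" "finite (orb (step n v) p)"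
  using cl_graph[OF inj_step finite_pretzel_pts step_pts assms smoothing_graph] by (simp_all add: circle_eq_cl)

lemma corners_at:
  assumes "c \<le> 2" "j < ht n c"
  shows "corners D ! (3 * c + j) =
    (if c = 1 then ((c, j, Left), (c, Suc j, Right)) else ((c, j, Right), (c, Suc j, Left)))"
  using index_less[OF assms] length_crossings_pretzel[OF q0] by (simp add: corners_def crossing_at[OF assms])

lemma length_corners: "length (corners D) = 6 + n"
  using length_crossings_pretzel[OF q0] by (simp add: corners_def)

text \<open>An edge multiplies the permutation \<open>step\<close> by a transposition, so exactly
  one of its two smoothings has both entering points on one circle; this is the parity condition of
  \<open>linked_cl\<close>.\<close>

lemma good_pretzel: "good_cube (points D) (corners D) (circle D)"
  unfolding good_cube_def points_D length_corners
proof (intro conjI allI impI)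
  show "finite pts" by (rule finite_pretzel_pts)
  show "is_part pts (circle D v)" for v unfolding circle_eq_cl by (rule is_part_cl)
  fix v :: "bool list" and k assume v: "length v = 6 + n" and k: "k < 6 + n" and vk: "v ! k"
  obtain c j where cj: "c \<le> 2" "j < ht n c" "k = 3 * c + j" using index_decode[OF k] .
  let ?w = "v[k := False]"
  obtain a b c' d where x: "crossings D ! k = (a, b, c', d)" by (metis prod_cases4)
  have pt: "a \<in> pts" "b \<in> pts" "c' \<in> pts" "d \<in> pts"
    using x crossing_at[OF cj(1,2)] cj by (auto simp: pretzel_pts_iff split: if_splits)
  have co: "corners D ! k = (a, c')"
    using x k length_crossings_pretzel[OF q0] by (simp add: corners_def)
  define E0 where "E0 = set (joins D) \<union> (\<Union>m\<in>{..<6 + n} - {k}. smoothing_arcs (v ! m) (crossings D ! m))"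
  have U: "(\<Union>m<6 + n. smoothing_arcs (u ! m) (crossings D ! m)) =
      smoothing_arcs (u ! k) (crossings D ! k) \<union> (\<Union>m\<in>{..<6 + n} - {k}. smoothing_arcs (u ! m) (crossings D ! m))" for u
    using k by blast
  have E: "smoothing D ?w = E0 \<union> {(a, b), (c', d)}"
    unfolding smoothing_def length_crossings_pretzel[OF q0] U E0_def using v k by (auto simp: x)
  have E': "smoothing D v = E0 \<union> {(a, d), (b, c')}"
    unfolding smoothing_def length_crossings_pretzel[OF q0] U E0_def using v k vk by (auto simp: x)
  let ?s = "(c, j, Left) :: pretzel_point" and ?t = "(c, Suc j, Right) :: pretzel_point"
  have st: "?s \<in> pts" "?t \<in> pts" "?s \<noteq> ?t" using cj by (auto simp: pretzel_pts_iff)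
  have "v[k := True] = v" using vk list_update_id[of v k] by simp
  then have "v = ?w[k := \<not> ?w ! k]" using v k by simp
  then have sv: "step n v = (step n ?w)(?s := step n ?w ?t, ?t := step n ?w ?s)"
    using step_upd[OF cj(1,2), of ?w] v cj(3) by simp
  have "(?t \<in> orb (step n ?w) ?s) \<noteq> (?t \<in> orb (step n v) ?s)"
    using orb_transpose[OF inj_step circle_orb(2)[OF st(1)] circle_orb(2)[OF st(2)] st(3) sv inj_step
        circle_orb(2)[OF st(1)] circle_orb(2)[OF st(2)]] .
  then have o: "(?t \<in> cl (smoothing D ?w) ?s) \<noteq> (?t \<in> cl (smoothing D v) ?s)"
    using circle_orb(1)[OF st(1)] by (simp add: circle_eq_cl)
  have m: "y \<in> cl X z \<longleftrightarrow> cl X z = cl X y" for y z and X :: "(pretzel_point \<times> pretzel_point) set"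
    using cl_eq cl_refl by metis
  have one: "(cl (smoothing D ?w) a = cl (smoothing D ?w) c') \<noteq> (cl (smoothing D v) a = cl (smoothing D v) c')"
  proof (cases "c = 1")
    case True
    then have "a = ?s" "c' = ?t" using x crossing_at[OF cj(1,2)] cj(3) by simp_all
    then show ?thesis using o unfolding m by simp
  next
    case False
    \<comment> \<open>In the positive columns the entering points are the ends of the overstrand,
      not the corners \<open>a\<close> and \<open>c'\<close>; in either smoothing each of them
      shares an arc with one of the corners.\<close>
    then have "b = ?s" "d = ?t" using x crossing_at[OF cj(1,2)] cj(3) by simp_all
    moreover have "cl (smoothing D ?w) a = cl (smoothing D ?w) b" "cl (smoothing D ?w) c' = cl (smoothing D ?w) d"
      using cl_arc[of _ _ "smoothing D ?w"] unfolding m[symmetric] E by auto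
    moreover have "cl (smoothing D v) a = cl (smoothing D v) d" "cl (smoothing D v) b = cl (smoothing D v) c'"
      using cl_arc[of _ _ "smoothing D v"] unfolding m[symmetric] E' by auto
    ultimately show ?thesis using o unfolding m by auto
  qed
  show "linked pts (circle D ?w) (circle D v) (fst (corners D ! k)) (snd (corners D ! k))"
    unfolding circle_eq_cl co fst_conv snd_conv
    by (rule linked_cl[OF E E' one finite_pretzel_pts pt(1,3)])
qed

end

section \<open>Circles that occur in the smoothings of the pretzel diagram\<close>

context pretzel_knot
begin

abbreviation "circ \<equiv> circle D"
abbreviation "cs \<equiv> corners D"

lemma circ_refl: "p \<in> circ v p"
  by (simp add: circle_eq_cl cl_refl)

lemma circ_step: "p \<in> pts \<Longrightarrow> circ v (step n v p) = circ v p"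
proof -
  assume p: "p \<in> pts"
  then have "step n v p \<in> circ v p" unfolding circle_orb(1)[OF p] orb_def by (auto intro: exI[of _ 1])
  then show ?thesis unfolding circle_eq_cl by (rule cl_eq)
qed

lemma circ_vert: "c \<le> 2 \<Longrightarrow> j < ht n c \<Longrightarrow> \<not> hor v c j \<Longrightarrow> circ v (c, Suc j, s) = circ v (c, j, s)"
  using circ_step[of "(c, j, Left)" v] circ_step[of "(c, Suc j, Right)" v]
  by (cases s) (simp_all add: step_def pretzel_pts_iff)

lemma circ_hor: "c \<le> 2 \<Longrightarrow> j < ht n c \<Longrightarrow> hor v c j \<Longrightarrow> circ v (c, j, s) = circ v (c, j, s')"
  "c \<le> 2 \<Longrightarrow> j < ht n c \<Longrightarrow> hor v c j \<Longrightarrow> circ v (c, Suc j, s) = circ v (c, Suc j, s')"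
  using circ_step[of "(c, j, Left)" v] circ_step[of "(c, Suc j, Right)" v]
  by (cases s; cases s'; simp add: step_def pretzel_pts_iff)+

lemma circ_top: "c \<le> 2 \<Longrightarrow> circ v (c, 0, Right) = circ v (nx c, 0, Left)"
  using circ_step[of "(c, 0, Right)" v] by (simp add: step_def pretzel_pts_iff)

lemma circ_bot: "c \<le> 2 \<Longrightarrow> circ v (nx c, ht n (nx c), Left) = circ v (c, ht n c, Right)"
  using circ_step[of "(nx c, ht n (nx c), Left)" v] by (simp add: step_def pretzel_pts_iff nx_pv)

lemma circ_run:
  assumes "i \<le> j" "c \<le> 2" "j \<le> ht n c" "\<And>k. i \<le> k \<Longrightarrow> k < j \<Longrightarrow> \<not> hor v c k"
  shows "circ v (c, j, s) = circ v (c, i, s)"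
  using assms
proof (induction j rule: dec_induct)
  case (step j)
  then show ?case using circ_vert[of c j v s] by simp
qed simp

lemma circ_eqI:
  assumes "p \<in> T" "T \<subseteq> pts" "\<And>x. x \<in> T \<Longrightarrow> step n v x \<in> T" "\<And>x. x \<in> T \<Longrightarrow> circ v x = circ v p"
  shows "circ v p = T"
proof
  have "(step n v ^^ m) p \<in> T" for m by (induction m) (use assms(1,3) in auto)
  moreover have "p \<in> pts" using assms(1,2) by blast
  ultimately show "circ v p \<subseteq> T" unfolding circle_orb(1)[OF \<open>p \<in> pts\<close>] orb_def by blast
  show "T \<subseteq> circ v p" using assms(4) circ_refl by blast
qed

lemma circ_eqI':
  assumes "p \<in> T" "T \<subseteq> pts" "\<And>x. x \<in> T \<Longrightarrow> step n v x \<in> T" "\<And>x. x \<in> T \<Longrightarrow> circ v x = circ v b"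
  shows "circ v p = T"
  by (rule circ_eqI[OF assms(1-3)]) (use assms(1,4) in simp_all)

text \<open>The circle enclosed by the horizontally smoothed crossings \<open>i\<close> and
  \<open>j\<close> of a column when those between them are vertical.\<close>

definition bead :: "nat \<Rightarrow> nat \<Rightarrow> nat \<Rightarrow> pretzel_point set" where
  "bead c i j = {(c', k, s). c' = c \<and> i < k \<and> k \<le> j}"

text \<open>The circle between a column and the next one, cyclically, when both are entirely
  vertical.\<close>

definition gap :: "nat \<Rightarrow> pretzel_point set" where
  "gap c = {(c', k, s). c' = c \<and> k \<le> ht n c \<and> s = Right \<or> c' = nx c \<and> k \<le> ht n (nx c) \<and> s = Left}"

text \<open>The circle at the bottom of the diagram, bounded above by the lowest horizontal crossing
  of each column: \<open>r\<close> in the first two, \<open>h\<close> in the third.\<close>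

definition floor_circ :: "nat \<Rightarrow> nat \<Rightarrow> pretzel_point set" where
  "floor_circ r h = {(c, k, s). c \<le> 1 \<and> r < k \<and> k \<le> 3 \<or> c = 2 \<and> h < k \<and> k \<le> n}"

lemma circ_bead:
  assumes "c \<le> 2" "i < j" "j < ht n c" "hor v c i" "hor v c j"
    "\<And>k. i < k \<Longrightarrow> k < j \<Longrightarrow> \<not> hor v c k" "p \<in> bead c i j"
  shows "circ v p = bead c i j"
proof (rule circ_eqI'[OF assms(7), where b = "(c, Suc i, Left)"])
  show "bead c i j \<subseteq> pts" using assms by (auto simp: bead_def pretzel_pts_iff)
next
  fix x assume "x \<in> bead c i j"
  then obtain k s where x: "x = (c, k, s)" "i < k" "k \<le> j" by (auto simp: bead_def)
  have h: "hor v c k \<longleftrightarrow> k = j" "hor v c (k - 1) \<longleftrightarrow> k - 1 = i"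
  proof -
    have "k < j \<or> k = j" using x by linarith
    then show "hor v c k \<longleftrightarrow> k = j" using assms(5) assms(6)[of k] x by blast
    have "i < k - 1 \<and> k - 1 < j \<or> k - 1 = i" using x by linarith
    then show "hor v c (k - 1) \<longleftrightarrow> k - 1 = i" using assms(4) assms(6)[of "k - 1"] by fastforce
  qed
  show "step n v x \<in> bead c i j"
    using x assms(1-3) h by (cases s) (auto simp: step_def pretzel_pts_iff bead_def)
  have "circ v (c, k, s) = circ v (c, Suc i, s)"
    by (rule circ_run) (use x assms in auto)
  also have "\<dots> = circ v (c, Suc i, Left)" using circ_hor(2)[of c i v] assms by simp
  finally show "circ v x = circ v (c, Suc i, Left)" by (simp add: x)
qed

lemma circ_gap:
  assumes "c \<le> 2" "\<And>k. k < ht n c \<Longrightarrow> \<not> hor v c k" "\<And>k. k < ht n (nx c) \<Longrightarrow> \<not> hor v (nx c) k" "p \<in> gap c"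
  shows "circ v p = gap c"
proof (rule circ_eqI'[OF assms(4), where b = "(c, 0, Right)"])
  show "gap c \<subseteq> pts" using assms(1) by (auto simp: gap_def pretzel_pts_iff nx_pv)
next
  fix x assume "x \<in> gap c"
  then consider k where "x = (c, k, Right)" "k \<le> ht n c" | k where "x = (nx c, k, Left)" "k \<le> ht n (nx c)"
    by (auto simp: gap_def)
  then show "step n v x \<in> gap c"
  proof cases
    case (1 k)
    then show ?thesis using assms(1,2) by (cases k) (auto simp: step_def pretzel_pts_iff gap_def nx_pv)
  next
    case (2 k)
    then show ?thesis using assms(1,3) by (auto simp: step_def pretzel_pts_iff gap_def nx_pv)
  qed
  from \<open>x \<in> gap c\<close> consider k where "x = (c, k, Right)" "k \<le> ht n c" | k where "x = (nx c, k, Left)" "k \<le> ht n (nx c)"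
    by (auto simp: gap_def)
  then show "circ v x = circ v (c, 0, Right)"
  proof cases
    case (1 k)
    then show ?thesis using circ_run[of 0 k c v Right] assms(1,2) by auto
  next
    case (2 k)
    then show ?thesis using circ_run[of 0 k "nx c" v Left] assms(1,3) circ_top[OF assms(1)] nx_pv(3)[OF assms(1)] by auto
  qed
qed

lemma circ_floor:
  assumes "r < 3" "hor v 0 r" "hor v 1 r" "\<And>k. r < k \<Longrightarrow> k < 3 \<Longrightarrow> \<not> hor v 0 k" "\<And>k. r < k \<Longrightarrow> k < 3 \<Longrightarrow> \<not> hor v 1 k"
    "h < n" "hor v 2 h" "\<And>k. h < k \<Longrightarrow> k < n \<Longrightarrow> \<not> hor v 2 k" "p \<in> floor_circ r h"
  shows "circ v p = floor_circ r h"
proof (rule circ_eqI'[OF assms(9), where b = "(0, 3, Left)"])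
  show "floor_circ r h \<subseteq> pts" by (auto simp: floor_circ_def pretzel_pts_iff ht_def)
next
  define b where "b c = (if c = 2 then h else r)" for c :: nat
  have b: "b c < ht n c" "hor v c (b c)" "\<And>k. b c < k \<Longrightarrow> k < ht n c \<Longrightarrow> \<not> hor v c k" if "c \<le> 2" for c
    using that assms(1-8) by (auto simp: le2 b_def ht_def)
  have F: "floor_circ r h = {(c, k, s). c \<le> 2 \<and> b c < k \<and> k \<le> ht n c}"
    by (auto simp: floor_circ_def b_def ht_def split: if_splits)
  fix x assume "x \<in> floor_circ r h"
  then obtain c k s where x: "x = (c, k, s)" "c \<le> 2" "b c < k" "k \<le> ht n c" by (auto simp: F)
  show "step n v x \<in> floor_circ r h"
  proof (cases s)
    case Left
    show ?thesis
    proof (cases "k < ht n c")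
      case True
      then show ?thesis using x b(3)[OF x(2,3)] Left by (simp add: step_def pretzel_pts_iff F)
    next
      case False
      then show ?thesis using x b(1)[of "pv c"] nx_pv(4)[of c] Left by (simp add: step_def pretzel_pts_iff F)
    qed
  next
    case Right
    then obtain i where i: "k = Suc i" using x by (cases k) auto
    then show ?thesis using x b(2)[OF x(2)] b(3)[OF x(2), of i] Right by (cases "i = b c") (auto simp: step_def pretzel_pts_iff F)
  qed
  have col: "circ v (c, k, s) = circ v (c, ht n c, s')" if "c \<le> 2" "b c < k" "k \<le> ht n c" for c k s s'
  proof -
    have "circ v (c, k, s) = circ v (c, Suc (b c), s)" by (rule circ_run) (use that b(3)[OF that(1)] in auto)
    also have "\<dots> = circ v (c, Suc (b c), s')" by (rule circ_hor(2)) (use that b(1,2)[OF that(1)] in auto)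
    also have "\<dots> = circ v (c, ht n c, s')"
      by (rule circ_run[symmetric]) (use that b(1,3)[OF that(1)] in auto)
    finally show ?thesis .
  qed
  have "circ v (c, ht n c, Left) = circ v (0, 3, Left)"
  proof -
    have 1: "circ v (1, ht n 1, Left) = circ v (0, ht n 0, Left)"
      using circ_bot[of 0 v] col[of 0 "ht n 0" Right Left] b(1)[of 0] by (simp add: nx_def)
    have 2: "circ v (2, ht n 2, Left) = circ v (1, ht n 1, Left)"
      using circ_bot[of 1 v] col[of 1 "ht n 1" Right Left] b(1)[of 1] by (simp add: nx_def numeral_2_eq_2)
    have "ht n 0 = 3" by (simp add: ht_def)
    then show ?thesis using 1 2 x(2) by (auto simp: le2)
  qed
  then show "circ v x = circ v (0, 3, Left)" using col[OF x(2-4), of s Left] x(1) by simp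
qed

text \<open>The horizontal crossings connect all the tops and all the bottoms of the columns, and
  the vertical strands of the third column connect the two groups.\<close>

lemma circ_single:
  assumes "i < 3" "hor v 0 i" "\<And>k. k < 3 \<Longrightarrow> k \<noteq> i \<Longrightarrow> \<not> hor v 0 k"
    "j < 3" "hor v 1 j" "\<And>k. k < 3 \<Longrightarrow> k \<noteq> j \<Longrightarrow> \<not> hor v 1 k" "\<And>k. k < n \<Longrightarrow> \<not> hor v 2 k" "p \<in> pts"
  shows "circ v p = circ v (2, 0, Left)"
proof -
  have "circ v (c, k, s) = circ v (c, if k \<le> e then 0 else ht n c, Left)"
    if "c \<le> 2" "k \<le> ht n c" "e < ht n c" "hor v c e" "\<And>k. k < ht n c \<Longrightarrow> k \<noteq> e \<Longrightarrow> \<not> hor v c k" for c k e s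
  proof (cases "k \<le> e")
    case True
    have "circ v (c, k, s) = circ v (c, e, s)" by (rule circ_run[symmetric]) (use True that in auto)
    also have "\<dots> = circ v (c, e, Left)" by (rule circ_hor(1)) (use that in auto)
    also have "\<dots> = circ v (c, 0, Left)" by (rule circ_run) (use True that in auto)
    finally show ?thesis using True by simp
  next
    case False
    have "circ v (c, k, s) = circ v (c, Suc e, s)" by (rule circ_run) (use False that in auto)
    also have "\<dots> = circ v (c, Suc e, Left)" by (rule circ_hor(2)) (use that in auto)
    also have "\<dots> = circ v (c, ht n c, Left)" by (rule circ_run[symmetric]) (use False that in auto)
    finally show ?thesis using False by simp
  qed
  note col = this
  have c0: "circ v (0, k, s) = circ v (0, if k \<le> i then 0 else 3, Left)" if "k \<le> 3" for k s
    using col[of 0 k i s] that assms(1-3) by (simp add: ht_def)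
  have c1: "circ v (1, k, s) = circ v (1, if k \<le> j then 0 else 3, Left)" if "k \<le> 3" for k s
    using col[of 1 k j s] that assms(4-6) by (simp add: ht_def)
  have c2: "circ v (2, k, s) = circ v (2, 0, s)" if "k \<le> n" for k s
    using circ_run[of 0 k 2 v s] that assms(7) by (simp add: ht_def)
  note T = circ_top[of 0 v] circ_top[of 1 v] circ_top[of 2 v] and B = circ_bot[of 0 v] circ_bot[of 1 v] circ_bot[of 2 v]
  have t: "circ v (0, 0, Left) = circ v (1, 0, Left)" using T(1) c0[of 0 Right] by (simp add: nx_def)
  have t': "circ v (1, 0, Left) = circ v (2, 0, Left)" using T(2) c1[of 0 Right] by (simp add: nx_def numeral_2_eq_2)
  have t'': "circ v (2, 0, Right) = circ v (0, 0, Left)" using T(3) by (simp add: nx_def)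
  have b: "circ v (1, 3, Left) = circ v (0, 3, Left)" using B(1) c0[of 3 Right] assms(1) by (simp add: nx_def ht_def)
  have b': "circ v (2, n, Left) = circ v (1, 3, Left)" using B(2) c1[of 3 Right] assms(4) by (simp add: nx_def ht_def numeral_2_eq_2)
  have n2: "circ v (2, n, Left) = circ v (2, 0, Left)" using c2[of n Left] by simp
  have ends: "circ v (0, if k \<le> i then 0 else 3, Left) = circ v (2, 0, Left)"
    "circ v (1, if k \<le> j then 0 else 3, Left) = circ v (2, 0, Left)" for k
    using t t' b b' n2 by simp_all
  have ends3: "circ v (2, 0, s) = circ v (2, 0, Left)" for s
    using t t' t'' by (cases s) simp_all
  obtain c k s where p: "p = (c, k, s)" by (cases p)
  then have "c \<le> 2" "k \<le> ht n c" using assms(8) by (simp_all add: pretzel_pts_iff)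
  then show ?thesis unfolding p using c0[of k s] c1[of k s] c2[of k s] ends[of k] ends3[of s] by (auto simp: le2 ht_def)
qed

end

section \<open>Base cases\<close>

lemma chains_no_crossings:
  assumes "z \<in> chains P 0 F i j" "\<And>l. l \<in> labs P (F []) \<Longrightarrow> i = 0 \<Longrightarrow> ldeg P (F []) l \<noteq> j"
  shows "z = 0"
proof
  fix v :: "bool list"
  have "supp (z v) \<subseteq> (if length v = 0 \<and> int (weight v) = i then labsd P (F v) (j - i) else {})"
    using assms(1) by (simp add: chains_def)
  also have "\<dots> = {}" using assms(2) by (auto simp: labsd_def weight_def)
  finally show "z v = 0 v" by simp
qed

lemma exact_one_circle:
  assumes "P \<noteq> {}" "\<And>p. p \<in> P \<Longrightarrow> F [] p = A" "j - 2 * i \<noteq> 1" "j - 2 * i \<noteq> -1"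
  shows "exact_at P [] F i j"
proof -
  have im: "F [] ` P = {A}" using assms(1,2) by auto
  have "ldeg P (F []) l \<noteq> j" if "i = 0" for l
    using assms(3,4) that by (cases "l A") (auto simp: ldeg_def im)
  then have "z = 0" if "z \<in> chains P 0 F i j" for z using chains_no_crossings[OF that] by blast
  moreover have "bounds P [] F i j 0" unfolding bounds_def by (rule bexI[of _ 0]) simp_all
  ultimately show ?thesis by (auto simp: exact_at_def)
qed

text \<open>The excluded values leave only the degree of 1 tensor 1, which the product of the two X
  sends to X tensor X.\<close>

lemma inj_XX_two_circles:
  assumes "t \<in> P" "p \<in> P" "F [] t \<noteq> F [] p" "F [] ` P = {F [] t, F [] p}" "j - 2 * i \<noteq> 0" "j - 2 * i \<noteq> -2"
  shows "inj_XX P [] F t p i j"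
proof -
  let ?A = "F [] t" and ?B = "F [] p"
  have ld: "ldeg P (F []) l = label_deg (l ?A) + label_deg (l ?B)" for l
    using assms(3) by (simp add: ldeg_def assms(4))
  have b0: "bounds P [] F i j 0" unfolding bounds_def by (rule bexI[of _ 0]) simp_all
  have d: "bdry P [] F w = 0" if "w \<in> chains P 0 F i' j'" for w i' j'
  proof
    fix v show "bdry P [] F w v = 0 v"
      unfolding bdry_def using chains_keys(2)[OF that] by (cases "v = []") (auto intro!: sum.neutral)
  qed
  have "z = 0" if z: "z \<in> chains P 0 F i j" and b: "bounds P [] F i (j - 4) (actX F t (actX F p z))" for z
  proof (cases "i = 0 \<and> j = 2")
    case False
    have "ldeg P (F []) l \<noteq> j" if "i = 0" for l
      using assms(5,6) False that by (cases "l ?A"; cases "l ?B") (auto simp: ld)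
    then show ?thesis using chains_no_crossings[OF z] by blast
  next
    case True
    have "actX F t (actX F p z) = 0" using b d by (auto simp: bounds_def)
    then have "mulX ?A (mulX ?B (z [])) = 0" unfolding actX_def by (metis zero_fun_apply)
    \<comment> \<open>On labellings with 1 on both circles the two derivatives undo the two
      multiplications.\<close>
    moreover have "delX ?B (delX ?A (mulX ?A (mulX ?B (z [])))) = z []"
    proof (rule additive_eq[where z = "z []" and S = "labsd P (F []) 2"
        and G = "\<lambda>y. delX ?B (delX ?A (mulX ?A (mulX ?B y)))" and H = "\<lambda>y. y"])
      show "supp (z []) \<subseteq> labsd P (F []) 2"
        using z[unfolded chains_def, THEN CollectD, rule_format, of "[]"] True by (simp add: weight_def)
      fix l assume "l \<in> labsd P (F []) 2"
      then have "label_deg (l ?A) + label_deg (l ?B) = 2" by (simp add: labsd_def ld)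
      then have "l ?A = L1" "l ?B = L1" by (cases "l ?A"; cases "l ?B"; simp)+
      then show "delX ?B (delX ?A (mulX ?A (mulX ?B (frag_of l)))) = frag_of l"
        using assms(3) by (simp add: mulX_of delX_of fun_upd_idem fun_upd_twist)
    qed auto
    ultimately have "z [] = 0" by simp
    then show ?thesis using chains_keys(2)[OF z] by (metis length_0_conv zero_fun_apply ext)
  qed
  then show ?thesis using b0 by (auto simp: inj_XX_def)
qed

section \<open>Resolving the crossings of the pretzel diagram one at a time\<close>

context pretzel_knot
begin

text \<open>The first \<open>m\<close> crossings are free and the others are smoothed according to \<open>suf\<close>.\<close>

definition fam :: "nat \<Rightarrow> bool list \<Rightarrow> pretzel_point family \<Rightarrow> bool" where
  "fam m suf F \<longleftrightarrow> m + length suf = 6 + n \<and> (\<forall>u. length u = m \<longrightarrow> F u = circ (u @ suf))"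

text \<open>Quantified over all families with the given values on lists of length \<open>m\<close>,
  because the faces of a cube yield families whose values on other lists differ.\<close>

definition exact_res :: "nat \<Rightarrow> bool list \<Rightarrow> int \<Rightarrow> int \<Rightarrow> bool" where
  "exact_res m suf i j \<longleftrightarrow> (\<forall>F. fam m suf F \<longrightarrow> exact_at pts (take m cs) F i j)"

definition inj_res :: "nat \<Rightarrow> bool list \<Rightarrow> pretzel_point \<Rightarrow> pretzel_point \<Rightarrow> int \<Rightarrow> int \<Rightarrow> bool" where
  "inj_res m suf p r i j \<longleftrightarrow> (\<forall>F. fam m suf F \<longrightarrow> inj_XX pts (take m cs) F p r i j)"

lemma exact_res_iff_inj_res: "exact_res m suf i j \<longleftrightarrow> inj_res m suf p p i j"
  by (simp add: exact_res_def inj_res_def exact_at_iff_inj_XX[of _ _ _ _ _ p])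

lemma exact_res_imp_INJ: "exact_res m suf i j \<Longrightarrow> inj_res m suf p r i j"
  unfolding exact_res_def inj_res_def exact_at_def inj_XX_def by blast

lemma inj_res_swap: "inj_res m suf p r i j \<longleftrightarrow> inj_res m suf r p i j"
  by (simp only: inj_res_def inj_XX_def actX_commute[of _ p r])

lemma fam_good:
  assumes "fam m suf F" shows "good_cube pts (take m cs) F"
proof -
  have m: "m + length suf = 6 + n" and F: "\<And>u. length u = m \<Longrightarrow> F u = circ (u @ suf)"
    using assms by (auto simp: fam_def)
  have l: "length (take m cs) = m" using m length_corners by simp
  note G = good_pretzel[unfolded points_D]
  show ?thesis unfolding good_cube_def l
  proof (intro conjI allI impI)
    show "finite pts" by (rule finite_pretzel_pts)
    fix v :: "bool list" assume v: "length v = m"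
    then show "is_part pts (F v)" using F good_cubeD(2)[OF G, of "v @ suf"] m length_corners by simp
    fix k assume k: "k < m" "v ! k"
    show "linked pts (F (v[k := False])) (F v) (fst (take m cs ! k)) (snd (take m cs ! k))"
      using good_cubeD(3)[OF G, of "v @ suf" k] F v k m length_corners by (simp add: nth_append list_update_append)
  qed
qed

lemma fam_face:
  assumes "fam (Suc m) suf F"
  shows "fam m (b # suf) (\<lambda>u. F (ins m b u))" "cone pts (take (Suc m) cs) F m m"
    "del m (take (Suc m) cs) = take m cs" "take (Suc m) cs ! m = cs ! m"
proof -
  have m: "Suc m + length suf = 6 + n" using assms by (simp add: fam_def)
  show "fam m (b # suf) (\<lambda>u. F (ins m b u))" using assms by (auto simp: fam_def ins_def)
  show "cone pts (take (Suc m) cs) F m m"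
    by unfold_locales (use fam_good[OF assms] m length_corners in auto)
  show "del m (take (Suc m) cs) = take m cs" using m length_corners by (simp add: del_def)
  show "take (Suc m) cs ! m = cs ! m" by simp
qed

lemma exact_res_step:
  assumes "inj_res m (False # suf) (fst (cs ! m)) (snd (cs ! m)) i j" "exact_res m (True # suf) (i - 1) (j - 1)"
  shows "exact_res (Suc m) suf i j"
  unfolding exact_res_def
proof (intro allI impI)
  fix F assume F: "fam (Suc m) suf F"
  interpret cone pts "take (Suc m) cs" F m m by (rule fam_face(2)[OF F])
  note S = fam_face(3,4)[OF F]
  show "exact_at pts (take (Suc m) cs) F i j"
    by (rule exact_of_inj_XX; unfold S)
      (use assms[unfolded inj_res_swap[of m _ "fst (cs ! m)"]] fam_face(1)[OF F] in \<open>auto simp: inj_res_def exact_res_def\<close>)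
qed

lemma inj_res_bead:
  assumes 1: "inj_res m (True # suf) p' r i (j + 1)"
    and T: "\<And>u. length u = m \<Longrightarrow> circ (u @ False # suf) (snd (cs ! m)) = T" "fst (cs ! m) \<notin> T"
      "\<And>k. k < m \<Longrightarrow> fst (cs ! k) \<notin> T \<and> snd (cs ! k) \<notin> T"
    and p: "p \<in> pts" "p \<in> T \<and> p' = fst (cs ! m) \<or> p \<notin> T \<and> p' = p" and r: "r \<in> pts" "r \<notin> T"
  shows "inj_res (Suc m) suf p r i j"
  unfolding inj_res_def
proof (intro allI impI)
  fix F assume F: "fam (Suc m) suf F"
  interpret c: cone pts "take (Suc m) cs" F m m by (rule fam_face(2)[OF F])
  note S = fam_face(3,4)[OF F]
  interpret cone_free0 pts "take (Suc m) cs" F m m T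
    by unfold_locales (use T fam_face(1)[OF F, of False] in \<open>auto simp: S fam_def\<close>)
  show "inj_XX pts (take (Suc m) cs) F p r i j"
    by (rule inj_XX_free0[OF _ p(1) _ r, of p']; unfold S)
      (use 1 p(2) fam_face(1)[OF F] in \<open>auto simp: inj_res_def\<close>)
qed

lemma fst_corner: "m < 6 + n \<Longrightarrow> fst (cs ! m) \<in> pts"
proof -
  assume "m < 6 + n"
  then obtain c j where "c \<le> 2" "j < ht n c" "m = 3 * c + j" by (rule index_decode)
  then show ?thesis using corners_at[of c j] by (auto simp: pretzel_pts_iff)
qed

lemma exact_res_bead:
  assumes 1: "exact_res m (True # suf) i (j + 1)" and m: "m < 6 + n"
    and T: "\<And>u. length u = m \<Longrightarrow> circ (u @ False # suf) (snd (cs ! m)) = T" "fst (cs ! m) \<notin> T"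
      "\<And>k. k < m \<Longrightarrow> fst (cs ! k) \<notin> T \<and> snd (cs ! k) \<notin> T"
  shows "exact_res (Suc m) suf i j"
  \<comment> \<open>Exactness is read as \<open>inj_XX\<close> for the first corner taken twice;
    this point lies off the free circle, so the move leaves it unchanged.\<close>
  unfolding exact_res_iff_inj_res[of "Suc m" _ _ _ "fst (cs ! m)"]
  by (rule inj_res_bead[OF _ T, of _ "fst (cs ! m)"]) (use exact_res_iff_inj_res[of m "True # suf" i "j + 1" "fst (cs ! m)"] 1 T(2) fst_corner[OF m] in auto)

lemma exact_res_bead1:
  assumes 0: "exact_res m (False # suf) (i - 1) (j - 2)"
    and T: "\<And>u. length u = m \<Longrightarrow> circ (u @ True # suf) (snd (cs ! m)) = T" "fst (cs ! m) \<notin> T"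
      "\<And>k. k < m \<Longrightarrow> fst (cs ! k) \<notin> T \<and> snd (cs ! k) \<notin> T"
  shows "exact_res (Suc m) suf i j"
  unfolding exact_res_def
proof (intro allI impI)
  fix F assume F: "fam (Suc m) suf F"
  interpret c: cone pts "take (Suc m) cs" F m m by (rule fam_face(2)[OF F])
  note S = fam_face(3,4)[OF F]
  interpret cone_free1 pts "take (Suc m) cs" F m m T
    by unfold_locales (use T fam_face(1)[OF F, of True] in \<open>auto simp: S fam_def\<close>)
  show "exact_at pts (take (Suc m) cs) F i j"
    by (rule exact_free1; unfold S) (use 0 fam_face(1)[OF F] in \<open>auto simp: exact_res_def\<close>)
qed

lemma corner_cases:
  assumes "k < 6 + n"
  obtains c j where "c \<le> 2" "j < ht n c" "k = 3 * c + j"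
    "cs ! k = (if c = 1 then ((c, j, Left), (c, Suc j, Right)) else ((c, j, Right), (c, Suc j, Left)))"
  using index_decode[OF assms] corners_at by metis

lemma corners_off_bead:
  assumes "c \<le> 2" "i < ht n c" "k < 3 * c + i"
  shows "fst (cs ! k) \<notin> bead c i j \<and> snd (cs ! k) \<notin> bead c i j"
proof -
  have "k < 6 + n" using index_less[OF assms(1,2)] assms(3) by simp
  then obtain c' j' where "c' \<le> 2" "j' < ht n c'" "k = 3 * c' + j'"
    "cs ! k = (if c' = 1 then ((c', j', Left), (c', Suc j', Right)) else ((c', j', Right), (c', Suc j', Left)))"
    by (rule corner_cases)
  then show ?thesis using assms(3) by (auto simp: bead_def)
qed

lemma corner_bead:
  assumes "c \<le> 2" "i < ht n c" "i < j"
  shows "fst (cs ! (3 * c + i)) \<notin> bead c i j" "snd (cs ! (3 * c + i)) \<in> bead c i j"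
  using corners_at[OF assms(1,2)] assms(3) by (auto simp: bead_def)

text \<open>A horizontally smoothed crossing \<open>j0\<close> of a column makes the crossing \<open>i0\<close> above it a kink if
  those between them are smoothed vertically.\<close>

lemma exact_res_kink:
  assumes c: "c = 0 \<or> c = 2" "i0 < j0" "j0 < ht n c" "m = 3 * c + i0"
    and h: "\<And>u. length u = m \<Longrightarrow> hor (u @ False # suf) c j0"
      "\<And>u k. length u = m \<Longrightarrow> i0 < k \<Longrightarrow> k < j0 \<Longrightarrow> \<not> hor (u @ False # suf) c k"
    and 1: "exact_res m (True # suf) i (j + 1)"
  shows "exact_res (Suc m) suf i j"
proof -
  have c2: "c \<le> 2" "i0 < ht n c" "c \<noteq> 1" using c by auto
  show ?thesis
  proof (rule exact_res_bead[OF 1, where T = "bead c i0 j0"])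
    show "m < 6 + n" using index_less[OF c2(1,2)] c(4) by simp
    fix u :: "bool list" assume u: "length u = m"
    have "hor (u @ False # suf) c i0" using u c2(3) c(4) by (simp add: hor_def nth_append)
    then show "circ (u @ False # suf) (snd (cs ! m)) = bead c i0 j0"
      using circ_bead[OF c2(1) c(2,3) _ h(1)[OF u] h(2)[OF u] corner_bead(2)[OF c2(1,2) c(2)]] c(4) by simp
  qed (use corners_off_bead[OF c2(1,2)] corner_bead(1)[OF c2(1,2) c(2)] c(4) in auto)
qed

text \<open>In the negative column the horizontal smoothing is the 1-smoothing, so here the bead
  splits off in the 1-face.\<close>

lemma exact_res_kink1:
  assumes c: "i0 < j0" "j0 < 3" "m = 3 + i0"
    and h: "\<And>u. length u = m \<Longrightarrow> hor (u @ True # suf) 1 j0"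
      "\<And>u k. length u = m \<Longrightarrow> i0 < k \<Longrightarrow> k < j0 \<Longrightarrow> \<not> hor (u @ True # suf) 1 k"
    and 0: "exact_res m (False # suf) (i - 1) (j - 2)"
  shows "exact_res (Suc m) suf i j"
proof -
  have c2: "(1::nat) \<le> 2" "i0 < ht n 1" "j0 < ht n 1" "m = 3 * 1 + i0" using c by (auto simp: ht_def)
  show ?thesis
  proof (rule exact_res_bead1[OF 0, where T = "bead 1 i0 j0"])
    fix u :: "bool list" assume u: "length u = m"
    have "hor (u @ True # suf) 1 i0" using u c2(4) by (simp add: hor_def nth_append)
    then show "circ (u @ True # suf) (snd (cs ! m)) = bead 1 i0 j0"
      using circ_bead[OF c2(1) c(1) c2(3) _ h(1)[OF u] h(2)[OF u] corner_bead(2)[OF c2(1,2) c(1)]] c2(4) by simp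
  qed (use corners_off_bead[OF c2(1,2)] corner_bead(1)[OF c2(1,2) c(1)] c2(4) in auto)
qed

subsection \<open>The connected sum of trefoils\<close>

abbreviation "V \<equiv> replicate n True"

text \<open>One \<open>False\<close> in the positive column and one \<open>True\<close> in the
  negative column mean one horizontal crossing in each; with the third column vertical the result is
  a single circle.\<close>

lemma exact_res_unknot:
  assumes "w \<in> {[True, True, False], [True, False, True], [False, True, True]}"
    "w' \<in> {[False, False, True], [False, True, False], [True, False, False]}"
    "j - 2 * i \<noteq> 1" "j - 2 * i \<noteq> -1"
  shows "exact_res 0 (w @ w' @ V) i j"
  unfolding exact_res_def
proof (intro allI impI)
  fix F assume "fam 0 (w @ w' @ V) F"
  then have F: "F [] = circ (w @ w' @ V)" by (simp add: fam_def)
  let ?v = "w @ w' @ V"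
  have h2: "\<not> hor ?v 2 k" if "k < n" for k using assms(1,2) that by (auto simp: hor_def nth_append)
  have lt3: "k < 3 \<longleftrightarrow> k = 0 \<or> k = 1 \<or> k = (2::nat)" for k by auto
  have "\<exists>i<3. hor ?v 0 i \<and> (\<forall>k<3. k \<noteq> i \<longrightarrow> \<not> hor ?v 0 k)"
    using assms(1) unfolding lt3 by (elim insertE emptyE) (simp_all add: hor_def nth_append)
  then obtain a where a: "a < 3" "hor ?v 0 a" "\<And>k. k < 3 \<Longrightarrow> k \<noteq> a \<Longrightarrow> \<not> hor ?v 0 k" by blast
  have w3: "length w = 3" "length w' = 3" using assms(1,2) by auto
  have "hor ?v 1 k \<longleftrightarrow> w' ! k" if "k < 3" for k using that w3 by (simp add: hor_def nth_append)
  moreover have "\<exists>i<3. w' ! i \<and> (\<forall>k<3. k \<noteq> i \<longrightarrow> \<not> w' ! k)"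
    using assms(2) unfolding lt3 by (elim insertE emptyE) simp_all
  ultimately obtain b where b: "b < 3" "hor ?v 1 b" "\<And>k. k < 3 \<Longrightarrow> k \<noteq> b \<Longrightarrow> \<not> hor ?v 1 k" by blast
  have "(0, 0, Left) \<in> pts" by (simp add: pretzel_pts_iff)
  then have "exact_at pts [] F i j"
    using circ_single[OF a b h2] assms(3,4) by (intro exact_one_circle[where A = "circ ?v (2, 0, Left)"]) (auto simp: F)
  then show "exact_at pts (take 0 cs) F i j" by simp
qed

lemma gap_right: "snd (cs ! 3) \<in> gap 1" "fst (cs ! 3) \<notin> gap 1" "k < 3 \<Longrightarrow> fst (cs ! k) \<notin> gap 1 \<and> snd (cs ! k) \<notin> gap 1"
  using corners_at[of 1 0] corners_at[of 0 k] by (auto simp: gap_def ht_def nx_def)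

lemma gap_left: "snd (cs ! 0) \<in> gap 2" "fst (cs ! 0) \<notin> gap 2"
  using corners_at[of 0 0] by (auto simp: gap_def ht_def nx_def)

text \<open>A horizontal crossing in the second column and a vertical third column close the first
  column up to a trefoil. Its crossings are resolved from the bottom, and both ends of each cone lie
  on the same two diagonals.\<close>

lemma exact_res_trefoil:
  assumes w: "w \<in> {[False, False, True], [False, True, False], [True, False, False]}"
    and d: "j - 2 * i \<noteq> -1" "j - 2 * i \<noteq> -3"
  shows "exact_res 3 (w @ V) i j"
proof -
  let ?s = "w @ V"
  have E: "exact_res 0 (a # b # c # ?s) i j"
    if "[a, b, c] \<in> {[True, True, False], [True, False, True], [False, True, True]}"
      "j - 2 * i \<noteq> 1" "j - 2 * i \<noteq> -1" for a b c i j
    using exact_res_unknot[OF that(1) w that(2,3)] by simp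
  have A: "exact_res 1 (False # True # ?s) i j" if "j - 2 * i \<noteq> 0" "j - 2 * i \<noteq> -2" for i j
    unfolding One_nat_def
    by (rule exact_res_kink[of 0 0 1]) (use that in \<open>auto simp: ht_def hor_def intro!: E\<close>)
  have B: "exact_res 1 (True # False # ?s) i j" if "j - 2 * i \<noteq> 0" "j - 2 * i \<noteq> -2" for i j
    unfolding One_nat_def
    by (rule exact_res_kink[of 0 0 2]) (use that in \<open>auto simp: ht_def hor_def intro!: E\<close>)
  have C: "exact_res 2 (False # ?s) i j" if "j - 2 * i \<noteq> -1" "j - 2 * i \<noteq> -3" for i j
    unfolding numeral_2_eq_2
    by (rule exact_res_kink[of 0 1 2]) (use that in \<open>auto simp: ht_def hor_def nth_append intro!: B[unfolded One_nat_def]\<close>)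
  have h2: "\<not> hor (True # True # True # ?s) 2 k" if "k < n" for k
    using w that by (auto simp: hor_def nth_append nth_Cons')
  have h0: "\<not> hor (True # True # True # ?s) 0 k" if "k < 3" for k
    using w that by (auto simp: hor_def nth_append nth_Cons')
  \<comment> \<open>With the other two crossings vertical, the first one is a kink whose 1-smoothing
    frees the circle between the third and the first column.\<close>
  have Dd: "exact_res 1 (True # True # ?s) i j" if "j - 2 * i \<noteq> 1" "j - 2 * i \<noteq> -1" for i j
    unfolding One_nat_def
  proof (rule exact_res_bead1[where T = "gap 2"])
    fix u :: "bool list" assume "length u = 0"
    then show "circ (u @ True # True # True # ?s) (snd (cs ! 0)) = gap 2"
      using circ_gap[of 2 _ "snd (cs ! 0)"] gap_left h2 h0 by (simp add: ht_def nx_def)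
  qed (use that gap_left in \<open>auto intro!: E\<close>)
  \<comment> \<open>Two free crossings above a vertical one form the Hopf link, a cone on the
    unknots \<open>A\<close> and \<open>Dd\<close>.\<close>
  have Ee: "exact_res 2 (True # ?s) i j" if "j - 2 * i \<noteq> 0" "j - 2 * i \<noteq> -2" for i j
    unfolding numeral_2_eq_2
    by (rule exact_res_step) (use that in \<open>auto intro!: exact_res_imp_INJ A[unfolded One_nat_def] Dd[unfolded One_nat_def]\<close>)
  show ?thesis unfolding numeral_3_eq_3
    by (rule exact_res_step) (use d in \<open>auto intro!: exact_res_imp_INJ C[unfolded numeral_2_eq_2] Ee[unfolded numeral_2_eq_2]\<close>)
qed

text \<open>The same resolution for the second column, with the two smoothings exchanged: a
  horizontal crossing turns those above it into kinks and leaves the trefoil of the first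
  column.\<close>

lemma exact_res_square_knot:
  assumes d: "j - 2 * i \<noteq> -2" "j - 2 * i \<noteq> -4"
  shows "exact_res 6 V i j"
proof -
  have n: "Suc (Suc (Suc 0)) = 3" "Suc 3 = 4" "Suc 4 = 5" "Suc 5 = 6" by simp_all
  have E: "exact_res 3 (a # b # c # V) i j"
    if "[a, b, c] \<in> {[False, False, True], [False, True, False], [True, False, False]}"
      "j - 2 * i \<noteq> -1" "j - 2 * i \<noteq> -3" for a b c i j
    using exact_res_trefoil[OF that] by simp
  have A: "exact_res 4 (False # True # V) i j" if "j - 2 * i \<noteq> -1" "j - 2 * i \<noteq> -3" for i j
    unfolding n(2)[symmetric]
    by (rule exact_res_kink1[of 0 2]) (use that in \<open>auto simp: hor_def nth_append nth_Cons' intro!: E\<close>)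
  have B: "exact_res 5 (True # V) i j" if "j - 2 * i \<noteq> -1" "j - 2 * i \<noteq> -3" for i j
    unfolding n(3)[symmetric]
    by (rule exact_res_kink1[of 1 2]) (use that in \<open>auto simp: hor_def nth_append nth_Cons' intro!: A\<close>)
  have C: "exact_res 4 (True # False # V) i j" if "j - 2 * i \<noteq> -1" "j - 2 * i \<noteq> -3" for i j
    unfolding n(2)[symmetric]
    by (rule exact_res_kink1[of 0 1]) (use that in \<open>auto simp: hor_def nth_append nth_Cons' intro!: E\<close>)
  \<comment> \<open>With the other two crossings of the column vertical, the 0-smoothing frees the
    circle between the second and the third column, and the 1-smoothing is again the
    trefoil.\<close>
  have Dd: "exact_res 4 (False # False # V) i j" if "j - 2 * i \<noteq> -2" "j - 2 * i \<noteq> -4" for i j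
    unfolding n(2)[symmetric]
  proof (rule exact_res_bead[where T = "gap 1"])
    fix u :: "bool list" assume u: "length u = 3"
    have "\<not> hor (u @ False # False # False # V) 1 k" if "k < 3" for k
      using that u by (auto simp: hor_def nth_append nth_Cons')
    moreover have "\<not> hor (u @ False # False # False # V) 2 k" if "k < n" for k
      using that u by (auto simp: hor_def nth_append nth_Cons')
    ultimately show "circ (u @ False # False # False # V) (snd (cs ! 3)) = gap 1"
      using circ_gap[of 1 _ "snd (cs ! 3)"] gap_right(1) by (simp add: ht_def nx_def numeral_2_eq_2)
  qed (use that gap_right in \<open>auto intro!: E\<close>)
  have Ee: "exact_res 5 (False # V) i j" if "j - 2 * i \<noteq> -2" "j - 2 * i \<noteq> -4" for i j
    unfolding n(3)[symmetric] by (rule exact_res_step) (use that in \<open>auto intro!: exact_res_imp_INJ C Dd\<close>)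
  show ?thesis unfolding n(4)[symmetric] by (rule exact_res_step) (use d in \<open>auto intro!: exact_res_imp_INJ B Ee\<close>)
qed

end

context pretzel_knot
begin

subsection \<open>The unlink\<close>

text \<open>Here the last \<open>3 - s\<close> crossings of the first two columns are smoothed vertically, and \<open>suf\<close>
  describes the third column.\<close>

definition unlink_fam :: "nat \<Rightarrow> bool list \<Rightarrow> pretzel_point family \<Rightarrow> bool" where
  "unlink_fam s suf F \<longleftrightarrow> (\<forall>u. length u = 2 * s \<longrightarrow>
     F u = circ (take s u @ replicate (3 - s) True @ drop s u @ replicate (3 - s) False @ suf))"

definition unlink_corners :: "nat \<Rightarrow> (pretzel_point \<times> pretzel_point) list" where
  "unlink_corners s = take s cs @ take s (drop 3 cs)"

lemma hor_pattern:
  fixes u suf :: "bool list" and b b' :: bool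
  assumes "length u = 2 * r" "r < 3"
  defines "v \<equiv> take r u @ b # replicate (2 - r) True @ drop r u @ b' # replicate (2 - r) False @ suf"
  shows "hor v 0 r = (\<not> b)" "r < k \<Longrightarrow> k < 3 \<Longrightarrow> \<not> hor v 0 k" "hor v 1 r = b'"
    "r < k \<Longrightarrow> k < 3 \<Longrightarrow> \<not> hor v 1 k" "hor v 2 k = (\<not> suf ! k)"
proof -
  have l: "length (take r u) = r" "length (drop r u) = r" using assms by auto
  show "hor v 0 r = (\<not> b)" unfolding v_def hor_def using l by (simp add: nth_append)
  show "r < k \<Longrightarrow> k < 3 \<Longrightarrow> \<not> hor v 0 k" unfolding v_def hor_def using l by (auto simp: nth_append nth_Cons')
  show "hor v 1 r = b'" unfolding v_def hor_def using l assms(2) by (auto simp: nth_append nth_Cons')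
  show "r < k \<Longrightarrow> k < 3 \<Longrightarrow> \<not> hor v 1 k" unfolding v_def hor_def using l assms(2) by (auto simp: nth_append nth_Cons')
  have "r + Suc (2 - r + (r + Suc (2 - r))) = 6" using assms(2) by simp
  then have "length (take r u @ b # replicate (2 - r) True @ drop r u @ b' # replicate (2 - r) False) = 6" using l by simp
  then have "v ! (6 + k) = suf ! k"
    using nth_append_length_plus[of "take r u @ b # replicate (2 - r) True @ drop r u @ b' # replicate (2 - r) False" suf k]
    by (simp add: v_def)
  then show "hor v 2 k = (\<not> suf ! k)" by (simp add: hor_def)
qed

text \<open>Each type II move cancels the lowest remaining crossings of the first two columns. Both
  \<open>inn\<close> and \<open>out\<close> lie on the bigon circle, and after the move they lie on
  the two different strands of the first column, so each move exchanges them. The choice by the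
  parity of \<open>s\<close> makes the marked point arrive at \<open>inn\<close> for
  \<open>s = 0\<close>, off the circle of \<open>(2, 0, Right)\<close>.\<close>

lemma inj_unlink_fam:
  assumes suf: "length suf = n" "h < n" "\<not> suf ! h" "\<And>k. k < n \<Longrightarrow> k \<noteq> h \<Longrightarrow> suf ! k"
  defines "out \<equiv> (2, Suc h, Left) :: pretzel_point" and "inn \<equiv> (0, 3, Right) :: pretzel_point"
  shows "s \<le> 3 \<Longrightarrow> unlink_fam s suf F \<Longrightarrow> good_cube pts (unlink_corners s) F \<Longrightarrow> j - 2 * i + int s \<noteq> 0 \<Longrightarrow> j - 2 * i + int s \<noteq> -2 \<Longrightarrow>
    inj_XX pts (unlink_corners s) F (2, 0, Right) (if odd s then out else inn) i j"
proof (induction s arbitrary: F i j)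
  case 0
  let ?v = "replicate 3 True @ replicate 3 False @ suf"
  let ?t = "(2, 0, Right) :: pretzel_point"
  have F: "F [] = circ ?v" using "0.prems"(2) by (simp add: unlink_fam_def)
  have h0: "\<not> hor ?v 0 k" "\<not> hor ?v 1 k" if "k < 3" for k using that by (auto simp: hor_def nth_append)
  have h2: "hor ?v 2 k = (\<not> suf ! k)" for k by (simp add: hor_def nth_append)
  have pin: "inn \<in> pts" "?t \<in> pts" by (simp_all add: inn_def pretzel_pts_iff ht_def)
  \<comment> \<open>One circle of the crossingless unlink runs between the first two columns; the
    facts \<open>t0\<close> to \<open>t3\<close> put all other points on the circle of
    \<open>?t\<close>.\<close>
  have gap: "circ ?v p = gap 0" if "p \<in> gap 0" for p
    using circ_gap[of 0 ?v p] h0 that by (simp add: ht_def nx_def)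
  have "inn \<in> gap 0" by (simp add: inn_def gap_def ht_def)
  have ig: "circ ?v inn = gap 0" using gap[OF \<open>inn \<in> gap 0\<close>] .
  have t0: "circ ?v (0, 0, Left) = circ ?v ?t" using circ_top[of 2 ?v] by (simp add: nx_def)
  have t1: "circ ?v (0, k, Left) = circ ?v ?t" if "k \<le> 3" for k
    using circ_run[of 0 k 0 ?v Left] h0(1) that t0 by (simp add: ht_def)
  have t2: "circ ?v (2, k, s) = circ ?v ?t" if "k \<le> n" for k s
  proof (cases "k \<le> h")
    case True
    have "circ ?v (2, k, s) = circ ?v (2, h, s)"
      by (rule circ_run[symmetric]) (use True suf h2 in \<open>auto simp: ht_def\<close>)
    also have "\<dots> = circ ?v (2, h, Right)" by (rule circ_hor(1)) (use suf h2 in \<open>auto simp: ht_def\<close>)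
    also have "\<dots> = circ ?v ?t" by (rule circ_run) (use suf h2 in \<open>auto simp: ht_def\<close>)
    finally show ?thesis .
  next
    case False
    have "circ ?v (2, k, s) = circ ?v (2, Suc h, s)"
      by (rule circ_run) (use False that suf h2 in \<open>auto simp: ht_def\<close>)
    also have "\<dots> = circ ?v (2, Suc h, Right)" by (rule circ_hor(2)) (use suf h2 in \<open>auto simp: ht_def\<close>)
    also have "\<dots> = circ ?v (2, n, Right)" by (rule circ_run[symmetric]) (use suf h2 in \<open>auto simp: ht_def\<close>)
    also have "\<dots> = circ ?v (0, 3, Left)" using circ_bot[of 2 ?v] by (simp add: nx_def ht_def)
    finally show ?thesis using t1[of 3] by simp
  qed
  have t3: "circ ?v (1, k, Right) = circ ?v ?t" if "k \<le> 3" for k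
    using circ_run[of 0 k 1 ?v Right] h0(2) that circ_top[of 1 ?v] t2[of 0 Left] by (simp add: ht_def nx_def numeral_2_eq_2)
  have two: "circ ?v p = circ ?v ?t \<or> circ ?v p = circ ?v inn" if "p \<in> pts" for p
  proof -
    obtain c k s where p: "p = (c, k, s)" by (cases p)
    then have ck: "c \<le> 2" "k \<le> ht n c" using that by (simp_all add: pretzel_pts_iff)
    show ?thesis
    proof (cases "p \<in> gap 0")
      case False
      then show ?thesis using p ck t1[of k] t2[of k s] t3[of k]
        unfolding le2 p gap_def ht_def nx_def by (elim disjE; cases s; simp)
    qed (use gap ig in simp)
  qed
  have im: "circ ?v ` pts = {circ ?v ?t, circ ?v inn}"
  proof (intro equalityI subsetI)
    fix C assume "C \<in> circ ?v ` pts"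
    then obtain p where "p \<in> pts" "C = circ ?v p" by (rule imageE)
    then show "C \<in> {circ ?v ?t, circ ?v inn}" using two[of p] by simp
  next
    fix C assume "C \<in> {circ ?v ?t, circ ?v inn}"
    then show "C \<in> circ ?v ` pts" using imageI[OF pin(1), of "circ ?v"] imageI[OF pin(2), of "circ ?v"] by (elim insertE emptyE) simp_all
  qed
  have ne: "circ ?v ?t \<noteq> circ ?v inn"
  proof
    assume e: "circ ?v ?t = circ ?v inn"
    have "?t \<in> gap 0" using circ_refl[of ?t ?v] unfolding e ig .
    then show False by (simp add: gap_def nx_def)
  qed
  have "inj_XX pts [] F ?t inn i j"
  proof (rule inj_XX_two_circles[OF pin(2,1)])
    show "F [] ?t \<noteq> F [] inn" unfolding F by (rule ne)
    show "F [] ` pts = {F [] ?t, F [] inn}" unfolding F by (rule im)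
  qed (use "0.prems"(4,5) in simp_all)
  then show ?case by (simp add: unlink_corners_def)
next
  case (Suc r)
  have r: "r < 3" using Suc.prems(1) by simp
  let ?t = "(2, 0, Right) :: pretzel_point"
  \<comment> \<open>When both lowest crossings are horizontal, the bigon circle also passes through
    the part of the third column below its horizontal crossing \<open>h\<close>.\<close>
  let ?T = "floor_circ r h"
  let ?A = "take r cs" and ?B = "take r (drop 3 cs)"
  have lc: "length ?A = r" "length ?B = r" "length cs = 6 + n" using r length_corners by auto
  have c2: "unlink_corners (Suc r) = ?A @ cs ! r # ?B @ [cs ! (3 + r)]" "unlink_corners r = ?A @ ?B"
    using r lc(3) by (simp_all add: unlink_corners_def take_Suc_conv_app_nth)
  have dl: "del (Suc (2 * r)) (unlink_corners (Suc r)) = ?A @ cs ! r # ?B" "unlink_corners (Suc r) ! Suc (2 * r) = cs ! (3 + r)"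
    unfolding c2 del_def using lc by (simp_all add: nth_append mult_2)
  have dk: "del r (?A @ cs ! r # ?B) = unlink_corners r" "(?A @ cs ! r # ?B) ! r = cs ! r"
    unfolding c2 del_def using lc by (simp_all add: nth_append)
  have co: "cs ! r = ((0, r, Right), (0, Suc r, Left))" "cs ! (3 + r) = ((1, r, Left), (1, Suc r, Right))"
    using corners_at[of 0 r] corners_at[of 1 r] r by (simp_all add: ht_def)
  have cr: "del (Suc (2 * r)) (unlink_corners (Suc r)) ! r = ((0, r, Right), (0, Suc r, Left))"
    "unlink_corners (Suc r) ! Suc (2 * r) = ((1, r, Left), (1, Suc r, Right))"
    "del r (del (Suc (2 * r)) (unlink_corners (Suc r))) = unlink_corners r"
    unfolding dl dk by (rule co)+ (rule refl)
  have inT: "(0, Suc r, Left) \<in> ?T" "(1, Suc r, Right) \<in> ?T" using r by (simp_all add: floor_circ_def)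
  let ?v = "\<lambda>u b b'. take r u @ b # replicate (2 - r) True @ drop r u @ b' # replicate (2 - r) False @ suf"
  have F: "F (ins (Suc (2 * r)) b' (ins r b u)) = circ (?v u b b')" if "length u = 2 * r" for u b b'
  proof -
    have i: "ins (Suc (2 * r)) b' (ins r b u) = take r u @ b # drop r u @ [b']"
      using that by (simp add: ins_def)
    have "Suc (2 - r) = 3 - r" "3 - Suc r = 2 - r" using r by simp_all
    then show ?thesis using Suc.prems(2) that unfolding unlink_fam_def i by simp
  qed
  have floor: "circ (?v u False True) p = ?T" if "length u = 2 * r" "p \<in> ?T" for u p
    using circ_floor[of r _ h p] r hor_pattern[OF that(1) r, where b = False and b' = True and suf = suf] suf that(2) by simp
  have offc: "fst (unlink_corners r ! m) \<notin> ?T \<and> snd (unlink_corners r ! m) \<notin> ?T" if "m < 2 * r" for m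
  proof (cases "m < r")
    case True
    then show ?thesis using corners_at[of 0 m] r lc by (auto simp: c2 nth_append ht_def floor_circ_def)
  next
    case False
    then have "m - r < r" using that by simp
    then show ?thesis using corners_at[of 1 "m - r"] r lc False by (auto simp: c2 nth_append ht_def floor_circ_def)
  qed
  \<comment> \<open>The positions \<open>Suc (2 * r)\<close> and \<open>r\<close> belong to the
    lowest crossings of the second and the first column. Horizontal is 1 in the second and 0 in the
    first, so \<open>F01\<close> is the bigon state and \<open>F10\<close> the vertical one.\<close>
  interpret square pts "unlink_corners (Suc r)" F "Suc (2 * r)" r "2 * r" ?T
  proof unfold_locales
    show "good_cube pts (unlink_corners (Suc r)) F" by (rule Suc.prems(3))
    show "length (unlink_corners (Suc r)) = Suc (Suc (2 * r))" using lc by (simp add: c2)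
    show "length u = 2 * r \<Longrightarrow> F (ins (Suc (2 * r)) True (ins r False u)) (snd (del (Suc (2 * r)) (unlink_corners (Suc r)) ! r)) = ?T" for u
      unfolding cr snd_conv by (simp only: F floor inT)
    show "length u = 2 * r \<Longrightarrow> F (ins (Suc (2 * r)) True (ins r False u)) (snd (unlink_corners (Suc r) ! Suc (2 * r))) = ?T" for u
      unfolding cr snd_conv by (simp only: F floor inT)
    show "m < 2 * r \<Longrightarrow> fst (del r (del (Suc (2 * r)) (unlink_corners (Suc r))) ! m) \<notin> ?T \<and>
        snd (del r (del (Suc (2 * r)) (unlink_corners (Suc r))) ! m) \<notin> ?T" for m
      unfolding cr by (rule offc)
  qed (simp_all add: cr floor_circ_def)
  \<comment> \<open>With crossing \<open>r\<close> of the first column vertical, \<open>inn\<close>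
    follows its right strand up to the first corner, and \<open>out\<close> runs around the bottom
    of the diagram to its left strand and the second corner.\<close>
  have far: "F10 u inn = F10 u (0, r, Right) \<and> F10 u out = F10 u (0, Suc r, Left)" if u: "length u = 2 * r" for u
  proof -
    let ?w = "?v u True False"
    note H = hor_pattern[OF u r, where b = True and b' = False and suf = suf]
    have v0: "\<not> hor ?w 0 k" if "r \<le> k" "k < 3" for k using H(1) H(2)[of k] that by (cases "k = r") auto
    have "circ ?w (0, 3, Right) = circ ?w (0, r, Right)"
      by (rule circ_run) (use r v0 in \<open>auto simp: ht_def\<close>)
    moreover have "circ ?w (2, Suc h, Left) = circ ?w (0, Suc r, Left)"
    proof -
      have "circ ?w (2, Suc h, Left) = circ ?w (2, Suc h, Right)" by (rule circ_hor(2)) (use suf H(5) in \<open>auto simp: ht_def\<close>)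
      also have "\<dots> = circ ?w (2, n, Right)" by (rule circ_run[symmetric]) (use suf H(5) in \<open>auto simp: ht_def\<close>)
      also have "\<dots> = circ ?w (0, 3, Left)" using circ_bot[of 2 ?w] by (simp add: nx_def ht_def)
      also have "\<dots> = circ ?w (0, Suc r, Left)" by (rule circ_run) (use r v0 in \<open>auto simp: ht_def\<close>)
      finally show ?thesis .
    qed
    ultimately show ?thesis unfolding F[OF u] inn_def out_def by simp
  qed
  have "unlink_fam r suf F10"
  proof -
    have "Suc (2 - r) = 3 - r" using r by simp
    then have "replicate (3 - r) x = x # replicate (2 - r) x" for x :: bool by (metis replicate_Suc)
    then show ?thesis unfolding unlink_fam_def by (simp add: F)
  qed
  moreover have "good_cube pts (unlink_corners r) F10" using i0.good01[of True] unfolding cr .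
  ultimately have IH: "inj_XX pts (unlink_corners r) F10 ?t (if odd r then out else inn) (i - 1) (j - 1)"
    using Suc.IH[of F10 "j - 1" "i - 1"] Suc.prems r by (simp add: algebra_simps)
  show ?case
  proof (rule inj_XX_square[of ?t "if odd r then out else inn"])
    show "inj_XX pts (del r (del (Suc (2 * r)) (unlink_corners (Suc r)))) F10 ?t (if odd r then out else inn) (i - 1) (j - 1)"
      unfolding cr by (rule IH)
    show "F10 v (if odd (Suc r) then out else inn) = F10 v (fst (del (Suc (2 * r)) (unlink_corners (Suc r)) ! r)) \<and>
        F10 v (if odd r then out else inn) = F10 v (snd (del (Suc (2 * r)) (unlink_corners (Suc r)) ! r)) \<or>
       F10 v (if odd (Suc r) then out else inn) = F10 v (snd (del (Suc (2 * r)) (unlink_corners (Suc r)) ! r)) \<and>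
        F10 v (if odd r then out else inn) = F10 v (fst (del (Suc (2 * r)) (unlink_corners (Suc r)) ! r))" if "length v = 2 * r" for v
      unfolding cr fst_conv snd_conv using far[OF that] by (cases "odd r") auto
  qed (use r suf in \<open>auto simp: out_def inn_def pretzel_pts_iff ht_def floor_circ_def\<close>)
qed

lemma inj_res_unlink:
  assumes "length suf = n" "h < n" "\<not> suf ! h" "\<And>k. k < n \<Longrightarrow> k \<noteq> h \<Longrightarrow> suf ! k"
    "j - 2 * i \<noteq> -3" "j - 2 * i \<noteq> -5"
  shows "inj_res 6 suf (2, 0, Right) (2, Suc h, Left) i j"
  unfolding inj_res_def
proof (intro allI impI)
  fix F assume F: "fam 6 suf F"
  have "take 6 cs = unlink_corners 3" using take_add[of 3 3 cs] by (simp add: unlink_corners_def)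
  moreover have "unlink_fam 3 suf F"
    unfolding unlink_fam_def
  proof (intro allI impI)
    fix u :: "bool list" assume "length u = 2 * 3"
    then have "F u = circ (u @ suf)" using F by (simp add: fam_def)
    then show "F u = circ (take 3 u @ replicate (3 - 3) True @ drop 3 u @ replicate (3 - 3) False @ suf)"
      by (simp flip: append_assoc)
  qed
  ultimately show "inj_XX pts (take 6 cs) F (2, 0, Right) (2, Suc h, Left) i j"
    using inj_unlink_fam[OF assms(1-4), of 3 F j i] fam_good[OF F] assms(5,6) by simp
qed

text \<open>In the third column the free crossings above the horizontal crossing \<open>h\<close>
  are kinks. Removing the lowest one trades the marked point on its bead for the corner above, so
  the point climbs to \<open>(2, 0, Right)\<close>, while the point below \<open>h\<close> stays
  fixed.\<close>

lemma inj_res_unlink_kinks: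
  assumes "k \<le> h" "h < n" "j - 2 * i + int k \<noteq> -3" "j - 2 * i + int k \<noteq> -5"
  shows "inj_res (6 + k) (replicate (h - k) True @ False # replicate (n - Suc h) True) (2, k, Right) (2, Suc h, Left) i j"
  using assms
proof (induction k arbitrary: i j)
  case 0
  show ?case
    using inj_res_unlink[of "replicate h True @ False # replicate (n - Suc h) True" h j i] 0
    by (simp add: nth_append nth_Cons')
next
  case (Suc k)
  let ?s = "replicate (h - Suc k) True @ False # replicate (n - Suc h) True"
  have k: "k < ht n 2" "h < ht n 2" "k < h" using Suc.prems by (simp_all add: ht_def)
  have co: "cs ! (6 + k) = ((2, k, Right), (2, Suc k, Left))" using corners_at[of 2 k] k by simp
  have s: "True # ?s = replicate (h - k) True @ False # replicate (n - Suc h) True"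
    using k(3) by (metis Suc_diff_Suc append_Cons replicate_Suc)
  have "inj_res (Suc (6 + k)) ?s (2, Suc k, Right) (2, Suc h, Left) i j"
  proof (rule inj_res_bead[where p' = "(2, k, Right)" and T = "bead 2 k h"])
    show "inj_res (6 + k) (True # ?s) (2, k, Right) (2, Suc h, Left) i (j + 1)"
      unfolding s by (rule Suc.IH) (use Suc.prems in \<open>auto simp: algebra_simps\<close>)
    fix u :: "bool list" assume u: "length u = 6 + k"
    have "hor (u @ False # ?s) 2 k" "hor (u @ False # ?s) 2 h"
      using u k(3) by (auto simp: hor_def nth_append nth_Cons')
    moreover have "\<not> hor (u @ False # ?s) 2 l" if "k < l" "l < h" for l
      using u that by (auto simp: hor_def nth_append nth_Cons')
    ultimately show "circ (u @ False # ?s) (snd (cs ! (6 + k))) = bead 2 k h"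
      using circ_bead[of 2 k h "u @ False # ?s" "snd (cs ! (6 + k))"] k by (simp add: co bead_def)
  next
    show "fst (cs ! l) \<notin> bead 2 k h \<and> snd (cs ! l) \<notin> bead 2 k h" if "l < 6 + k" for l
      using corners_off_bead[of 2 k l h] k that by simp
  qed (use k in \<open>auto simp: co bead_def pretzel_pts_iff\<close>)
  then show ?case by simp
qed

subsection \<open>The pretzel knots\<close>

text \<open>With \<open>m\<close> free crossings and the rest of the third column vertical, the
  diagram is that of P(3, -3, m). Each further crossing shifts the two diagonals by one in the
  grading j - 2i of the unshifted complex.\<close>

lemma exact_res_pretzel:
  assumes "m \<le> n" "j - 2 * i + int m \<noteq> -2" "j - 2 * i + int m \<noteq> -4"
  shows "exact_res (6 + m) (replicate (n - m) True) i j"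
  using assms
proof (induction m arbitrary: i j)
  case 0
  then show ?case using exact_res_square_knot[of j i] by simp
next
  case (Suc m)
  have m: "m < n" using Suc.prems by simp
  have s: "True # replicate (n - Suc m) True = replicate (n - m) True" using m by (metis Suc_diff_Suc replicate_Suc)
  have co: "cs ! (6 + m) = ((2, m, Right), (2, Suc m, Left))" using corners_at[of 2 m] m by (simp add: ht_def)
  have "exact_res (Suc (6 + m)) (replicate (n - Suc m) True) i j"
  proof (rule exact_res_step)
    \<comment> \<open>The corners of the crossing being resolved are the two marked points of the
      unlink for h = k = m.\<close>
    show "inj_res (6 + m) (False # replicate (n - Suc m) True) (fst (cs ! (6 + m))) (snd (cs ! (6 + m))) i j"
      using inj_res_unlink_kinks[of m m j i] m Suc.prems by (simp add: co)
    show "exact_res (6 + m) (True # replicate (n - Suc m) True) (i - 1) (j - 1)"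
      unfolding s by (rule Suc.IH) (use Suc.prems in \<open>auto simp: algebra_simps\<close>)
  qed
  then show ?case by simp
qed

lemma trivial_H_bar_pretzel:
  assumes "j - 2 * i + int n \<noteq> -2" "j - 2 * i + int n \<noteq> -4"
  shows "trivial_group (H_bar D i j)"
proof (rule trivial_H_bar)
  have "fam (6 + n) [] circ" by (simp add: fam_def)
  then show "exact_at (points D) cs circ i j"
    using exact_res_pretzel[of n j i] assms length_corners by (auto simp: exact_res_def points_D)
qed

end

theorem corollary2:
  fixes q :: int and ori :: "strand \<Rightarrow> bool"
  assumes "q \<ge> 4"
    and "is_orientation (pretzel 3 (-3) q) ori"
  shows "Kh_thin (pretzel 3 (-3) q) ori"
proof -
  interpret pretzel_knot q by unfold_locales (use assms(1) in simp)
  \<comment> \<open>In j - 2i the two shifts by the negative crossings cancel. What remains is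
    \<open>n_pos\<close>, and the diagonals -2 and -4 of the square knot have the midpoint
    -3.\<close>
  define s where "s = int (n_pos D ori) - 3 - int n"
  show ?thesis
    unfolding Kh_thin_def Kh_def
    by (rule exI[of _ s]) (auto intro!: trivial_H_bar_pretzel simp: s_def)
qed

end
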